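(* For any integer $n\geq 2$, there exists a complete $n$-dimensional Riemannian manifold $(M,g)$ such that for any integer $k\geq 2$ and any real $p\geq 2$, the space $C^\infty_c(M)$ of smooth compactly supported functions on $M$ is not dense in $W^{k,p}(M)$ with respect to the norm $\|\cdot\|_{W^{k,p}}$.
   Context: Riemannian manifolds $(M,g)$ are smooth and without boundary (possibly non-compact); $\mu_g$ denotes the Riemannian measure and $\nabla$ the Levi-Civita covariant derivative. For an integer $k\geq 0$ and a real $p\geq 1$, the Sobolev space $W^{k,p}(M)=W^{k,p}(M,g)$ is the space of functions $u$ on $M$ all of whose (distributional) covariant derivatives $\nabla^j u$ of order $j$ are tensor fields with finite $L^p$-norm, for $0\leq j\leq k$. It is a Banach space with the norm $$\|u\|_{W^{k,p}} = \sum_{j=0}^{k}\left(\int_M |\nabla^j u|^p\,d\mu_g\right)^{1/p}.$$ *)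

theory Defs
  imports "HOL-Analysis.Analysis"
begin

section \<open>Smooth functions on open subsets of Euclidean space\<close>

definition pd :: "'n::finite \<Rightarrow> (real^'n \<Rightarrow> real) \<Rightarrow> real^'n \<Rightarrow> real" where
  "pd i f x = frechet_derivative f (at x) (axis i 1)"

text \<open>Only meant for open \<open>S\<close>. All iterated partial derivatives are (totally) differentiable,
  hence continuous, so this is \<open>C\<^sup>\<infinity>\<close>.\<close>

definition smooth_on :: "(real^'n::finite) set \<Rightarrow> (real^'n \<Rightarrow> real) \<Rightarrow> bool" where
  "smooth_on S f \<longleftrightarrow> (\<forall>is. \<forall>x\<in>S. foldr pd is f differentiable (at x))"

definition test_functions :: "(real^'n::finite) set \<Rightarrow> (real^'n \<Rightarrow> real) set" where
  "test_functions S =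
     {\<psi>. smooth_on UNIV \<psi> \<and> (\<exists>K. compact K \<and> K \<subseteq> S \<and> (\<forall>x. x \<notin> K \<longrightarrow> \<psi> x = 0))}"


section \<open>Smooth manifolds\<close>

text \<open>A chart is a pair of a coordinate domain and a coordinate map; the values of the map outside
  the domain are irrelevant. The dimension is \<open>CARD('n)\<close>.\<close>

type_synonym ('a, 'n) chart = "'a set \<times> ('a \<Rightarrow> real^'n)"

definition cimg :: "('a, 'n::finite) chart \<Rightarrow> (real^'n) set" where
  "cimg c = snd c ` fst c"

definition cinv :: "('a, 'n::finite) chart \<Rightarrow> real^'n \<Rightarrow> 'a" where
  "cinv c = inv_into (fst c) (snd c)"

definition is_chart :: "'a topology \<Rightarrow> ('a, 'n::finite) chart \<Rightarrow> bool" where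
  "is_chart X c \<longleftrightarrow> openin X (fst c) \<and> open (cimg c) \<and>
     homeomorphic_map (subtopology X (fst c)) (top_of_set (cimg c)) (snd c)"

text \<open>The atlas is not required to be maximal: the notions below are independent of the choice of
  an atlas within a smooth structure.\<close>

definition smooth_atlas :: "'a topology \<Rightarrow> ('a, 'n::finite) chart set \<Rightarrow> bool" where
  "smooth_atlas X A \<longleftrightarrow>
     (\<forall>c\<in>A. is_chart X c) \<and> (\<Union>c\<in>A. fst c) = topspace X \<and>
     (\<forall>c\<in>A. \<forall>d\<in>A. \<forall>i. smooth_on (snd c ` (fst c \<inter> fst d)) (\<lambda>x. snd d (cinv c x) $ i))"

text \<open>The points form a subset of an arbitrary type, and the topology is part of the data. Every
  manifold of dimension \<open>CARD('n) \<ge> 1\<close> has at most the cardinality of the continuum, so that each one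
  has an isomorphic copy whose points are elements of \<open>real^'n\<close>: for such manifolds, existence over
  this point type is existence of a manifold without restriction. (The topology of the copy
  need not be related to that of \<open>real^'n\<close>.)

  Connectedness is part of the definition, as usual in Riemannian geometry; it makes the
  Riemannian distance finite.\<close>

definition smooth_manifold :: "'a topology \<Rightarrow> ('a, 'n::finite) chart set \<Rightarrow> bool" where
  "smooth_manifold X A \<longleftrightarrow>
     Hausdorff_space X \<and> second_countable X \<and> connected_space X \<and> smooth_atlas X A"

definition smooth_fun :: "('a, 'n::finite) chart set \<Rightarrow> ('a \<Rightarrow> real) \<Rightarrow> bool" where
  "smooth_fun A f \<longleftrightarrow> (\<forall>c\<in>A. smooth_on (cimg c) (f \<circ> cinv c))"

definition smooth_compact_support ::
  "'a topology \<Rightarrow> ('a, 'n::finite) chart set \<Rightarrow> ('a \<Rightarrow> real) set" where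
  "smooth_compact_support X A =
     {f. smooth_fun A f \<and> compactin X (X closure_of {p \<in> topspace X. f p \<noteq> 0})}"


section \<open>Covariant tensor fields\<close>

text \<open>A (not necessarily continuous) covariant tensor field is given by its components:
  \<open>T c p [i\<^sub>1, \<dots>, i\<^sub>j]\<close> is the component at the point \<open>p\<close>, with respect to the coordinates of
  the chart \<open>c\<close>, of a tensor of rank \<open>j\<close>.\<close>

type_synonym ('a, 'n) tensor = "('a, 'n) chart \<Rightarrow> 'a \<Rightarrow> 'n list \<Rightarrow> real"

text \<open>\<open>jacobian c d p $ a $ b\<close> is \<open>\<partial>y\<^sub>a/\<partial>x\<^sub>b\<close> at \<open>p\<close>, for \<open>x\<close> the coordinates of \<open>c\<close> and \<open>y\<close>
  those of \<open>d\<close>.\<close>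

definition jacobian ::
  "('a, 'n::finite) chart \<Rightarrow> ('a, 'n) chart \<Rightarrow> 'a \<Rightarrow> real^'n^'n" where
  "jacobian c d p = matrix (frechet_derivative (snd d \<circ> cinv c) (at (snd c p)))"

definition tensor_field ::
  "('a, 'n::finite) chart set \<Rightarrow> nat \<Rightarrow> ('a, 'n) tensor \<Rightarrow> bool" where
  "tensor_field A j T \<longleftrightarrow>
     (\<forall>c\<in>A. \<forall>d\<in>A. \<forall>p \<in> fst c \<inter> fst d. \<forall>I. length I = j \<longrightarrow>
        T c p I = (\<Sum>J | length J = j. (\<Prod>s<j. jacobian c d p $ (J ! s) $ (I ! s)) * T d p J))"


section \<open>Riemannian metrics\<close>

text \<open>\<open>G c p\<close> is the Gram matrix of the metric at \<open>p\<close> in the coordinates of \<open>c\<close>.\<close>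

type_synonym ('a, 'n) metric_comps = "('a, 'n) chart \<Rightarrow> 'a \<Rightarrow> real^'n^'n"

definition riemannian_metric ::
  "('a, 'n::finite) chart set \<Rightarrow> ('a, 'n) metric_comps \<Rightarrow> bool" where
  "riemannian_metric A G \<longleftrightarrow>
     tensor_field A 2 (\<lambda>c p I. G c p $ (I ! 0) $ (I ! 1)) \<and>
     (\<forall>c\<in>A. \<forall>i j. smooth_on (cimg c) (\<lambda>x. G c (cinv c x) $ i $ j)) \<and>
     (\<forall>c\<in>A. \<forall>p\<in>fst c. transpose (G c p) = G c p \<and> (\<forall>v. v \<noteq> 0 \<longrightarrow> v \<bullet> (G c p *v v) > 0))"

definition riemannian_manifold ::
  "'a topology \<Rightarrow> ('a, 'n::finite) chart set \<Rightarrow> ('a, 'n) metric_comps \<Rightarrow> bool" where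
  "riemannian_manifold X A G \<longleftrightarrow> smooth_manifold X A \<and> riemannian_metric A G"

text \<open>Chart-independent quantities at a point are evaluated in an arbitrary chart around it.\<close>

definition chart_at :: "('a, 'n::finite) chart set \<Rightarrow> 'a \<Rightarrow> ('a, 'n) chart" where
  "chart_at A p = (SOME c. c \<in> A \<and> p \<in> fst c)"


subsection \<open>Riemannian distance and completeness\<close>

text \<open>Curves that are \<open>C\<^sup>1\<close> up to finitely many times. No one-sided limits of the velocity are
  required; the curves of finite length are then still absolutely continuous, so that the
  infimum of the lengths is the usual one.\<close>

definition piecewise_C1_path ::
  "'a topology \<Rightarrow> ('a, 'n::finite) chart set \<Rightarrow> (real \<Rightarrow> 'a) \<Rightarrow> bool" where
  "piecewise_C1_path X A \<gamma> \<longleftrightarrow> pathin X \<gamma> \<and>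
     (\<exists>S. finite S \<and>
        (\<forall>c\<in>A. (snd c \<circ> \<gamma>) C1_differentiable_on {t. 0 < t \<and> t < 1 \<and> t \<notin> S \<and> \<gamma> t \<in> fst c}))"

definition speed ::
  "('a, 'n::finite) chart set \<Rightarrow> ('a, 'n) metric_comps \<Rightarrow> (real \<Rightarrow> 'a) \<Rightarrow> real \<Rightarrow> real" where
  "speed A G \<gamma> t =
     (let c = chart_at A (\<gamma> t); v = vector_derivative (snd c \<circ> \<gamma>) (at t)
      in sqrt (v \<bullet> (G c (\<gamma> t) *v v)))"

definition path_len ::
  "('a, 'n::finite) chart set \<Rightarrow> ('a, 'n) metric_comps \<Rightarrow> (real \<Rightarrow> 'a) \<Rightarrow> ennreal" where
  "path_len A G \<gamma> = (\<integral>\<^sup>+t\<in>{0..1}. ennreal (speed A G \<gamma> t) \<partial>lborel)"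

definition riem_dist ::
  "'a topology \<Rightarrow> ('a, 'n::finite) chart set \<Rightarrow> ('a, 'n) metric_comps \<Rightarrow> 'a \<Rightarrow> 'a \<Rightarrow> real" where
  "riem_dist X A G p q =
     enn2real (INF \<gamma> \<in> {\<gamma>. piecewise_C1_path X A \<gamma> \<and> \<gamma> 0 = p \<and> \<gamma> 1 = q}. path_len A G \<gamma>)"

definition complete_riemannian_manifold ::
  "'a topology \<Rightarrow> ('a, 'n::finite) chart set \<Rightarrow> ('a, 'n) metric_comps \<Rightarrow> bool" where
  "complete_riemannian_manifold X A G \<longleftrightarrow>
     riemannian_manifold X A G \<and> Metric_space.mcomplete (topspace X) (riem_dist X A G)"


subsection \<open>Riemannian measure\<close>

text \<open>The unique Borel measure that is given by \<open>\<surd>(det g) dx\<close> in each chart.\<close>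

definition riem_measure ::
  "'a topology \<Rightarrow> ('a, 'n::finite) chart set \<Rightarrow> ('a, 'n) metric_comps \<Rightarrow> 'a measure" where
  "riem_measure X A G =
     (THE \<mu>. sets \<mu> = sets (sigma (topspace X) {U. openin X U}) \<and>
        (\<forall>c\<in>A. \<forall>E\<in>sets \<mu>. E \<subseteq> fst c \<longrightarrow>
           emeasure \<mu> E = (\<integral>\<^sup>+x\<in>snd c ` E. ennreal (sqrt (det (G c (cinv c x)))) \<partial>lborel)))"


subsection \<open>Levi-Civita covariant derivative\<close>

text \<open>\<open>christoffel G c x l i j\<close> is \<open>\<Gamma>\<close> with upper index \<open>l\<close> and lower indices \<open>i, j\<close>, at the point
  with coordinates \<open>x\<close> in the chart \<open>c\<close>.\<close>

definition christoffel ::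
  "('a, 'n::finite) metric_comps \<Rightarrow> ('a, 'n) chart \<Rightarrow> real^'n \<Rightarrow> 'n \<Rightarrow> 'n \<Rightarrow> 'n \<Rightarrow> real" where
  "christoffel G c x l i j =
     (let g = (\<lambda>a b y. G c (cinv c y) $ a $ b) in
      1/2 * (\<Sum>m\<in>UNIV. matrix_inv (G c (cinv c x)) $ l $ m *
                 (pd i (g j m) x + pd j (g i m) x - pd m (g i j) x)))"

text \<open>These symbols are those of the torsion-free connection that is compatible with the metric.\<close>

lemma christoffel_Levi_Civita:
  fixes G :: "('a, 'n::finite) metric_comps"
  assumes G: "riemannian_metric A G" and c: "c \<in> A" "open (cimg c)" and x: "x \<in> cimg c"
  shows torsion_free: "christoffel G c x l i j = christoffel G c x l j i"
    and metric_compatible: "pd k (\<lambda>y. G c (cinv c y) $ i $ j) x =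
         (\<Sum>l\<in>UNIV. christoffel G c x l k i * G c (cinv c x) $ l $ j
                    + christoffel G c x l k j * G c (cinv c x) $ i $ l)"
proof -
  define g where "g = (\<lambda>a b y. G c (cinv c y) $ a $ b)"
  define H where "H = matrix_inv (G c (cinv c x))"
  have dom: "cinv c y \<in> fst c" if "y \<in> cimg c" for y
    using that unfolding cimg_def cinv_def by (rule inv_into_into)
  have tr: "transpose (G c (cinv c y)) = G c (cinv c y)" if "y \<in> cimg c" for y
    using G c(1) dom[OF that] unfolding riemannian_metric_def by blast
  have sym: "g a b y = g b a y" if "y \<in> cimg c" for a b y
    using tr[OF that] unfolding g_def transpose_def by (metis vec_lambda_beta)
  have pds: "pd m (g a b) x = pd m (g b a) x" for m a b
  proof -
    have "(g a b has_derivative D) (at x) = (g b a has_derivative D) (at x)" for D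
      using has_derivative_transform_within_open[OF _ c(2) x] sym by metis
    then show ?thesis unfolding pd_def frechet_derivative_def by simp
  qed
  have ch: "christoffel G c x l i j =
      1/2 * (\<Sum>m\<in>UNIV. H $ l $ m * (pd i (g j m) x + pd j (g i m) x - pd m (g i j) x))" for l i j
    unfolding christoffel_def g_def H_def by (simp add: Let_def)
  show "christoffel G c x l i j = christoffel G c x l j i"
    unfolding ch using pds[of _ i j] by (simp add: add.commute)
  have pos: "v \<noteq> 0 \<Longrightarrow> v \<bullet> (G c (cinv c x) *v v) > 0" for v
    using G c(1) dom[OF x] unfolding riemannian_metric_def by blast
  have "invertible (G c (cinv c x))"
    unfolding invertible_left_inverse matrix_left_invertible_ker
    using pos by (metis inner_zero_right less_irrefl)
  then have inv: "G c (cinv c x) ** H = mat 1"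
    unfolding H_def matrix_inv_def invertible_def by (rule someI_ex[THEN conjunct1])
  have GH: "(\<Sum>l\<in>UNIV. g a l x * H $ l $ m) = (if a = m then 1 else 0)" for a m
    using arg_cong[OF inv, of "\<lambda>M. M $ a $ m"]
    unfolding g_def matrix_matrix_mult_def mat_def by simp
  have low: "(\<Sum>l\<in>UNIV. christoffel G c x l i j * g a l x) =
      1/2 * (pd i (g j a) x + pd j (g i a) x - pd a (g i j) x)" for i j a
  proof -
    have "(\<Sum>l\<in>UNIV. christoffel G c x l i j * g a l x) =
       (\<Sum>l\<in>UNIV. \<Sum>m\<in>UNIV. 1/2 * (g a l x * H $ l $ m) * (pd i (g j m) x + pd j (g i m) x - pd m (g i j) x))"
      unfolding ch by (simp add: sum_distrib_left sum_distrib_right mult_ac)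
    also have "\<dots> = (\<Sum>m\<in>UNIV. 1/2 * (\<Sum>l\<in>UNIV. g a l x * H $ l $ m) * (pd i (g j m) x + pd j (g i m) x - pd m (g i j) x))"
      by (subst sum.swap) (simp add: sum_distrib_left sum_distrib_right)
    also have "\<dots> = (\<Sum>m\<in>UNIV. if a = m then 1/2 * (pd i (g j m) x + pd j (g i m) x - pd m (g i j) x) else 0)"
      unfolding GH by (intro sum.cong) auto
    finally show ?thesis by simp
  qed
  have "(\<Sum>l\<in>UNIV. christoffel G c x l k i * g l j x + christoffel G c x l k j * g i l x)
      = (\<Sum>l\<in>UNIV. christoffel G c x l k i * g j l x) + (\<Sum>l\<in>UNIV. christoffel G c x l k j * g i l x)"
    by (simp add: sum.distrib sym[OF x, of _ j])
  also have "\<dots> = pd k (g i j) x"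
    unfolding low using pds[of k i j] pds[of i j k] pds[of j i k] by (simp add: field_simps)
  finally show "pd k (\<lambda>y. G c (cinv c y) $ i $ j) x =
         (\<Sum>l\<in>UNIV. christoffel G c x l k i * G c (cinv c x) $ l $ j
                    + christoffel G c x l k j * G c (cinv c x) $ i $ l)"
    unfolding g_def by simp
qed

text \<open>\<open>weak_cov_deriv A G j T T'\<close> says that the tensor field \<open>T'\<close> of rank \<open>j + 1\<close> is the
  distributional covariant derivative of the tensor field \<open>T\<close> of rank \<open>j\<close> (both locally
  integrable). In the coordinates of each chart it is the formula
  \<open>\<nabla>\<^sub>i T\<^sub>I = \<partial>\<^sub>i T\<^sub>I - \<Sum>\<^sub>s \<Sum>\<^sub>l \<Gamma>\<^sup>l\<^sub>i\<^sub>I\<^sub>s T\<^sub>I\<^sub>[\<^sub>s\<^sub>:\<^sub>=\<^sub>l\<^sub>]\<close>,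
  with \<open>\<partial>\<^sub>i\<close> taken in the sense of distributions and the index of differentiation put first.\<close>

definition weak_cov_deriv ::
  "('a, 'n::finite) chart set \<Rightarrow> ('a, 'n) metric_comps \<Rightarrow> nat \<Rightarrow>
     ('a, 'n) tensor \<Rightarrow> ('a, 'n) tensor \<Rightarrow> bool" where
  "weak_cov_deriv A G j T T' \<longleftrightarrow>
     (\<forall>c\<in>A. \<forall>i I. length I = j \<longrightarrow> (\<forall>\<psi> \<in> test_functions (cimg c).
        (LINT x|lborel.
           (T' c (cinv c x) (i # I) +
            (\<Sum>s<j. \<Sum>l\<in>UNIV. christoffel G c x l i (I ! s) * T c (cinv c x) (I[s := l]))) * \<psi> x)
        = - (LINT x|lborel. T c (cinv c x) I * pd i \<psi> x)))"

definition locally_integrable_tensor ::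
  "('a, 'n::finite) chart set \<Rightarrow> nat \<Rightarrow> ('a, 'n) tensor \<Rightarrow> bool" where
  "locally_integrable_tensor A j T \<longleftrightarrow> tensor_field A j T \<and>
     (\<forall>c\<in>A. \<forall>I. length I = j \<longrightarrow>
        (\<forall>K. compact K \<and> K \<subseteq> cimg c \<longrightarrow> set_integrable lborel K (\<lambda>x. T c (cinv c x) I)))"


section \<open>Sobolev spaces\<close>

definition tensor_norm ::
  "('a, 'n::finite) chart set \<Rightarrow> ('a, 'n) metric_comps \<Rightarrow> nat \<Rightarrow> ('a, 'n) tensor \<Rightarrow> 'a \<Rightarrow> real" where
  "tensor_norm A G j T p =
     (let c = chart_at A p; h = matrix_inv (G c p) in
      sqrt (\<Sum>I | length I = j. \<Sum>J | length J = j.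
              (\<Prod>s<j. h $ (I ! s) $ (J ! s)) * T c p I * T c p J))"

text \<open>\<open>T 0, \<dots>, T k\<close> are the distributional covariant derivatives of \<open>u\<close> of order \<open>0, \<dots>, k\<close>,
  and they have finite \<open>L\<^sup>p\<close>-norm. They are unique up to null sets.\<close>

definition sobolev_jet ::
  "'a topology \<Rightarrow> ('a, 'n::finite) chart set \<Rightarrow> ('a, 'n) metric_comps \<Rightarrow> nat \<Rightarrow> real \<Rightarrow>
     ('a \<Rightarrow> real) \<Rightarrow> (nat \<Rightarrow> ('a, 'n) tensor) \<Rightarrow> bool" where
  "sobolev_jet X A G k p u T \<longleftrightarrow>
     (\<forall>c\<in>A. \<forall>q\<in>fst c. T 0 c q [] = u q) \<and>
     (\<forall>j\<le>k. locally_integrable_tensor A j (T j)) \<and>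
     (\<forall>j<k. weak_cov_deriv A G j (T j) (T (Suc j))) \<and>
     (\<forall>j\<le>k. integrable (riem_measure X A G) (\<lambda>q. tensor_norm A G j (T j) q powr p))"

definition sobolev_space ::
  "'a topology \<Rightarrow> ('a, 'n::finite) chart set \<Rightarrow> ('a, 'n) metric_comps \<Rightarrow> nat \<Rightarrow> real \<Rightarrow>
     ('a \<Rightarrow> real) set" where
  "sobolev_space X A G k p = {u. \<exists>T. sobolev_jet X A G k p u T}"

definition sobolev_norm ::
  "'a topology \<Rightarrow> ('a, 'n::finite) chart set \<Rightarrow> ('a, 'n) metric_comps \<Rightarrow> nat \<Rightarrow> real \<Rightarrow>
     ('a \<Rightarrow> real) \<Rightarrow> real" where
  "sobolev_norm X A G k p u =
     (let T = (SOME T. sobolev_jet X A G k p u T) in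
      \<Sum>j\<le>k. (LINT q|riem_measure X A G. tensor_norm A G j (T j) q powr p) powr (1 / p))"

text \<open>The functions in \<open>sobolev_space\<close> are not identified when equal almost everywhere; as
  \<open>sobolev_norm\<close> does not distinguish such functions, density is not affected.\<close>

definition test_functions_dense ::
  "'a topology \<Rightarrow> ('a, 'n::finite) chart set \<Rightarrow> ('a, 'n) metric_comps \<Rightarrow> nat \<Rightarrow> real \<Rightarrow> bool" where
  "test_functions_dense X A G k p \<longleftrightarrow>
     (\<forall>u \<in> sobolev_space X A G k p. \<forall>\<epsilon>>0. \<exists>f \<in> smooth_compact_support X A.
        sobolev_norm X A G k p (\<lambda>q. u q - f q) < \<epsilon>)"

end

theory Submission
  imports Defs
begin

text \<open>The manifold is \<open>\<real>\<^sup>n\<close> with a conformally flat complete metric of finite volume, so that the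
  constant \<open>1\<close> lies in every Sobolev space. The conformal factor is \<open>beta x * osc (x $ a)\<close>, where \<open>beta\<close> is
  \<open>1 / (r ln r)\<close> at infinity, up to a constant, and \<open>osc\<close> oscillates between 1 and 3 with rapidly
  increasing frequency along the \<open>a\<close>-axis. A compactly supported \<open>f\<close> close to \<open>1\<close> has to drop to \<open>0\<close>
  along that axis. In a transverse direction \<open>b\<close> the Hessian of \<open>1 - f\<close> contains its
  \<open>a\<close>-derivative multiplied by the logarithmic derivative of \<open>osc\<close>, which is huge except near the
  turning points of \<open>osc\<close>; there the \<open>a\<close>-derivative is controlled by the Hessian component in the
  direction \<open>a\<close>. So a small Hessian forces a small drop. As the volume is finite, it is enough
  to do this in \<open>L\<^sup>1\<close>, which treats all exponents and all orders at least two at once.\<close>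

text \<open>The rate 1 / (r ln r) is borderline: the radial length grows only like ln ln r, which
  still diverges, while the volume is of the order of the integral of dr / (r (ln r)^n), which
  converges for n at least 2. As \<open>osc\<close> is bounded above and below, it affects neither.
  Its frequency is exponential because the weights that extract the \<open>a\<close>-derivative from
  the Hessian have the size of the inverse frequency: they decay like exp (- t) along the axis,
  faster than any power of the conformal factor. So no constant depends on the support of
  \<open>f\<close>. The obstacle is that the Sobolev norm speaks of an unspecified choice of weak
  derivatives. They are never identified with classical ones: the weak equations are paired with
  explicit test functions, arranged so that the pairings add up to the \<open>a\<close>-derivative
  of \<open>1 - f\<close> against a cutoff of the strip. One more integration by parts leaves a
  fixed positive number from the far end of the cutoff, where \<open>1 - f\<close> is 1; all other
  terms are small with the jet.\<close>

subsection \<open>Smooth functions on the whole space\<close>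

lemma pd_has_derivative: "(f has_derivative f') (at x) \<Longrightarrow> pd i f x = f' (axis i 1)"
  unfolding pd_def by (metis frechet_derivative_at)

lemma pd_cong_open:
  assumes "open S" "x \<in> S" "\<And>y. y \<in> S \<Longrightarrow> f y = g y"
  shows "pd i f x = pd i g x"
proof -
  have "(f has_derivative D) (at x) = (g has_derivative D) (at x)" for D
    using has_derivative_transform_within_open[OF _ assms(1,2)] assms(3) by metis
  then show ?thesis unfolding pd_def frechet_derivative_def by simp
qed

text \<open>\<open>smooth_on\<close> peels the outermost derivative off a list, whereas the product
  and chain rules need the innermost one: differentiating once yields sums of products to which the
  induction hypothesis applies. \<open>C_upto k\<close> asks for the derivatives of order at most
  \<open>k\<close> to be differentiable.\<close>

fun C_upto :: "nat \<Rightarrow> (real^'n::finite \<Rightarrow> real) \<Rightarrow> bool" where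
  "C_upto 0 f \<longleftrightarrow> (\<forall>x. f differentiable (at x))"
| "C_upto (Suc k) f \<longleftrightarrow> (\<forall>x. f differentiable (at x)) \<and> (\<forall>i. C_upto k (pd i f))"

lemma C_upto_differentiable: "C_upto k f \<Longrightarrow> f differentiable (at x)"
  by (cases k) auto

lemma C_upto_Suc: "C_upto (Suc k) f \<Longrightarrow> C_upto k f"
proof (induction k arbitrary: f)
  case 0
  then show ?case by simp
next
  case (Suc k)
  then show ?case by (metis C_upto.simps(2))
qed

lemma smooth_on_iff_C_upto: "smooth_on UNIV f \<longleftrightarrow> (\<forall>k. C_upto k f)"
proof
  assume f: "smooth_on UNIV f"
  \<comment> \<open>Stated for all iterated derivatives at once, since the induction on
    \<open>k\<close> prepends an index.\<close>
  have "C_upto k (foldr pd is f)" for k "is"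
  proof (induction k arbitrary: "is")
    case 0
    then show ?case using f unfolding smooth_on_def by simp
  next
    case (Suc k)
    then show ?case using f Suc[of "_ # is"] unfolding smooth_on_def by simp
  qed
  from this[of _ "[]"] show "\<forall>k. C_upto k f" by simp
next
  assume f: "\<forall>k. C_upto k f"
  have "\<forall>k. C_upto k (foldr pd is f)" for "is"
  proof (induction "is")
    case Nil
    then show ?case using f by simp
  next
    case (Cons i "is")
    then have "C_upto (Suc k) (foldr pd is f)" for k by blast
    then show ?case by simp
  qed
  then show "smooth_on UNIV f" unfolding smooth_on_def using C_upto.simps(1) by blast
qed

lemma smooth_differentiable: "smooth_on UNIV f \<Longrightarrow> f differentiable (at x)"
  using smooth_on_iff_C_upto C_upto_differentiable by blast

lemma smooth_has_derivative:
  "smooth_on UNIV f \<Longrightarrow> (f has_derivative frechet_derivative f (at x)) (at x)"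
  using smooth_differentiable frechet_derivative_works by blast

lemma smooth_pd: "smooth_on UNIV f \<Longrightarrow> smooth_on UNIV (pd i f)"
  unfolding smooth_on_iff_C_upto by (metis C_upto.simps(2))

lemma smooth_continuous: "smooth_on UNIV f \<Longrightarrow> continuous_on S f"
  by (meson continuous_at_imp_continuous_on differentiable_imp_continuous_within smooth_differentiable)

lemma pd_const: "pd i (\<lambda>x. c) = (\<lambda>x. 0)"
  by (rule ext, subst pd_has_derivative[OF has_derivative_const]) simp

lemma C_upto_const: "C_upto k (\<lambda>x. c)"
  by (induction k arbitrary: c) (auto simp: pd_const)

lemma smooth_const: "smooth_on UNIV (\<lambda>x. c)"
  using C_upto_const smooth_on_iff_C_upto by blast

lemma pd_add:
  assumes "f differentiable (at x)" "g differentiable (at x)"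
  shows "pd i (\<lambda>x. f x + g x) x = pd i f x + pd i g x"
  using pd_has_derivative[OF has_derivative_add[OF assms[unfolded frechet_derivative_works]]]
  by (simp add: pd_def)

lemma pd_mult:
  assumes "f differentiable (at x)" "g differentiable (at x)"
  shows "pd i (\<lambda>x. f x * g x) x = f x * pd i g x + pd i f x * g x"
  using pd_has_derivative[OF has_derivative_mult[OF assms[unfolded frechet_derivative_works]]]
  by (simp add: pd_def)

lemma pd_chain:
  assumes "f differentiable (at x)" "(F has_real_derivative F') (at (f x))"
  shows "pd i (\<lambda>x. F (f x)) x = F' * pd i f x"
  using pd_has_derivative[OF has_derivative_compose[OF assms(1)[unfolded frechet_derivative_works]
        assms(2)[unfolded has_field_derivative_def]]]
  by (simp add: pd_def)

lemma C_upto_add: "C_upto k f \<Longrightarrow> C_upto k g \<Longrightarrow> C_upto k (\<lambda>x. f x + g x)"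
proof (induction k arbitrary: f g)
  case 0
  then show ?case by (simp add: differentiable_add)
next
  case (Suc k)
  then have "pd i (\<lambda>x. f x + g x) = (\<lambda>x. pd i f x + pd i g x)" for i
    by (intro ext pd_add) auto
  with Suc show ?case by (simp add: differentiable_add)
qed

lemma C_upto_mult: "C_upto k f \<Longrightarrow> C_upto k g \<Longrightarrow> C_upto k (\<lambda>x. f x * g x)"
proof (induction k arbitrary: f g)
  case 0
  then show ?case by (simp add: differentiable_mult)
next
  case (Suc k)
  then have "pd i (\<lambda>x. f x * g x) = (\<lambda>x. f x * pd i g x + pd i f x * g x)" for i
    by (intro ext pd_mult) auto
  moreover have "C_upto k (\<lambda>x. f x * pd i g x + pd i f x * g x)" for i
    by (intro C_upto_add Suc.IH C_upto_Suc[OF Suc.prems(1)] C_upto_Suc[OF Suc.prems(2)])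
      (use Suc.prems in auto)
  ultimately show ?case using Suc.prems by (simp add: differentiable_mult)
qed

lemma differentiable_real_chain:
  assumes "f differentiable (at x)" "(F has_real_derivative F') (at (f x))"
  shows "(\<lambda>x. F (f x)) differentiable (at x)"
  using has_derivative_compose[OF assms(1)[unfolded frechet_derivative_works]
      assms(2)[unfolded has_field_derivative_def]]
  unfolding differentiable_def by blast

text \<open>The outer function comes with all its derivatives, because differentiating
  \<open>D j (f x)\<close> produces the factor \<open>D (Suc j) (f x)\<close>; hence
  \<open>j\<close> is generalised in the induction.\<close>

lemma C_upto_chain:
  assumes D: "\<And>j t. t \<in> U \<Longrightarrow> (D j has_real_derivative D (Suc j) t) (at t)"
    and U: "\<And>x. f x \<in> U" and f: "C_upto k f"
  shows "C_upto k (\<lambda>x. D j (f x))"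
proof -
  have diff: "(\<lambda>x. D j (f x)) differentiable (at x)" for j x
    by (rule differentiable_real_chain[OF C_upto_differentiable[OF f]]) (rule D[OF U])
  show ?thesis
    using f
  proof (induction k arbitrary: j)
    case 0
    then show ?case using diff by simp
  next
    case (Suc k)
    have "pd i (\<lambda>x. D j (f x)) = (\<lambda>x. D (Suc j) (f x) * pd i f x)" for i
      using Suc.prems by (intro ext pd_chain D U) simp
    moreover have "C_upto k (\<lambda>x. D (Suc j) (f x) * pd i f x)" for i
      by (intro C_upto_mult Suc.IH C_upto_Suc[OF Suc.prems]) (use Suc.prems in auto)
    ultimately show ?case using diff by simp
  qed
qed

lemma smooth_add: "smooth_on UNIV f \<Longrightarrow> smooth_on UNIV g \<Longrightarrow> smooth_on UNIV (\<lambda>x. f x + g x)"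
  and smooth_mult: "smooth_on UNIV f \<Longrightarrow> smooth_on UNIV g \<Longrightarrow> smooth_on UNIV (\<lambda>x. f x * g x)"
  unfolding smooth_on_iff_C_upto by (auto intro: C_upto_add C_upto_mult)

lemma smooth_minus: "smooth_on UNIV f \<Longrightarrow> smooth_on UNIV (\<lambda>x. - f x)"
  using smooth_mult[OF smooth_const, of f "-1"] by simp

lemma smooth_diff: "smooth_on UNIV f \<Longrightarrow> smooth_on UNIV g \<Longrightarrow> smooth_on UNIV (\<lambda>x. f x - g x)"
  using smooth_add[OF _ smooth_minus] by fastforce

lemma smooth_sum: "(\<And>a. a \<in> I \<Longrightarrow> smooth_on UNIV (f a)) \<Longrightarrow> smooth_on UNIV (\<lambda>x. \<Sum>a\<in>I. f a x)"
  by (induction I rule: infinite_finite_induct) (auto intro: smooth_const smooth_add)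

lemma pd_coord: "pd i (\<lambda>x::real^'n::finite. x $ j) = (\<lambda>x. if i = j then 1 else 0)"
proof
  fix x :: "real^'n"
  have "((\<lambda>x::real^'n. x $ j) has_derivative (\<lambda>x. x $ j)) (at x)"
    by (rule bounded_linear_imp_has_derivative[OF bounded_linear_vec_nth])
  from pd_has_derivative[OF this] show "pd i (\<lambda>x. x $ j) x = (if i = j then 1 else 0)"
    by (simp add: axis_def)
qed

lemma smooth_coord: "smooth_on UNIV (\<lambda>x. x $ j)"
proof -
  have "C_upto k (\<lambda>x. x $ j)" for k
    by (cases k) (auto simp: pd_coord C_upto_const differentiable_def
        intro: bounded_linear_imp_has_derivative[OF bounded_linear_vec_nth])
  then show ?thesis unfolding smooth_on_iff_C_upto by blast
qed

text \<open>An explicit sequence of derivatives is required, in the form that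
  \<open>C_upto_chain\<close> consumes. For the elementary functions and the flat function below
  such a sequence has a closed form.\<close>

definition smooth1_on :: "real set \<Rightarrow> (real \<Rightarrow> real) \<Rightarrow> bool" where
  "smooth1_on U F \<longleftrightarrow>
     (\<exists>D. D 0 = F \<and> (\<forall>j. \<forall>t\<in>U. (D j has_real_derivative D (Suc j) t) (at t)))"

lemma smooth_chain:
  assumes "smooth1_on U F" "\<And>x. f x \<in> U" "smooth_on UNIV f"
  shows "smooth_on UNIV (\<lambda>x. F (f x))"
proof -
  obtain D where D: "D 0 = F" "\<And>j t. t \<in> U \<Longrightarrow> (D j has_real_derivative D (Suc j) t) (at t)"
    using assms(1) unfolding smooth1_on_def by blast
  then show ?thesis
    using assms(3) C_upto_chain[of U D f _ 0, OF D(2) assms(2)] unfolding smooth_on_iff_C_upto by simp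
qed

lemma smooth1_exp: "smooth1_on UNIV exp"
  unfolding smooth1_on_def by (intro exI[of _ "\<lambda>_. exp"]) (auto intro: DERIV_exp)

text \<open>Each derivative advances the phase by a quarter period, so one shifted cosine serves for
  both functions.\<close>

lemma smooth1_sin: "smooth1_on UNIV sin" and smooth1_cos: "smooth1_on UNIV cos"
proof -
  define D where "D c j t = (cos (t + c + real j * (pi/2)) :: real)" for c j t
  have D: "(D c j has_real_derivative D c (Suc j) t) (at t)" for c j t
  proof -
    have "D c (Suc j) t = - sin (t + c + real j * (pi/2))"
      unfolding D_def minus_sin_cos_eq by (simp add: algebra_simps add_divide_distrib)
    then show ?thesis unfolding D_def by (auto intro!: derivative_eq_intros)
  qed
  have "D (-(pi/2)) 0 = sin" unfolding D_def by (simp add: fun_eq_iff cos_sin_eq)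
  then show "smooth1_on UNIV sin" unfolding smooth1_on_def using D by blast
  have "D 0 0 = cos" unfolding D_def by (simp add: fun_eq_iff)
  then show "smooth1_on UNIV cos" unfolding smooth1_on_def using D by blast
qed

lemma smooth1_powr: "smooth1_on {0<..} (\<lambda>t. t powr a)"
proof -
  define c where "c j = (\<Prod>i<j. a - real i)" for j
  have "((\<lambda>t. c j * t powr (a - real j)) has_real_derivative c (Suc j) * t powr (a - real (Suc j))) (at t)"
    if "t > 0" for j t
    using DERIV_cmult[OF has_real_derivative_powr[OF that], of "c j" "a - real j"]
    by (simp add: c_def algebra_simps)
  then show ?thesis unfolding smooth1_on_def
    by (intro exI[of _ "\<lambda>j t. c j * t powr (a - real j)"]) (auto simp: c_def)
qed

lemma smooth1_inverse: "smooth1_on {0<..} inverse"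
proof -
  define c where "c j = (\<Prod>i<j. - 1 - real i)" for j
  have "((\<lambda>t. c j * inverse t ^ Suc j) has_real_derivative c (Suc j) * inverse t ^ Suc (Suc j)) (at t)"
    if "t > 0" for j t
  proof -
    have "((\<lambda>t. inverse t ^ Suc j) has_real_derivative
        real (Suc j) * (- (inverse t * 1 * inverse t) * inverse t ^ (Suc j - Suc 0))) (at t)"
      using that by (intro DERIV_power DERIV_inverse' DERIV_ident) auto
    from DERIV_cmult[OF this, of "c j"] show ?thesis
      by (simp add: c_def algebra_simps)
  qed
  then show ?thesis unfolding smooth1_on_def
    by (intro exI[of _ "\<lambda>j t. c j * inverse t ^ Suc j"]) (auto simp: c_def)
qed

lemma smooth1_ln: "smooth1_on {0<..} ln"
proof -
  obtain D where D: "D 0 = inverse" "\<And>j t. t > 0 \<Longrightarrow> (D j has_real_derivative D (Suc j) t) (at t)"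
    using smooth1_inverse unfolding smooth1_on_def by auto
  define E where "E j = (case j of 0 \<Rightarrow> ln | Suc i \<Rightarrow> D i)" for j
  have "(E j has_real_derivative E (Suc j) t) (at t)" if "t > 0" for j t
    using D that by (cases j) (auto simp: E_def intro!: derivative_eq_intros simp: field_simps)
  moreover have "E 0 = ln" by (simp add: E_def)
  ultimately show ?thesis unfolding smooth1_on_def by auto
qed

lemma smooth_inverse: "(\<And>x. f x > 0) \<Longrightarrow> smooth_on UNIV f \<Longrightarrow> smooth_on UNIV (\<lambda>x. inverse (f x))"
  by (rule smooth_chain[OF smooth1_inverse]) auto

lemma smooth_divide:
  "smooth_on UNIV f \<Longrightarrow> smooth_on UNIV g \<Longrightarrow> (\<And>x. g x > 0) \<Longrightarrow> smooth_on UNIV (\<lambda>x. f x / g x)"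
  unfolding divide_inverse by (intro smooth_mult smooth_inverse)

lemma smooth_power: "smooth_on UNIV f \<Longrightarrow> smooth_on UNIV (\<lambda>x. f x ^ k)"
  by (induction k) (auto intro: smooth_const smooth_mult)

subsection \<open>Cutoff functions\<close>

text \<open>The derivatives of exp (- 1 / t) are polynomials in s = 1 / t times the function itself,
  and d/dt turns the polynomial P into s^2 (P - P').\<close>

fun bump_poly :: "nat \<Rightarrow> real poly" where
  "bump_poly 0 = 1"
| "bump_poly (Suc k) = [:0, 0, 1:] * (bump_poly k - pderiv (bump_poly k))"

definition bump_deriv :: "nat \<Rightarrow> real \<Rightarrow> real" where
  "bump_deriv k t = (if t > 0 then poly (bump_poly k) (inverse t) * exp (- inverse t) else 0)"

abbreviation bump :: "real \<Rightarrow> real" where "bump \<equiv> bump_deriv 0"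

lemma poly_exp_minus_tendsto_0: "((\<lambda>s. poly Q s * exp (- s)) \<longlongrightarrow> 0) at_top" for Q :: "real poly"
proof -
  have "((\<lambda>s. \<Sum>i\<le>degree Q. coeff Q i * (s ^ i / exp s)) \<longlongrightarrow> (\<Sum>i\<le>degree Q. coeff Q i * 0)) at_top"
    by (intro tendsto_sum tendsto_mult tendsto_const tendsto_power_div_exp_0)
  moreover have "poly Q s * exp (- s) = (\<Sum>i\<le>degree Q. coeff Q i * (s ^ i / exp s))" for s
    by (simp add: poly_altdef exp_minus divide_inverse sum_distrib_left mult_ac)
  ultimately show ?thesis by simp
qed

lemma bump_deriv_DERIV: "(bump_deriv k has_real_derivative bump_deriv (Suc k) t) (at t)"
proof (cases t "0::real" rule: linorder_cases)
  case less
  have "((\<lambda>_. 0) has_real_derivative 0) (at t)" by simp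
  then have "(bump_deriv k has_real_derivative 0) (at t)"
    by (rule has_field_derivative_transform_within_open[of _ _ _ "{..<0}"])
      (use less in \<open>auto simp: bump_deriv_def\<close>)
  with less show ?thesis by (simp add: bump_deriv_def)
next
  case greater
  have "((\<lambda>t. poly (bump_poly k) (inverse t) * exp (- inverse t)) has_real_derivative bump_deriv (Suc k) t) (at t)"
  proof -
    have inv: "(inverse has_real_derivative - (inverse t * 1 * inverse t)) (at t)"
      using greater by (intro DERIV_inverse' DERIV_ident) auto
    have "((\<lambda>t. poly (bump_poly k) (inverse t)) has_real_derivative
        poly (pderiv (bump_poly k)) (inverse t) * - (inverse t * 1 * inverse t)) (at t)"
      by (rule DERIV_chain2[OF poly_DERIV inv])
    moreover have "((\<lambda>t. exp (- inverse t)) has_real_derivative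
        exp (- inverse t) * - (- (inverse t * 1 * inverse t))) (at t)"
      by (rule DERIV_chain2[OF DERIV_exp DERIV_minus[OF inv]])
    ultimately show ?thesis
      using DERIV_mult greater by (fastforce simp: bump_deriv_def algebra_simps)
  qed
  then show ?thesis
    by (rule has_field_derivative_transform_within_open[of _ _ _ "{0<..}"])
      (use greater in \<open>auto simp: bump_deriv_def\<close>)
next
  case equal
  \<comment> \<open>The difference quotient at 0 is once more a polynomial in 1 / h times exp (- 1 /
    h); \<open>pCons 0\<close> is the additional factor 1 / h.\<close>
  have "((\<lambda>h. bump_deriv k h / h) \<longlongrightarrow> 0) (at_right 0)"
  proof (rule Lim_transform_eventually)
    have "filterlim (inverse :: real \<Rightarrow> real) at_top (at_right 0)"
      by (rule filterlim_inverse_at_top_right)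
    then show "((\<lambda>h. poly (pCons 0 (bump_poly k)) (inverse h) * exp (- inverse h)) \<longlongrightarrow> 0) (at_right 0)"
      by (rule filterlim_compose[OF poly_exp_minus_tendsto_0])
    show "\<forall>\<^sub>F h in at_right 0. poly (pCons 0 (bump_poly k)) (inverse h) * exp (- inverse h) = bump_deriv k h / h"
      using eventually_at_right_less[of "0::real"]
      by eventually_elim (simp add: bump_deriv_def divide_inverse mult_ac)
  qed
  moreover have "((\<lambda>h. bump_deriv k h / h) \<longlongrightarrow> 0) (at_left 0)"
    by (rule Lim_transform_eventually[OF tendsto_const])
      (auto simp: bump_deriv_def eventually_at_left_field intro: exI[of _ "-1"])
  ultimately have "((\<lambda>h. bump_deriv k h / h) \<longlongrightarrow> 0) (at 0)"
    by (simp add: filterlim_split_at)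
  with equal show ?thesis
    by (simp add: DERIV_def bump_deriv_def)
qed

lemma smooth1_bump_deriv: "smooth1_on UNIV (bump_deriv k)"
  unfolding smooth1_on_def
  by (rule exI[of _ "\<lambda>j. bump_deriv (k + j)"]) (use bump_deriv_DERIV in simp)

lemma bump_pos: "t > 0 \<Longrightarrow> bump t > 0" and bump_nonneg: "bump t \<ge> 0"
  and bump_deriv_nonpos: "t \<le> 0 \<Longrightarrow> bump_deriv k t = 0" and bump_le_1: "bump t \<le> 1"
  and bump_deriv_1_nonneg: "bump_deriv 1 t \<ge> 0"
  by (auto simp: bump_deriv_def pderiv_1)

lemma bump_deriv_continuous: "continuous_on S (bump_deriv k)"
  using bump_deriv_DERIV by (meson DERIV_continuous_on has_field_derivative_at_within)

section \<open>The smooth transition from 0 to 1\<close>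

definition step :: "real \<Rightarrow> real" where
  "step t = bump t / (bump t + bump (1 - t))"

text \<open>The quotient rule after the products of \<open>bump t\<close> with its own derivative
  have cancelled, so that every remaining term is visibly nonnegative.\<close>

definition step' :: "real \<Rightarrow> real" where
  "step' t = (bump_deriv 1 t * bump (1 - t) + bump t * bump_deriv 1 (1 - t)) / (bump t + bump (1 - t))\<^sup>2"

lemma step_denom_pos: "bump t + bump (1 - t) > 0"
  using bump_pos[of t] bump_pos[of "1 - t"] bump_nonneg[of t] bump_nonneg[of "1 - t"]
  by (cases "t > 0") linarith+

lemma step_DERIV: "(step has_real_derivative step' t) (at t)"
proof -
  note [derivative_intros] = bump_deriv_DERIV[THEN DERIV_chain2]
  show ?thesis
    unfolding step_def[abs_def] step'_def using step_denom_pos[of t]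
    by (auto intro!: derivative_eq_intros simp: algebra_simps power2_eq_square)
qed

lemma step_nonpos: "t \<le> 0 \<Longrightarrow> step t = 0" and step_ge_1: "t \<ge> 1 \<Longrightarrow> step t = 1"
  and step_nonneg: "step t \<ge> 0" and step_le_1: "step t \<le> 1"
  using step_denom_pos[of t] bump_nonneg[of t] bump_nonneg[of "1 - t"]
  by (auto simp: step_def bump_deriv_nonpos)

lemma step'_nonneg: "step' t \<ge> 0"
  unfolding step'_def by (intro divide_nonneg_nonneg add_nonneg_nonneg mult_nonneg_nonneg
      bump_nonneg bump_deriv_1_nonneg) auto

lemma step'_zero: "t \<le> 0 \<or> t \<ge> 1 \<Longrightarrow> step' t = 0"
  unfolding step'_def by (auto simp: bump_deriv_nonpos)

lemma step'_half_pos: "step' (1/2) > 0"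
  by (simp add: step'_def bump_deriv_def pderiv_1)

lemma step'_continuous: "continuous_on S step'"
  unfolding step'_def using step_denom_pos
  by (intro continuous_intros continuous_on_compose2[OF bump_deriv_continuous[of UNIV]])
    (auto simp: less_imp_neq[symmetric])

lemma step'_bounded: "\<exists>C. \<forall>t. \<bar>step' t\<bar> \<le> C"
proof -
  have "bounded (step' ` {0..1})"
    by (intro compact_imp_bounded compact_continuous_image step'_continuous) auto
  then obtain C where C: "\<forall>t\<in>{0..1}. \<bar>step' t\<bar> \<le> C" "C > 0"
    unfolding bounded_pos by auto
  have "\<bar>step' t\<bar> \<le> C" for t
    using C step'_zero[of t] by (cases "t \<in> {0..1}") auto
  then show ?thesis by blast
qed

lemma smooth_step: "smooth_on UNIV f \<Longrightarrow> smooth_on UNIV (\<lambda>x. step (f x))"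
  unfolding step_def
  by (intro smooth_divide smooth_add smooth_chain[OF smooth1_bump_deriv] smooth_diff smooth_const step_denom_pos)
    auto

text \<open>As a partial derivative of a smooth function it is smooth; this spares a sequence of
  higher derivatives for \<open>step'\<close>.\<close>

lemma smooth_step'_coord: "smooth_on UNIV (\<lambda>x. step' (x $ i - c))"
proof -
  have f: "smooth_on UNIV (\<lambda>x. x $ i - c)"
    by (intro smooth_diff smooth_coord smooth_const)
  have "pd i (\<lambda>x. step (x $ i - c)) x = step' (x $ i - c)" for x
  proof -
    have "pd i (\<lambda>x. x $ i - c) x = 1"
      using pd_add[OF smooth_differentiable[OF smooth_coord] smooth_differentiable[OF smooth_const], of i i "-c" x]
      by (simp add: pd_coord pd_const)
    then show ?thesis
      using pd_chain[OF smooth_differentiable[OF f] step_DERIV, of i] by simp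
  qed
  then show ?thesis using smooth_pd[OF smooth_step[OF f], of i] by presburger
qed


subsection \<open>Integration by parts\<close>

lemma integrable_compact_support:
  fixes f :: "real^'n::finite \<Rightarrow> real"
  assumes "continuous_on UNIV f" "compact K" "\<And>x. x \<notin> K \<Longrightarrow> f x = 0"
  shows "integrable lborel f"
proof -
  have "integrable lborel (\<lambda>x. indicator K x *\<^sub>R f x)"
    using assms by (intro borel_integrable_compact) (auto intro: continuous_on_subset)
  moreover have "(\<lambda>x. indicator K x *\<^sub>R f x) = f"
    using assms(3) by (auto simp: indicator_def fun_eq_iff)
  ultimately show ?thesis by simp
qed

lemma integral_lborel_translation:
  fixes f :: "real^'n::finite \<Rightarrow> real"
  shows "(LINT x|lborel. f (c + x)) = (LINT x|lborel. f x)"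
proof (cases "f \<in> borel_measurable borel")
  case True
  have "distr lborel borel ((+) c) = (lborel :: (real^'n) measure)"
    using lborel_affine[of 1 c] by (simp add: density_1 one_ennreal_def[symmetric])
  then show ?thesis using integral_distr[of "(+) c" lborel borel f] True by simp
next
  \<comment> \<open>For a function that is not measurable both integrals have the default value
    0.\<close>
  case False
  have "(\<lambda>x. f (c + x)) \<notin> borel_measurable borel"
  proof
    assume "(\<lambda>x. f (c + x)) \<in> borel_measurable borel"
    then have "(\<lambda>x. f (c + x)) \<circ> (\<lambda>x. x - c) \<in> borel_measurable borel"
      by (rule measurable_comp[rotated]) simp
    with False show False by (simp add: comp_def)
  qed
  with False have "\<not> integrable lborel f" "\<not> integrable lborel (\<lambda>x. f (c + x))"
    using borel_measurable_integrable[of lborel] by auto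
  then show ?thesis by (simp add: not_integrable_integral_eq)
qed

lemma bounded_compact_support:
  fixes f :: "real^'n::finite \<Rightarrow> real"
  assumes "continuous_on UNIV f" "compact K" "\<And>x. x \<notin> K \<Longrightarrow> f x = 0"
  obtains B where "B > 0" "\<And>x. \<bar>f x\<bar> \<le> B"
proof -
  have "bounded (f ` K)"
    using assms by (intro compact_imp_bounded compact_continuous_image) (auto intro: continuous_on_subset)
  then obtain B where B: "B > 0" "\<forall>x\<in>K. \<bar>f x\<bar> \<le> B" unfolding bounded_pos by auto
  then have "\<bar>f x\<bar> \<le> B" for x using assms(3)[of x] by (cases "x \<in> K") auto
  with B that show thesis by blast
qed

lemma pd_zero_outside:
  assumes "closed K" "\<And>x. x \<notin> K \<Longrightarrow> f x = c" "x \<notin> K"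
  shows "pd i f x = 0"
proof -
  have "pd i f x = pd i (\<lambda>_. c) x"
    by (rule pd_cong_open[of "- K"]) (use assms in auto)
  then show ?thesis by (simp add: pd_const)
qed

lemma DERIV_pd:
  assumes "smooth_on UNIV f"
  shows "((\<lambda>t. f (x + t *\<^sub>R axis i 1)) has_real_derivative pd i f (x + t *\<^sub>R axis i 1)) (at t)"
proof -
  let ?y = "x + t *\<^sub>R axis i 1" and ?f' = "frechet_derivative f (at (x + t *\<^sub>R axis i 1))"
  have f: "(f has_derivative ?f') (at ?y)" by (rule smooth_has_derivative[OF assms])
  have "((\<lambda>t. x + t *\<^sub>R axis i 1) has_derivative (\<lambda>h. h *\<^sub>R axis i 1)) (at t)"
    by (auto intro!: derivative_eq_intros)
  from has_derivative_compose[OF this f]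
  have "((\<lambda>t. f (x + t *\<^sub>R axis i 1)) has_derivative (\<lambda>h. ?f' (h *\<^sub>R axis i 1))) (at t)" .
  moreover have "?f' (h *\<^sub>R axis i 1) = pd i f ?y * h" for h
    unfolding pd_def using linear_cmul[OF has_derivative_linear[OF f]] by simp
  ultimately show ?thesis unfolding has_field_derivative_def by simp
qed

text \<open>The difference quotients have integral zero by translation invariance.\<close>

lemma integral_pd_eq_0:
  assumes f: "smooth_on UNIV f" and K: "compact K" "\<And>x. x \<notin> K \<Longrightarrow> f x = 0"
  shows "(LINT x|lborel. pd i f x) = 0"
proof -
  let ?e = "axis i 1 :: real^'a"
  have "pd i f x = 0" if "x \<notin> K" for x
    by (rule pd_zero_outside[OF compact_imp_closed[OF K(1)] _ that]) (rule K(2))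
  then obtain B where B: "B > 0" "\<And>x. \<bar>pd i f x\<bar> \<le> B"
    using bounded_compact_support[OF smooth_continuous[OF smooth_pd[OF f]] K(1)] by blast
  obtain r where r: "K \<subseteq> cball 0 r"
    using compact_imp_bounded[OF K(1)] unfolding bounded_iff by (auto simp: subset_eq)
  define q where "q m x = (f (x + inverse (real (Suc m)) *\<^sub>R ?e) - f x) / inverse (real (Suc m))" for m x
  have int: "integrable lborel f"
    by (rule integrable_compact_support[OF smooth_continuous[OF f] K])
  have int': "integrable lborel (\<lambda>x. f (x + c))" for c
  proof (rule integrable_compact_support)
    show "continuous_on UNIV (\<lambda>x. f (x + c))"
      by (intro continuous_on_compose2[OF smooth_continuous[OF f, of UNIV]] continuous_intros) auto
    show "compact ((\<lambda>x. x - c) ` K)" by (intro compact_continuous_image continuous_intros K(1))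
    show "f (x + c) = 0" if "x \<notin> (\<lambda>x. x - c) ` K" for x
      using that by (intro K(2)) (auto simp: image_iff)
  qed
  have q0: "(LINT x|lborel. q m x) = 0" for m
  proof -
    have "(LINT x|lborel. f (x + c)) = (LINT x|lborel. f x)" for c
      using integral_lborel_translation[of f c] by (simp add: add.commute)
    then show ?thesis unfolding q_def using int int' by simp
  qed
  have "(\<lambda>m. LINT x|lborel. q m x) \<longlonglongrightarrow> (LINT x|lborel. pd i f x)"
  \<comment> \<open>The increments are at most 1, so every quotient vanishes outside the ball of
    radius \<open>r + 1\<close>, and the mean value theorem bounds it by \<open>B\<close>.\<close>
  proof (rule integral_dominated_convergence[where w = "\<lambda>x. B * indicator (cball 0 (r + 1)) x"])
    show "pd i f \<in> borel_measurable lborel"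
      using smooth_continuous[OF smooth_pd[OF f], of UNIV] by (simp add: borel_measurable_continuous_onI)
    have "continuous_on UNIV (q m)" for m
      unfolding q_def by (intro continuous_intros continuous_on_compose2[OF smooth_continuous[OF f, of UNIV]]) auto
    then show "q m \<in> borel_measurable lborel" for m by (simp add: borel_measurable_continuous_onI)
    show "integrable lborel (\<lambda>x::real^'a. B * indicator (cball 0 (r + 1)) x)"
      by (intro integrable_mult_right integrable_real_indicator) (use emeasure_lborel_cball_finite in auto)
    show "AE x in lborel. (\<lambda>m. q m x) \<longlonglongrightarrow> pd i f x"
    proof (rule AE_I2)
      fix x
      have "((\<lambda>h. (f (x + h *\<^sub>R ?e) - f x) / h) \<longlongrightarrow> pd i f x) (at 0)"
        using DERIV_pd[OF f, of x i 0] by (simp add: DERIV_def)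
      moreover have "filterlim (\<lambda>m. inverse (real (Suc m))) (at 0) sequentially"
        using LIMSEQ_inverse_real_of_nat by (auto simp: filterlim_at)
      ultimately show "(\<lambda>m. q m x) \<longlonglongrightarrow> pd i f x" unfolding q_def by (rule filterlim_compose)
    qed
    show "AE x in lborel. norm (q m x) \<le> B * indicator (cball 0 (r + 1)) x" for m
    proof (rule AE_I2)
      fix x
      define h where "h = inverse (real (Suc m))"
      have h: "0 < h" "h \<le> 1" by (auto simp: h_def field_simps)
      obtain z where z: "0 < z" "f (x + h *\<^sub>R ?e) - f (x + 0 *\<^sub>R ?e) = (h - 0) * pd i f (x + z *\<^sub>R ?e)"
        using MVT2[OF h(1), of "\<lambda>t. f (x + t *\<^sub>R ?e)" "\<lambda>t. pd i f (x + t *\<^sub>R ?e)"] DERIV_pd[OF f] by blast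
      then have qx: "q m x = pd i f (x + z *\<^sub>R ?e)" unfolding q_def h_def[symmetric] using h by simp
      show "norm (q m x) \<le> B * indicator (cball 0 (r + 1)) x"
      proof (cases "x \<in> cball 0 (r + 1)")
        case True
        then show ?thesis using qx B(2) by simp
      next
        case False
        then have "norm x > r + 1" by simp
        moreover have "norm x \<le> norm (x + h *\<^sub>R ?e) + norm (h *\<^sub>R ?e)"
          using norm_triangle_ineq4[of "x + h *\<^sub>R ?e" "h *\<^sub>R ?e"] by simp
        ultimately have "norm (x + h *\<^sub>R ?e) > r" "norm x > r" using h by auto
        then have "x + h *\<^sub>R ?e \<notin> K" "x \<notin> K" using r by auto
        then show ?thesis using K(2) False by (simp add: q_def h_def)
      qed
    qed
  qed
  from LIMSEQ_unique[OF this[unfolded q0] tendsto_const] show ?thesis .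
qed

lemma integral_pd_by_parts:
  assumes f: "smooth_on UNIV f" and \<psi>: "\<psi> \<in> test_functions UNIV"
  shows "(LINT x|lborel. pd i f x * \<psi> x) = - (LINT x|lborel. f x * pd i \<psi> x)"
proof -
  obtain K where K: "compact K" "\<And>x. x \<notin> K \<Longrightarrow> \<psi> x = 0" and s: "smooth_on UNIV \<psi>"
    using \<psi> unfolding test_functions_def by auto
  have pd: "pd i (\<lambda>x. f x * \<psi> x) x = f x * pd i \<psi> x + pd i f x * \<psi> x" for x
    by (intro pd_mult smooth_differentiable f s)
  have "pd i \<psi> x = 0" if "x \<notin> K" for x
    by (rule pd_zero_outside[OF compact_imp_closed[OF K(1)] _ that]) (rule K(2))
  then have "integrable lborel (\<lambda>x. f x * pd i \<psi> x)" "integrable lborel (\<lambda>x. pd i f x * \<psi> x)"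
    by (auto intro!: integrable_compact_support[OF _ K(1)] smooth_continuous smooth_mult smooth_pd f s simp: K(2))
  moreover have "(LINT x|lborel. pd i (\<lambda>x. f x * \<psi> x) x) = 0"
    by (rule integral_pd_eq_0[OF smooth_mult[OF f s] K(1)]) (simp add: K(2))
  ultimately show ?thesis unfolding pd by simp
qed

lemma test_functionsI:
  "smooth_on UNIV \<psi> \<Longrightarrow> compact K \<Longrightarrow> (\<And>x. x \<notin> K \<Longrightarrow> \<psi> x = 0) \<Longrightarrow> \<psi> \<in> test_functions UNIV"
  unfolding test_functions_def by blast

lemma test_functions_pd:
  assumes "\<psi> \<in> test_functions UNIV"
  shows "pd i \<psi> \<in> test_functions UNIV"
proof -
  obtain K where K: "compact K" "\<And>x. x \<notin> K \<Longrightarrow> \<psi> x = 0" and s: "smooth_on UNIV \<psi>"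
    using assms unfolding test_functions_def by auto
  show ?thesis
    by (rule test_functionsI[OF smooth_pd[OF s] K(1)], rule pd_zero_outside[OF compact_imp_closed[OF K(1)]])
      (rule K(2))
qed

subsection \<open>Conformally flat metrics in a single chart\<close>

abbreviation std_chart :: "(real^'n::finite, 'n) chart" where
  "std_chart \<equiv> (UNIV, \<lambda>x. x)"

abbreviation std_atlas :: "(real^'n::finite, 'n) chart set" where
  "std_atlas \<equiv> {std_chart}"

text \<open>The square makes \<open>lam\<close> the ratio of lengths: volumes scale by
  \<open>lam p ^ CARD('n)\<close> and norms of covariant tensors of rank j by
  \<open>1 / lam p ^ j\<close>.\<close>

definition conf_metric :: "(real^'n::finite \<Rightarrow> real) \<Rightarrow> (real^'n, 'n) metric_comps" where
  "conf_metric lam c p = (lam p)\<^sup>2 *\<^sub>R mat 1"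

lemma cimg_std [simp]: "cimg std_chart = UNIV"
  by (simp add: cimg_def)

lemma cinv_std [simp]: "cinv std_chart = (\<lambda>x. x)"
  by (simp add: cinv_def)

lemma chart_at_std [simp]: "chart_at std_atlas p = std_chart"
  unfolding chart_at_def by (rule some_equality) auto

lemma jacobian_std [simp]: "jacobian std_chart std_chart p = mat 1"
  using matrix_id_mat_1 by (simp add: jacobian_def comp_def id_def)

lemma conf_metric_component: "conf_metric lam c p $ i $ j = (if i = j then (lam p)\<^sup>2 else 0)"
  by (simp add: conf_metric_def mat_def)

lemma prod_delta_lists:
  fixes I J :: "'n list" and a :: real
  assumes "length I = j" "length J = j"
  shows "(\<Prod>s<j. if I ! s = J ! s then a else 0) = (if I = J then a ^ j else 0)"
proof (cases "I = J")
  case False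
  with assms obtain s where "s < j" "I ! s \<noteq> J ! s" by (metis nth_equalityI)
  then have "(\<Prod>s<j. if I ! s = J ! s then a else 0) = 0"
    by (intro prod_zero) auto
  with False show ?thesis by simp
qed simp

lemma matrix_inv_eqI:
  fixes M N :: "real^'n::finite^'n"
  assumes "M ** N = mat 1" "N ** M = mat 1"
  shows "matrix_inv M = N"
proof -
  have "M ** matrix_inv M = mat 1 \<and> matrix_inv M ** M = mat 1"
    unfolding matrix_inv_def by (rule someI_ex) (use assms in blast)
  then have "matrix_inv M ** (M ** N) = N"
    by (simp add: matrix_mul_assoc)
  then show ?thesis using assms by simp
qed

lemma finite_lists_length: "finite {I :: 'n::finite list. length I = j}"
  using finite_lists_length_eq[of "UNIV :: 'n set" j] by simp

text \<open>The only transition map is the identity. Its Jacobian products single out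
  \<open>J = I\<close>, so that no condition remains.\<close>

lemma tensor_field_std: "tensor_field std_atlas j T"
proof -
  have "(\<Sum>J | length J = j. (\<Prod>s<j. (mat 1 :: real^'a^'a) $ (J ! s) $ (I ! s)) * T std_chart p J) = T std_chart p I"
    if I: "length I = j" for I p
  proof -
    have "(\<Sum>J | length J = j. (\<Prod>s<j. (mat 1 :: real^'a^'a) $ (J ! s) $ (I ! s)) * T std_chart p J)
        = (\<Sum>J | length J = j. if I = J then T std_chart p J else 0)"
      by (intro sum.cong) (auto simp: mat_def prod_delta_lists I)
    also have "\<dots> = T std_chart p I" using I finite_lists_length[where 'n='a] by simp
    finally show ?thesis .
  qed
  then show ?thesis unfolding tensor_field_def by simp
qed

lemma smooth_manifold_std: "smooth_manifold euclidean (std_atlas :: (real^'n::finite, 'n) chart set)"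
proof -
  have "is_chart euclidean (std_chart :: (real^'n, 'n) chart)"
    using homeomorphic_map_id[of "euclidean :: (real^'n) topology" euclidean] by (simp add: is_chart_def id_def)
  then have "smooth_atlas euclidean (std_atlas :: (real^'n, 'n) chart set)"
    by (auto simp: smooth_atlas_def smooth_coord)
  moreover have "second_countable (euclidean :: (real^'n) topology)"
  proof -
    obtain B :: "(real^'n) set set" where B: "countable B" "topological_basis B"
      using ex_countable_basis by blast
    have "\<exists>V\<in>B. x \<in> V \<and> V \<subseteq> U" if "open U" "x \<in> U" for U x
      by (rule topological_basisE[OF B(2) that]) blast
    then show ?thesis
      unfolding second_countable_def using B topological_basis_open[OF B(2)] by auto
  qed
  moreover have "connected_space (euclidean :: (real^'n) topology)"
    using connectedin_topspace[of "euclidean :: (real^'n) topology"] connected_UNIV by force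
  ultimately show ?thesis
    by (simp add: smooth_manifold_def)
qed

locale conformal =
  fixes lam :: "real^'n::finite \<Rightarrow> real"
  assumes lam_smooth: "smooth_on UNIV lam" and lam_pos: "lam x > 0"
begin

abbreviation G :: "(real^'n, 'n) metric_comps" where "G \<equiv> conf_metric lam"
abbreviation A :: "(real^'n, 'n) chart set" where "A \<equiv> std_atlas"
abbreviation X :: "(real^'n) topology" where "X \<equiv> euclidean"

lemma riemannian_manifold_conf: "riemannian_manifold X A G"
proof -
  have "smooth_on UNIV (\<lambda>x. G std_chart x $ i $ j)" for i j
    unfolding conf_metric_component
    by (cases "i = j") (auto intro: smooth_power lam_smooth smooth_const)
  moreover have "transpose (G c p) = G c p" for c p
    by (simp add: transpose_def vec_eq_iff conf_metric_component)
  moreover have "v \<bullet> (G c p *v v) > 0" if "v \<noteq> 0" for v c p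
  proof -
    have "G c p *v v = (lam p)\<^sup>2 *\<^sub>R v"
      by (simp add: conf_metric_def scaleR_matrix_vector_assoc[symmetric])
    then show ?thesis using that lam_pos[of p] by simp
  qed
  ultimately show ?thesis
    by (simp add: riemannian_manifold_def smooth_manifold_std riemannian_metric_def tensor_field_std)
qed

lemma matrix_inv_conf: "matrix_inv (G c p) $ i $ j = (if i = j then 1 / (lam p)\<^sup>2 else 0)"
proof -
  have "G c p ** ((1 / (lam p)\<^sup>2) *\<^sub>R mat 1) = mat 1" "((1 / (lam p)\<^sup>2) *\<^sub>R mat 1) ** G c p = mat 1"
    using lam_pos[of p] by (simp_all add: conf_metric_def flip: scalar_matrix_assoc matrix_scalar_ac)
  then have "matrix_inv (G c p) = (1 / (lam p)\<^sup>2) *\<^sub>R mat 1"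
    by (rule matrix_inv_eqI)
  then show ?thesis by (simp add: mat_def)
qed

lemma sqrt_det_conf: "sqrt (det (G c p)) = lam p ^ CARD('n)"
proof -
  have "det (G c p) = (\<Prod>i\<in>UNIV. G c p $ i $ i)"
    by (rule det_diagonal) (simp add: conf_metric_component)
  then have "det (G c p) = (lam p ^ CARD('n))\<^sup>2"
    by (simp add: conf_metric_component power_mult[symmetric] mult.commute)
  then show ?thesis using lam_pos[of p] by (simp add: less_imp_le)
qed

lemma borel_measurable_smooth: "smooth_on UNIV f \<Longrightarrow> f \<in> borel_measurable borel"
  by (simp add: borel_measurable_continuous_onI smooth_continuous)

lemma lam_measurable [measurable]: "lam \<in> borel_measurable borel"
  by (rule borel_measurable_smooth[OF lam_smooth])

section \<open>Measure, tensor norms and connection of the conformal metric\<close>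

definition vol :: "(real^'n) measure" where
  "vol = density lborel (\<lambda>x. ennreal (lam x ^ CARD('n)))"

text \<open>One chart covers everything, so the defining property prescribes the measure of every
  Borel set; this settles existence and uniqueness for the definite description.\<close>

lemma riem_measure_conf: "riem_measure X A G = vol"
proof -
  have sets: "sets (sigma (topspace X) {U. openin X U}) = sets borel"
    by (simp add: borel_def)
  have vol: "emeasure vol E = (\<integral>\<^sup>+x\<in>E. ennreal (lam x ^ CARD('n)) \<partial>lborel)" if "E \<in> sets borel" for E
    using that unfolding vol_def by (subst emeasure_density) auto
  show ?thesis
    unfolding riem_measure_def sets
  proof (rule the_equality)
    show "sets vol = sets borel \<and> (\<forall>c\<in>A. \<forall>E\<in>sets vol. E \<subseteq> fst c \<longrightarrow>
        emeasure vol E = (\<integral>\<^sup>+x\<in>snd c ` E. ennreal (sqrt (det (G c (cinv c x)))) \<partial>lborel))"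
      using vol by (simp add: sqrt_det_conf vol_def)
  next
    fix \<mu> :: "(real^'n) measure"
    assume \<mu>: "sets \<mu> = sets borel \<and> (\<forall>c\<in>A. \<forall>E\<in>sets \<mu>. E \<subseteq> fst c \<longrightarrow>
        emeasure \<mu> E = (\<integral>\<^sup>+x\<in>snd c ` E. ennreal (sqrt (det (G c (cinv c x)))) \<partial>lborel))"
    show "\<mu> = vol"
    proof (rule measure_eqI)
      show "sets \<mu> = sets vol" using \<mu> by (simp add: vol_def)
      show "emeasure \<mu> E = emeasure vol E" if "E \<in> sets \<mu>" for E
        using that \<mu> vol[of E] by (simp add: sqrt_det_conf)
    qed
  qed
qed

lemma tensor_norm_conf:
  "tensor_norm A G j T p = sqrt (\<Sum>I | length I = j. (T std_chart p I)\<^sup>2) / lam p ^ j"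
proof -
  have "(\<Sum>J | length J = j. (\<Prod>s<j. matrix_inv (G c p) $ (I ! s) $ (J ! s)) * T c p I * T c p J)
      = (1 / (lam p)\<^sup>2) ^ j * (T c p I)\<^sup>2" if I: "length I = j" for I c
  proof -
    have "(\<Sum>J | length J = j. (\<Prod>s<j. matrix_inv (G c p) $ (I ! s) $ (J ! s)) * T c p I * T c p J)
      = (\<Sum>J | length J = j. if I = J then (1 / (lam p)\<^sup>2) ^ j * T c p I * T c p J else 0)"
      by (intro sum.cong) (auto simp: matrix_inv_conf prod_delta_lists I)
    also have "\<dots> = (1 / (lam p)\<^sup>2) ^ j * (T c p I)\<^sup>2"
      using I finite_lists_length[where 'n='n] by (simp add: power2_eq_square)
    finally show ?thesis .
  qed
  then have "tensor_norm A G j T p = sqrt (\<Sum>I | length I = j. (1 / (lam p)\<^sup>2) ^ j * (T std_chart p I)\<^sup>2)"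
    unfolding tensor_norm_def by (simp add: Let_def)
  also have "\<dots> = sqrt ((1 / (lam p ^ j))\<^sup>2 * (\<Sum>I | length I = j. (T std_chart p I)\<^sup>2))"
    by (simp add: sum_distrib_left power_mult[symmetric] power_divide mult.commute)
  also have "\<dots> = sqrt (\<Sum>I | length I = j. (T std_chart p I)\<^sup>2) / lam p ^ j"
    using lam_pos[of p] by (simp add: real_sqrt_mult real_sqrt_divide)
  finally show ?thesis .
qed

text \<open>Passage from the intrinsic norm to coordinates. The factor \<open>lam p ^ j\<close> has
  to be absorbed by the test functions, which is the source of the condition on
  \<open>\<psi>\<close> in the later estimates.\<close>

lemma tensor_component_le:
  assumes "length I = j"
  shows "\<bar>T std_chart p I\<bar> \<le> lam p ^ j * tensor_norm A G j T p"
proof -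
  have "(T std_chart p I)\<^sup>2 \<le> (\<Sum>I | length I = j. (T std_chart p I)\<^sup>2)"
    by (rule member_le_sum) (use assms finite_lists_length in auto)
  then have "\<bar>T std_chart p I\<bar> \<le> sqrt (\<Sum>I | length I = j. (T std_chart p I)\<^sup>2)"
    using real_sqrt_le_mono by fastforce
  then show ?thesis using lam_pos[of p] by (simp add: tensor_norm_conf)
qed

lemma tensor_norm_nonneg: "tensor_norm A G j T p \<ge> 0"
  using lam_pos[of p] by (simp add: tensor_norm_conf sum_nonneg less_imp_le)

definition dlog :: "'n \<Rightarrow> real^'n \<Rightarrow> real" where
  "dlog i x = pd i lam x / lam x"

lemma smooth_dlog: "smooth_on UNIV (dlog i)"
  unfolding dlog_def by (intro smooth_divide smooth_pd lam_smooth lam_pos)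

text \<open>The classical symbols of exp (2 phi) times the Euclidean metric, where phi = ln
  \<open>lam\<close> and \<open>dlog i\<close> is its \<open>i\<close>-th partial
  derivative.\<close>

lemma christoffel_conf:
  "christoffel G std_chart x l i j =
     (if l = j then dlog i x else 0) + (if l = i then dlog j x else 0) - (if i = j then dlog l x else 0)"
proof -
  have pdG: "pd k (\<lambda>y. G std_chart y $ a $ b) x = (if a = b then 2 * lam x * pd k lam x else 0)" for k a b
  proof (cases "a = b")
    case True
    have "pd k (\<lambda>y. lam y * lam y) x = lam x * pd k lam x + pd k lam x * lam x"
      by (intro pd_mult smooth_differentiable lam_smooth)
    then show ?thesis using True by (simp add: conf_metric_component power2_eq_square)
  next
    case False
    then show ?thesis by (simp add: conf_metric_component pd_const)
  qed
  have "christoffel G std_chart x l i j = 1/2 * (\<Sum>m\<in>UNIV. if l = m then 1 / (lam x)\<^sup>2 *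
      ((if j = m then 2 * lam x * pd i lam x else 0) + (if i = m then 2 * lam x * pd j lam x else 0)
        - (if i = j then 2 * lam x * pd m lam x else 0)) else 0)"
    unfolding christoffel_def Let_def matrix_inv_conf cinv_std pdG
    by (intro arg_cong2[where f="(*)"] sum.cong) auto
  also have "\<dots> = 1/2 * (1 / (lam x)\<^sup>2 *
      ((if j = l then 2 * lam x * pd i lam x else 0) + (if i = l then 2 * lam x * pd j lam x else 0)
        - (if i = j then 2 * lam x * pd l lam x else 0)))"
    by simp
  finally show ?thesis using lam_pos[of x]
    by (simp add: dlog_def power2_eq_square)
qed

end

subsection \<open>Riemannian distance of a conformally flat metric\<close>

context conformal
begin

text \<open>This makes the standard operations on valid paths, joining and reversing, available. The
  end points, excluded in one notion only, go into the finite exceptional set.\<close>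

lemma piecewise_C1_path_iff_valid_path: "piecewise_C1_path X A \<gamma> \<longleftrightarrow> valid_path \<gamma>"
proof -
  have "pathin X \<gamma> \<longleftrightarrow> continuous_on {0..1} \<gamma>"
    by (simp add: pathin_def)
  moreover have "(\<exists>S. finite S \<and> \<gamma> C1_differentiable_on {t. 0 < t \<and> t < 1 \<and> t \<notin> S})
      \<longleftrightarrow> (\<exists>S. finite S \<and> \<gamma> C1_differentiable_on ({0..1} - S))"
  proof
    assume "\<exists>S. finite S \<and> \<gamma> C1_differentiable_on {t. 0 < t \<and> t < 1 \<and> t \<notin> S}"
    then obtain S where "finite S" "\<gamma> C1_differentiable_on {t. 0 < t \<and> t < 1 \<and> t \<notin> S}" by blast
    then have "finite (insert 0 (insert 1 S))" "\<gamma> C1_differentiable_on ({0..1} - insert 0 (insert 1 S))"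
      by (auto elim: C1_differentiable_on_subset)
    then show "\<exists>S. finite S \<and> \<gamma> C1_differentiable_on ({0..1} - S)" by blast
  next
    assume "\<exists>S. finite S \<and> \<gamma> C1_differentiable_on ({0..1} - S)"
    then obtain S where "finite S" "\<gamma> C1_differentiable_on ({0..1} - S)" by blast
    then have "\<gamma> C1_differentiable_on {t. 0 < t \<and> t < 1 \<and> t \<notin> S}"
      by (auto elim: C1_differentiable_on_subset)
    with \<open>finite S\<close> show "\<exists>S. finite S \<and> \<gamma> C1_differentiable_on {t. 0 < t \<and> t < 1 \<and> t \<notin> S}" by blast
  qed
  ultimately show ?thesis
    by (simp add: piecewise_C1_path_def valid_path_def piecewise_C1_differentiable_on_def comp_def)
qed

lemma speed_conf: "speed A G \<gamma> t = lam (\<gamma> t) * norm (vector_derivative \<gamma> (at t))"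
proof -
  have "v \<bullet> (G c p *v v) = (lam p * norm v)\<^sup>2" for v c p
    by (simp add: conf_metric_def scaleR_matrix_vector_assoc[symmetric] power_mult_distrib
        power2_norm_eq_inner)
  then show ?thesis
    using lam_pos[of "\<gamma> t"] by (simp add: speed_def Let_def comp_def)
qed

text \<open>The velocity in \<open>speed\<close> is a two-sided derivative, without meaning at the
  end points and at corners; these finitely many times form a null set.\<close>

lemma path_len_conf:
  assumes S: "finite S" and D: "\<And>t. t \<in> {0<..<1} - S \<Longrightarrow> (\<gamma> has_vector_derivative D t) (at t)"
  shows "path_len A G \<gamma> = (\<integral>\<^sup>+t\<in>{0<..<1} - S. ennreal (lam (\<gamma> t) * norm (D t)) \<partial>lborel)"
  unfolding path_len_def speed_conf
proof (rule nn_integral_cong_AE)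
  have "AE t in lborel. t \<notin> insert 0 (insert 1 S)"
    using S by (intro AE_not_in null_setsI emeasure_lborel_countable)
      (auto intro: countable_finite sets.sets_into_space simp: finite_imp_closed)
  then show "AE t in lborel. ennreal (lam (\<gamma> t) * norm (vector_derivative \<gamma> (at t))) * indicator {0..1} t =
      ennreal (lam (\<gamma> t) * norm (D t)) * indicator ({0<..<1} - S) t"
  proof eventually_elim
    case (elim t)
    then show ?case
      using D[of t] by (auto simp: indicator_def vector_derivative_at)
  qed
qed

text \<open>The indicator makes the integrand Borel measurable on the whole line, although nothing
  is known about the path outside the unit interval.\<close>

lemma valid_path_speed:
  assumes "valid_path \<gamma>"
  obtains S D where "finite S" "\<And>t. t \<in> {0<..<1} - S \<Longrightarrow> (\<gamma> has_vector_derivative D t) (at t)"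
    "(\<lambda>t. indicator ({0<..<1} - S) t * (lam (\<gamma> t) * norm (D t))) \<in> borel_measurable borel"
    "path_len A G \<gamma> = (\<integral>\<^sup>+t. ennreal (indicator ({0<..<1} - S) t * (lam (\<gamma> t) * norm (D t))) \<partial>lborel)"
proof -
  from assms obtain S D where S: "finite S" "continuous_on {0..1} \<gamma>"
    and D: "\<And>t. t \<in> {0..1} - S \<Longrightarrow> (\<gamma> has_vector_derivative D t) (at t)" "continuous_on ({0..1} - S) D"
    unfolding valid_path_def piecewise_C1_differentiable_on_def C1_differentiable_on_def by blast
  have sub: "{0<..<1} - S \<subseteq> {0..1} - S" by auto
  have "continuous_on ({0<..<1} - S) (\<lambda>t. lam (\<gamma> t) * norm (D t))"
    by (intro continuous_intros continuous_on_subset[OF D(2) sub]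
        continuous_on_compose2[OF smooth_continuous[OF lam_smooth, of UNIV]] continuous_on_subset[OF S(2)]) auto
  then have "(\<lambda>t. indicator ({0<..<1} - S) t *\<^sub>R (lam (\<gamma> t) * norm (D t))) \<in> borel_measurable borel"
    using S(1) by (intro borel_measurable_continuous_on_indicator borel_open open_Diff finite_imp_closed) auto
  then have m: "(\<lambda>t. indicator ({0<..<1} - S) t * (lam (\<gamma> t) * norm (D t))) \<in> borel_measurable borel"
    by simp
  have "path_len A G \<gamma> = (\<integral>\<^sup>+t\<in>{0<..<1} - S. ennreal (lam (\<gamma> t) * norm (D t)) \<partial>lborel)"
    using S(1) D(1) by (intro path_len_conf) auto
  also have "\<dots> = (\<integral>\<^sup>+t. ennreal (indicator ({0<..<1} - S) t * (lam (\<gamma> t) * norm (D t))) \<partial>lborel)"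
    by (intro nn_integral_cong) (auto simp: indicator_def)
  finally show thesis using that S(1) D(1) m sub by blast
qed

text \<open>The fundamental theorem of calculus for \<open>F\<close> along the path, the derivative
  being dominated by \<open>C\<close> times the speed. All lower bounds for the distance come from
  here.\<close>

lemma path_len_ge:
  assumes F: "\<And>x. (F has_derivative F' x) (at x)" "\<And>x v. \<bar>F' x v\<bar> \<le> C * lam x * norm v"
    and C: "C > 0" and \<gamma>: "valid_path \<gamma>"
  shows "ennreal (\<bar>F (\<gamma> 1) - F (\<gamma> 0)\<bar> / C) \<le> path_len A G \<gamma>"
proof -
  obtain S D where S: "finite S"
    and D: "\<And>t. t \<in> {0<..<1} - S \<Longrightarrow> (\<gamma> has_vector_derivative D t) (at t)"
    and m: "(\<lambda>t. indicator ({0<..<1} - S) t * (lam (\<gamma> t) * norm (D t))) \<in> borel_measurable borel"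
    and len: "path_len A G \<gamma> = (\<integral>\<^sup>+t. ennreal (indicator ({0<..<1} - S) t * (lam (\<gamma> t) * norm (D t))) \<partial>lborel)"
    using valid_path_speed[OF \<gamma>] by blast
  define h where "h t = indicator ({0<..<1} - S) t * (lam (\<gamma> t) * norm (D t))" for t
  have h0: "h t \<ge> 0" for t using lam_pos[of "\<gamma> t"] by (simp add: h_def)
  show ?thesis
  proof (cases "path_len A G \<gamma> = top")
    \<comment> \<open>Finite length makes the speed integrable, as the comparison of integrals
      requires; for infinite length there is nothing to show.\<close>
    case False
    then have "integrable lborel h"
      using m h0 len by (intro integrableI_nonneg) (auto simp: h_def[symmetric] less_top)
    then have h: "(h has_integral integral\<^sup>L lborel h) UNIV"
      by (rule has_integral_integral_lborel)
    have len': "path_len A G \<gamma> = ennreal (integral\<^sup>L lborel h)"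
      unfolding len h_def[symmetric] using \<open>integrable lborel h\<close> h0 by (intro nn_integral_eq_integral) auto
    have h': "(h has_integral integral\<^sup>L lborel h) {0..1}"
    proof -
      have "(\<lambda>t. if t \<in> {0..1} then h t else 0) = h" by (auto simp: h_def indicator_def fun_eq_iff)
      then show ?thesis using h has_integral_restrict_UNIV[of "{0..1}" h] by simp
    qed
    define g where "g t = (if t \<in> {0<..<1} - S then F' (\<gamma> t) (D t) else 0)" for t
    have "(g has_integral ((F \<circ> \<gamma>) 1 - (F \<circ> \<gamma>) 0)) {0..1}"
    proof (rule fundamental_theorem_of_calculus_interior_strong[OF S])
      show "((F \<circ> \<gamma>) has_vector_derivative g t) (at t)" if "t \<in> {0<..<1} - S" for t
      proof -
        have "(\<gamma> has_derivative (\<lambda>s. s *\<^sub>R D t)) (at t)"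
          using D[OF that] by (simp add: has_vector_derivative_def)
        then have "((\<lambda>t. F (\<gamma> t)) has_derivative (\<lambda>s. F' (\<gamma> t) (s *\<^sub>R D t))) (at t)"
          by (rule has_derivative_compose) (rule F(1))
        moreover have "F' (\<gamma> t) (s *\<^sub>R D t) = s *\<^sub>R g t" for s
          using that linear_cmul[OF has_derivative_linear[OF F(1)]] by (simp add: g_def)
        ultimately show ?thesis by (simp add: has_vector_derivative_def comp_def)
      qed
      have "continuous_on {0..1} \<gamma>"
        using \<gamma> by (simp add: valid_path_def piecewise_C1_differentiable_on_def)
      moreover have "continuous_on UNIV F"
        using F(1) has_derivative_continuous continuous_at_imp_continuous_on by blast
      ultimately show "continuous_on {0..1} (F \<circ> \<gamma>)"
        using continuous_on_compose2[of UNIV F "{0..1}" \<gamma>] by (simp add: comp_def)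
    qed simp
    moreover have "norm (g t) \<le> C * h t" for t
      using F(2)[of "\<gamma> t" "D t"] by (simp add: g_def h_def indicator_def mult_ac)
    ultimately have "norm ((F \<circ> \<gamma>) 1 - (F \<circ> \<gamma>) 0) \<le> C * integral\<^sup>L lborel h"
      using has_integral_mult_right[OF h', of C]
        Henstock_Kurzweil_Integration.integral_norm_bound_integral[of g "{0..1}" "\<lambda>t. C * h t"]
        integral_unique[OF h']
      by (auto simp: integrable_on_def integral_unique)
    then have "\<bar>F (\<gamma> 1) - F (\<gamma> 0)\<bar> / C \<le> integral\<^sup>L lborel h"
      using C by (simp add: field_simps)
    then show ?thesis unfolding len' by (rule ennreal_leI)
  qed simp
qed

lemma path_len_reversepath:
  assumes "valid_path \<gamma>"
  shows "path_len A G (reversepath \<gamma>) = path_len A G \<gamma>"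
proof -
  obtain S D where S: "finite S"
    and D: "\<And>t. t \<in> {0<..<1} - S \<Longrightarrow> (\<gamma> has_vector_derivative D t) (at t)"
    and m: "(\<lambda>t. indicator ({0<..<1} - S) t * (lam (\<gamma> t) * norm (D t))) \<in> borel_measurable borel"
    and len: "path_len A G \<gamma> = (\<integral>\<^sup>+t. ennreal (indicator ({0<..<1} - S) t * (lam (\<gamma> t) * norm (D t))) \<partial>lborel)"
    using valid_path_speed[OF assms] by blast
  have "(reversepath \<gamma> has_vector_derivative - D (1 - t)) (at t)"
    if "t \<in> {0<..<1} - (\<lambda>s. 1 - s) ` S" for t
  proof -
    have "1 - t \<notin> S" using that by force
    then have "(\<gamma> has_vector_derivative D (1 - t)) (at (1 - t))" using that by (intro D) auto
    then have "(\<gamma> \<circ> (\<lambda>t. 1 - t) has_vector_derivative (-1) *\<^sub>R D (1 - t)) (at t)"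
      by (intro vector_diff_chain_at) (auto intro!: derivative_eq_intros)
    then show ?thesis by (simp add: reversepath_def comp_def)
  qed
  then have "path_len A G (reversepath \<gamma>) = (\<integral>\<^sup>+t\<in>{0<..<1} - (\<lambda>s. 1 - s) ` S.
      ennreal (lam (reversepath \<gamma> t) * norm (- D (1 - t))) \<partial>lborel)"
    using S by (intro path_len_conf) auto
  also have "\<dots> = (\<integral>\<^sup>+t. ennreal (indicator ({0<..<1} - S) (1 + (-1) * t) *
      (lam (\<gamma> (1 + (-1) * t)) * norm (D (1 + (-1) * t)))) \<partial>lborel)"
    by (intro nn_integral_cong) (force simp: indicator_def reversepath_def)
  also have "\<dots> = path_len A G \<gamma>"
    unfolding len using nn_integral_real_affine[of "\<lambda>t. ennreal (indicator ({0<..<1} - S) t * (lam (\<gamma> t) * norm (D t)))" "-1" 1] m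
    by simp
  finally show ?thesis .
qed

lemma path_len_join:
  assumes \<gamma>: "valid_path \<gamma>1" "valid_path \<gamma>2"
  shows "path_len A G (\<gamma>1 +++ \<gamma>2) = path_len A G \<gamma>1 + path_len A G \<gamma>2"
proof -
  obtain S1 D1 where S1: "finite S1"
    and D1: "\<And>t. t \<in> {0<..<1} - S1 \<Longrightarrow> (\<gamma>1 has_vector_derivative D1 t) (at t)"
    and m1: "(\<lambda>t. indicator ({0<..<1} - S1) t * (lam (\<gamma>1 t) * norm (D1 t))) \<in> borel_measurable borel"
    and len1: "path_len A G \<gamma>1 = (\<integral>\<^sup>+t. ennreal (indicator ({0<..<1} - S1) t * (lam (\<gamma>1 t) * norm (D1 t))) \<partial>lborel)"
    using valid_path_speed[OF \<gamma>(1)] by blast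
  obtain S2 D2 where S2: "finite S2"
    and D2: "\<And>t. t \<in> {0<..<1} - S2 \<Longrightarrow> (\<gamma>2 has_vector_derivative D2 t) (at t)"
    and m2: "(\<lambda>t. indicator ({0<..<1} - S2) t * (lam (\<gamma>2 t) * norm (D2 t))) \<in> borel_measurable borel"
    and len2: "path_len A G \<gamma>2 = (\<integral>\<^sup>+t. ennreal (indicator ({0<..<1} - S2) t * (lam (\<gamma>2 t) * norm (D2 t))) \<partial>lborel)"
    using valid_path_speed[OF \<gamma>(2)] by blast
  define h1 where "h1 t = ennreal (indicator ({0<..<1} - S1) t * (lam (\<gamma>1 t) * norm (D1 t)))" for t
  define h2 where "h2 t = ennreal (indicator ({0<..<1} - S2) t * (lam (\<gamma>2 t) * norm (D2 t)))" for t
  have [measurable]: "h1 \<in> borel_measurable borel" "h2 \<in> borel_measurable borel"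
    using m1 m2 by (simp_all add: h1_def[abs_def] h2_def[abs_def])
  define D where "D t = (if t < 1/2 then 2 *\<^sub>R D1 (2 * t) else 2 *\<^sub>R D2 (2 * t - 1))" for t
  define S where "S = insert (1/2) ((\<lambda>s. s / 2) ` S1 \<union> (\<lambda>s. (s + 1) / 2) ` S2)"
  have S: "finite S" using S1 S2 by (simp add: S_def)
  have inS: "t \<noteq> 1/2 \<and> 2 * t \<notin> S1 \<and> 2 * t - 1 \<notin> S2" if "t \<notin> S" for t
    using that image_eqI[of t "\<lambda>s. s / 2" "2 * t" S1] image_eqI[of t "\<lambda>s. (s + 1) / 2" "2 * t - 1" S2]
    unfolding S_def by auto
  have Sin: "t \<notin> S" if "t \<noteq> 1/2" "2 * t \<notin> S1" "2 * t - 1 \<notin> S2" for t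
    using that unfolding S_def by (auto simp: field_simps)
  have D: "(\<gamma>1 +++ \<gamma>2 has_vector_derivative D t) (at t)" if "t \<in> {0<..<1} - S" for t
  proof (cases "t < 1/2")
    case True
    have "(\<gamma>1 has_vector_derivative D1 (2 * t)) (at (2 * t))"
      using True that inS[of t] by (intro D1) auto
    then have "(\<gamma>1 \<circ> (\<lambda>t. 2 * t) has_vector_derivative 2 *\<^sub>R D1 (2 * t)) (at t)"
      by (intro vector_diff_chain_at) (auto intro!: derivative_eq_intros)
    then have "(\<gamma>1 +++ \<gamma>2 has_vector_derivative 2 *\<^sub>R D1 (2 * t)) (at t)"
      by (rule has_vector_derivative_transform_within_open[where S = "{..<1/2}"])
        (use True in \<open>auto simp: joinpaths_def\<close>)
    with True show ?thesis by (simp add: D_def)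
  next
    case False
    then have t: "t > 1/2" using that inS[of t] by auto
    have "(\<gamma>2 has_vector_derivative D2 (2 * t - 1)) (at (2 * t - 1))"
      using t that inS[of t] by (intro D2) auto
    then have "(\<gamma>2 \<circ> (\<lambda>t. 2 * t - 1) has_vector_derivative 2 *\<^sub>R D2 (2 * t - 1)) (at t)"
      by (intro vector_diff_chain_at) (auto intro!: derivative_eq_intros)
    then have "(\<gamma>1 +++ \<gamma>2 has_vector_derivative 2 *\<^sub>R D2 (2 * t - 1)) (at t)"
      by (rule has_vector_derivative_transform_within_open[where S = "{1/2<..}"])
        (use t in \<open>auto simp: joinpaths_def\<close>)
    with False show ?thesis by (simp add: D_def)
  qed
  have "AE t in lborel. t \<notin> S"
    using S by (intro AE_not_in null_setsI emeasure_lborel_countable)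
      (auto intro: countable_finite simp: finite_imp_closed)
  \<comment> \<open>The indicators in \<open>h1\<close> and \<open>h2\<close> vanish outside the
    unit interval, so at most one summand is present at each time. The factor 2 is that of the chain
    rule and cancels in the affine substitutions.\<close>
  then have AE: "AE t in lborel. ennreal (lam ((\<gamma>1 +++ \<gamma>2) t) * norm (D t)) * indicator ({0<..<1} - S) t
      = 2 * h1 (0 + 2 * t) + 2 * h2 (-1 + 2 * t)"
  proof eventually_elim
    case (elim t)
    then show ?case
      using inS[OF elim] lam_pos
      by (auto simp: indicator_def D_def h1_def h2_def joinpaths_def ennreal_mult less_imp_le mult_ac)
  qed
  have "path_len A G (\<gamma>1 +++ \<gamma>2) = (\<integral>\<^sup>+t. 2 * h1 (0 + 2 * t) + 2 * h2 (-1 + 2 * t) \<partial>lborel)"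
    using path_len_conf[OF S D] nn_integral_cong_AE[OF AE] by simp
  also have "\<dots> = 2 * (\<integral>\<^sup>+t. h1 (0 + 2 * t) \<partial>lborel) + 2 * (\<integral>\<^sup>+t. h2 (-1 + 2 * t) \<partial>lborel)"
    by (subst nn_integral_add) (auto simp: nn_integral_cmult)
  also have "\<dots> = path_len A G \<gamma>1 + path_len A G \<gamma>2"
    using nn_integral_real_affine[of h1 2 0] nn_integral_real_affine[of h2 2 "-1"]
    unfolding len1 len2 h1_def[symmetric] h2_def[symmetric] by simp
  finally show ?thesis .
qed

lemma path_len_linepath_le:
  assumes "\<And>x. lam x \<le> L"
  shows "path_len A G (linepath p q) \<le> ennreal (L * norm (q - p))"
proof -
  have L: "L > 0" using lam_pos[of 0] assms[of 0] by linarith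
  have "path_len A G (linepath p q) = (\<integral>\<^sup>+t\<in>{0<..<1} - {}. ennreal (lam (linepath p q t) * norm (q - p)) \<partial>lborel)"
    by (rule path_len_conf) (auto intro: has_vector_derivative_linepath_within)
  also have "\<dots> \<le> (\<integral>\<^sup>+t. ennreal (L * norm (q - p)) * indicator {0<..<1::real} t \<partial>lborel)"
    using assms by (intro nn_integral_mono) (auto simp: indicator_def intro!: ennreal_leI mult_right_mono)
  also have "\<dots> = ennreal (L * norm (q - p))"
    by (simp add: nn_integral_cmult_indicator)
  finally show ?thesis .
qed

section \<open>The distance as an infimum of lengths\<close>

abbreviation rdist :: "real^'n \<Rightarrow> real^'n \<Rightarrow> real" where
  "rdist \<equiv> riem_dist X A G"

text \<open>Kept in \<open>ennreal\<close>, because \<open>riem_dist\<close> sends an infinite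
  infimum to 0: the triangle inequality is proved before the conversion and transferred once the
  values are known to be finite.\<close>

definition edist :: "real^'n \<Rightarrow> real^'n \<Rightarrow> ennreal" where
  "edist p q = (INF \<gamma> \<in> {\<gamma>. valid_path \<gamma> \<and> \<gamma> 0 = p \<and> \<gamma> 1 = q}. path_len A G \<gamma>)"

lemma edist_le: "valid_path \<gamma> \<Longrightarrow> \<gamma> 0 = p \<Longrightarrow> \<gamma> 1 = q \<Longrightarrow> edist p q \<le> path_len A G \<gamma>"
  unfolding edist_def by (rule INF_lower) simp

lemma edist_triangle: "edist p r \<le> edist p q + edist q r"
proof (rule ennreal_le_epsilon)
  fix e :: real assume fin: "edist p q + edist q r < top" and e: "0 < e"
  \<comment> \<open>Adding \<open>e/2\<close> gives a strict inequality for finite values only, and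
    \<open>ennreal_le_epsilon\<close> allows finiteness to be assumed.\<close>
  have less: "x < x + ennreal (e/2)" if "x < top" for x
    using that e
    by (cases x rule: ennreal_cases) (auto simp: ennreal_plus[symmetric] ennreal_less_iff simp del: ennreal_plus)
  have "edist p q < edist p q + ennreal (e/2)" "edist q r < edist q r + ennreal (e/2)"
    using fin e by (auto intro!: less)
  then obtain \<gamma>1 \<gamma>2 where
    \<gamma>1: "valid_path \<gamma>1" "\<gamma>1 0 = p" "\<gamma>1 1 = q" "path_len A G \<gamma>1 < edist p q + ennreal (e/2)" and
    \<gamma>2: "valid_path \<gamma>2" "\<gamma>2 0 = q" "\<gamma>2 1 = r" "path_len A G \<gamma>2 < edist q r + ennreal (e/2)"
    unfolding edist_def[of p q] edist_def[of q r] INF_less_iff by auto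
  have "edist p r \<le> path_len A G (\<gamma>1 +++ \<gamma>2)"
    using \<gamma>1 \<gamma>2 by (intro edist_le valid_path_join)
      (auto simp: pathfinish_def pathstart_def joinpaths_def)
  also have "\<dots> \<le> (edist p q + ennreal (e/2)) + (edist q r + ennreal (e/2))"
    unfolding path_len_join[OF \<gamma>1(1) \<gamma>2(1)] using \<gamma>1(4) \<gamma>2(4) by (intro add_mono) auto
  also have "\<dots> = edist p q + edist q r + (ennreal (e/2) + ennreal (e/2))"
    by (simp add: add_ac)
  also have "ennreal (e/2) + ennreal (e/2) = ennreal e"
    using e by (subst ennreal_plus[symmetric]) auto
  finally show "edist p r \<le> edist p q + edist q r + ennreal e" .
qed

lemma edist_commute: "edist p q = edist q p"
proof -
  have "edist p q \<le> edist q p" for p q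
    unfolding edist_def[of q p]
  proof (rule INF_greatest)
    fix \<gamma> assume "\<gamma> \<in> {\<gamma>. valid_path \<gamma> \<and> \<gamma> 0 = q \<and> \<gamma> 1 = p}"
    then show "edist p q \<le> path_len A G \<gamma>"
      using edist_le[of "reversepath \<gamma>" p q] path_len_reversepath[of \<gamma>] valid_path_imp_reverse[of \<gamma>]
      by (auto simp: reversepath_def)
  qed
  then show ?thesis using order_antisym by blast
qed

lemma rdist_edist: "rdist p q = enn2real (edist p q)"
  by (simp add: riem_dist_def edist_def piecewise_C1_path_iff_valid_path)

end

text \<open>A criterion for completeness. Functions whose gradient is bounded by \<open>C\<close> in
  the metric are Lipschitz for its distance: the proper \<open>\<rho>\<close> keeps Cauchy sequences
  in a bounded region, and the family \<open>F\<close> makes the distance definite. By the bound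
  \<open>L\<close> the distance is at most \<open>L\<close> times the Euclidean one.\<close>

locale conformal_complete = conformal lam for lam :: "real^'n::finite \<Rightarrow> real" +
  fixes L C :: real and \<rho> :: "real^'n \<Rightarrow> real" and F :: "'i \<Rightarrow> real^'n \<Rightarrow> real"
  assumes lam_le: "lam x \<le> L" and C_pos: "C > 0"
    and \<rho>_smooth: "smooth_on UNIV \<rho>"
    and \<rho>_deriv: "\<bar>frechet_derivative \<rho> (at x) v\<bar> \<le> C * lam x * norm v"
    and \<rho>_proper: "bounded {x. \<rho> x \<le> c}"
    and F_smooth: "smooth_on UNIV (F i)"
    and F_deriv: "\<bar>frechet_derivative (F i) (at x) v\<bar> \<le> C * lam x * norm v"
    and F_separates: "(\<And>i. F i x = F i y) \<Longrightarrow> x = y"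
begin

lemma edist_le_norm: "edist p q \<le> ennreal (L * norm (q - p))"
  using edist_le[of "linepath p q" p q] path_len_linepath_le[OF lam_le, of p q]
  by (simp add: linepath_0' linepath_1')

lemma edist_rdist: "edist p q = ennreal (rdist p q)"
  using edist_le_norm[of p q] unfolding rdist_edist by (auto simp: ennreal_enn2real_if top_unique)

lemma rdist_le_norm: "rdist p q \<le> L * norm (q - p)"
proof -
  have "L > 0" using lam_pos[of 0] lam_le[of 0] by linarith
  then show ?thesis using edist_le_norm[of p q] unfolding edist_rdist by (simp add: ennreal_le_iff)
qed

lemma rdist_nonneg: "rdist p q \<ge> 0"
  by (simp add: rdist_edist)

lemma rdist_triangle: "rdist p r \<le> rdist p q + rdist q r"
  using edist_triangle[of p r q] rdist_nonneg
  by (simp add: edist_rdist ennreal_plus[symmetric] del: ennreal_plus)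

lemma rdist_ge:
  assumes "smooth_on UNIV f" "\<And>x v. \<bar>frechet_derivative f (at x) v\<bar> \<le> C * lam x * norm v"
  shows "\<bar>f q - f p\<bar> \<le> C * rdist p q"
proof -
  have "ennreal (\<bar>f q - f p\<bar> / C) \<le> edist p q"
    unfolding edist_def
  proof (rule INF_greatest)
    fix \<gamma> assume "\<gamma> \<in> {\<gamma>. valid_path \<gamma> \<and> \<gamma> 0 = p \<and> \<gamma> 1 = q}"
    then show "ennreal (\<bar>f q - f p\<bar> / C) \<le> path_len A G \<gamma>"
      using path_len_ge[OF smooth_has_derivative[OF assms(1)] assms(2) C_pos, of \<gamma>] by auto
  qed
  then have "\<bar>f q - f p\<bar> / C \<le> rdist p q"
    unfolding edist_rdist using rdist_nonneg by (simp add: ennreal_le_iff)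
  then show ?thesis using C_pos by (simp add: field_simps)
qed

lemma Metric_space_rdist: "Metric_space UNIV rdist"
proof
  show "0 \<le> rdist x y" for x y by (rule rdist_nonneg)
  show "rdist x y = rdist y x" for x y by (simp add: rdist_edist edist_commute)
  show "rdist x z \<le> rdist x y + rdist y z" for x y z by (rule rdist_triangle)
  show "rdist x y = 0 \<longleftrightarrow> x = y" for x y
  proof
    assume "rdist x y = 0"
    then have "F i x = F i y" for i using rdist_ge[OF F_smooth F_deriv, of i y x] by simp
    then show "x = y" by (rule F_separates)
  next
    assume "x = y"
    then show "rdist x y = 0" using rdist_le_norm[of x y] rdist_nonneg[of x y] by simp
  qed
qed

text \<open>A tail of a Cauchy sequence is bounded through \<open>\<rho>\<close>, so a subsequence
  converges in the Euclidean sense and hence for \<open>rdist\<close>; the Cauchy property extends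
  this to the whole sequence.\<close>

lemma mcomplete_rdist: "Metric_space.mcomplete UNIV rdist"
proof -
  interpret M: Metric_space UNIV rdist by (rule Metric_space_rdist)
  have L: "L > 0" using lam_pos[of 0] lam_le[of 0] by linarith
  show ?thesis
    unfolding M.mcomplete_def
  proof (intro allI impI)
    fix \<sigma> assume \<sigma>: "M.MCauchy \<sigma>"
    then obtain N where N: "rdist (\<sigma> N) (\<sigma> n) < 1" if "n \<ge> N" for n
      unfolding M.MCauchy_def by (meson order_refl zero_less_one)
    have "\<rho> (\<sigma> n) \<le> \<rho> (\<sigma> N) + C" if "n \<ge> N" for n
    proof -
      have "\<bar>\<rho> (\<sigma> n) - \<rho> (\<sigma> N)\<bar> \<le> C * rdist (\<sigma> N) (\<sigma> n)" by (rule rdist_ge[OF \<rho>_smooth \<rho>_deriv])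
      also have "\<dots> \<le> C * 1" using N[OF that] C_pos by (intro mult_left_mono) auto
      finally show ?thesis by simp
    qed
    then have "bounded (range (\<lambda>n. \<sigma> (N + n)))"
      by (intro bounded_subset[OF \<rho>_proper[of "\<rho> (\<sigma> N) + C"]]) auto
    then obtain l r where r: "strict_mono r" and l: "((\<lambda>n. \<sigma> (N + n)) \<circ> r) \<longlonglongrightarrow> l"
      using bounded_imp_convergent_subsequence by blast
    have "\<exists>K. \<forall>n\<ge>K. \<sigma> n \<in> UNIV \<and> rdist (\<sigma> n) l < e" if e: "e > 0" for e
    proof -
      obtain K where K: "rdist (\<sigma> n) (\<sigma> m) < e/2" if "n \<ge> K" "m \<ge> K" for n m
        using \<sigma> e unfolding M.MCauchy_def by (meson half_gt_zero)
      from l have "\<forall>\<^sub>F m in sequentially. dist (((\<lambda>n. \<sigma> (N + n)) \<circ> r) m) l < e / (2 * L)"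
        by (rule tendstoD) (use e L in auto)
      then obtain K' where K': "dist (\<sigma> (N + r m)) l < e / (2 * L)" if "m \<ge> K'" for m
        unfolding eventually_sequentially by auto
      define m where "m = max K K'"
      have m: "N + r m \<ge> K" "m \<ge> K'" using seq_suble[OF r, of m] by (auto simp: m_def)
      have "rdist (\<sigma> (N + r m)) l \<le> L * norm (l - \<sigma> (N + r m))" by (rule rdist_le_norm)
      also have "\<dots> \<le> e/2" using K'[OF m(2)] L by (simp add: dist_norm norm_minus_commute field_simps)
      finally have "rdist (\<sigma> (N + r m)) l \<le> e/2" .
      then have "rdist (\<sigma> n) l < e" if "n \<ge> K" for n
        using rdist_triangle[of "\<sigma> n" l "\<sigma> (N + r m)"] K[OF that m(1)] by linarith
      then show ?thesis by blast
    qed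
    then show "\<exists>x. limitin M.mtopology \<sigma> x sequentially"
      unfolding M.limit_metric_sequentially by blast
  qed
qed

theorem complete_conf: "complete_riemannian_manifold X A G"
  using riemannian_manifold_conf mcomplete_rdist by (simp add: complete_riemannian_manifold_def)

end

subsection \<open>Sobolev functions that are constant near infinity\<close>

context conformal
begin

text \<open>The classical counterpart of \<open>weak_cov_deriv\<close>. Lists whose length is not
  the order carry values without meaning, which the Sobolev notions never read.\<close>

primrec cov_derivs :: "(real^'n \<Rightarrow> real) \<Rightarrow> nat \<Rightarrow> real^'n \<Rightarrow> 'n list \<Rightarrow> real" where
  "cov_derivs w 0 x I = w x"
| "cov_derivs w (Suc j) x I = pd (hd I) (\<lambda>y. cov_derivs w j y (tl I)) x
     - (\<Sum>s<j. \<Sum>l\<in>UNIV. christoffel G std_chart x l (hd I) (tl I ! s) * cov_derivs w j x ((tl I)[s := l]))"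

lemma smooth_christoffel: "smooth_on UNIV (\<lambda>x. christoffel G std_chart x l i j)"
proof -
  have "smooth_on UNIV (\<lambda>x. if P then dlog i x else 0)" for P i
    by (cases P) (auto intro: smooth_dlog smooth_const)
  then show ?thesis
    unfolding christoffel_conf by (intro smooth_add smooth_diff)
qed

lemma smooth_cov_derivs: "smooth_on UNIV w \<Longrightarrow> smooth_on UNIV (\<lambda>x. cov_derivs w j x I)"
proof (induction j arbitrary: I)
  case (Suc j)
  then show ?case
    unfolding cov_derivs.simps
    by (intro smooth_diff smooth_sum smooth_mult smooth_christoffel smooth_pd) auto
qed simp

text \<open>At order one the constant \<open>c\<close> has been differentiated away, and as the
  complement of \<open>K\<close> is open, vanishing there passes to all further derivatives.\<close>

lemma cov_derivs_zero_outside: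
  assumes K: "closed K" "\<And>x. x \<notin> K \<Longrightarrow> w x = c"
  shows "x \<notin> K \<Longrightarrow> cov_derivs w (Suc j) x I = 0"
proof (induction j arbitrary: x I)
  case 0
  have "pd (hd I) w x = 0" by (rule pd_zero_outside[OF K(1) _ 0]) (rule K(2))
  then show ?case by simp
next
  case (Suc j)
  have "pd (hd I) (\<lambda>y. cov_derivs w (Suc j) y (tl I)) x = 0"
    by (rule pd_zero_outside[OF K(1) _ Suc.prems]) (rule Suc.IH)
  then show ?case
    unfolding cov_derivs.simps(2)[of w "Suc j"] using Suc.IH[OF Suc.prems] by simp
qed

lemma weak_cov_deriv_cov_derivs:
  assumes w: "smooth_on UNIV w"
  shows "weak_cov_deriv A G j (\<lambda>c x I. cov_derivs w j x I) (\<lambda>c x I. cov_derivs w (Suc j) x I)"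
  unfolding weak_cov_deriv_def
  using integral_pd_by_parts[OF smooth_cov_derivs[OF w]] by simp

lemma finite_measure_vol: "emeasure vol UNIV < \<infinity> \<Longrightarrow> finite_measure vol"
  by (intro finite_measureI) (simp add: vol_def)

text \<open>All tensor norms are bounded: those of positive order have compact support, and at order
  zero \<open>w\<close> differs from a constant by a function with compact support. Finite measure
  does the rest. The lemma puts 1 into the Sobolev space and, for \<open>1 - f\<close>, ensures that
  the choice in \<open>sobolev_norm\<close> is a jet.\<close>

lemma sobolev_jet_constant_outside:
  assumes vol: "emeasure vol UNIV < \<infinity>" and p: "p > 0"
    and w: "smooth_on UNIV w" and K: "compact K" "\<And>x. x \<notin> K \<Longrightarrow> w x = c"
  shows "sobolev_jet X A G k p w (\<lambda>j c x I. cov_derivs w j x I)"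
proof -
  interpret finite_measure vol by (rule finite_measure_vol[OF vol])
  define T where "T = (\<lambda>j (c :: (real^'n, 'n) chart) x I. cov_derivs w j x I)"
  have cont: "continuous_on UNIV (\<lambda>x. T j c x I)" for j c I
    unfolding T_def by (rule smooth_continuous[OF smooth_cov_derivs[OF w]])
  have contN: "continuous_on UNIV (tensor_norm A G j (T j))" for j
    unfolding tensor_norm_conf[abs_def] using lam_pos
    by (intro continuous_intros cont smooth_continuous[OF lam_smooth]) (auto simp: less_imp_neq[symmetric])
  have "\<exists>B. \<forall>x. tensor_norm A G j (T j) x \<le> B" for j
  proof (cases j)
    case 0
    have "continuous_on UNIV (\<lambda>x. w x - c)" using smooth_continuous[OF w] by (intro continuous_intros) auto
    then obtain B where B: "\<And>x. \<bar>w x - c\<bar> \<le> B"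
      using bounded_compact_support[of "\<lambda>x. w x - c" K] K by (metis diff_self)
    have "tensor_norm A G j (T j) x \<le> \<bar>c\<bar> + B" for x
      using B[of x] 0 by (simp add: tensor_norm_conf T_def)
    then show ?thesis by blast
  next
    case (Suc i)
    have "tensor_norm A G j (T j) x = 0" if "x \<notin> K" for x
      unfolding tensor_norm_conf T_def Suc
      using cov_derivs_zero_outside[OF compact_imp_closed[OF K(1)] K(2) that] by simp
    then obtain B where "\<And>x. \<bar>tensor_norm A G j (T j) x\<bar> \<le> B"
      using bounded_compact_support[OF contN K(1)] by metis
    then show ?thesis by (metis abs_le_D1)
  qed
  then obtain B where B: "\<And>j x. tensor_norm A G j (T j) x \<le> B j" by metis
  have "integrable vol (\<lambda>q. tensor_norm A G j (T j) q powr p)" for j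
  proof (rule integrable_const_bound)
    show "AE x in vol. norm (tensor_norm A G j (T j) x powr p) \<le> B j powr p"
      using B p by (intro AE_I2) (auto intro!: powr_mono2 tensor_norm_nonneg)
    show "(\<lambda>q. tensor_norm A G j (T j) q powr p) \<in> borel_measurable vol"
    proof -
      have [measurable]: "tensor_norm A G j (T j) \<in> borel_measurable borel"
        by (rule borel_measurable_continuous_onI[OF contN])
      show ?thesis unfolding vol_def by simp
    qed
  qed
  moreover have "locally_integrable_tensor A j (T j)" for j
  proof -
    have "integrable lborel (\<lambda>x. indicator K x *\<^sub>R T j c x I)" if "compact K" for K c I
      by (rule borel_integrable_compact[OF that continuous_on_subset[OF cont]]) simp
    then show ?thesis
      by (simp add: locally_integrable_tensor_def set_integrable_def tensor_field_std)
  qed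
  moreover have "weak_cov_deriv A G j (T j) (T (Suc j))" for j
    unfolding T_def by (rule weak_cov_deriv_cov_derivs[OF w])
  ultimately have "sobolev_jet X A G k p w T"
    unfolding sobolev_jet_def riem_measure_conf by (simp add: T_def)
  then show ?thesis by (simp add: T_def)
qed

text \<open>The norm evaluates a jet picked by \<open>SOME\<close>. One known jet ensures that the
  picked object is a jet, but nothing identifies the two, so the later estimates are made for
  arbitrary weak jets.\<close>

lemma sobolev_norm_less:
  assumes T: "sobolev_jet X A G k p w T" and p: "p > 0" and less: "sobolev_norm X A G k p w < \<epsilon>"
  obtains T where "sobolev_jet X A G k p w T"
    "\<And>j. j \<le> k \<Longrightarrow> (LINT q|vol. tensor_norm A G j (T j) q powr p) \<le> \<epsilon> powr p"
proof -
  define S where "S = (SOME T. sobolev_jet X A G k p w T)"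
  have S: "sobolev_jet X A G k p w S" unfolding S_def
    by (rule someI[of "sobolev_jet X A G k p w", OF T])
  define a where "a j = (LINT q|vol. tensor_norm A G j (S j) q powr p)" for j
  have a: "a j \<ge> 0" for j unfolding a_def by (intro integral_nonneg_AE AE_I2) simp
  have "(\<Sum>j\<le>k. a j powr (1/p)) < \<epsilon>"
    using less unfolding sobolev_norm_def S_def[symmetric] Let_def riem_measure_conf a_def .
  then have "a j powr (1/p) \<le> \<epsilon>" if "j \<le> k" for j
    using member_le_sum[of j "{..k}" "\<lambda>j. a j powr (1/p)"] that by auto
  then have "(a j powr (1/p)) powr p \<le> \<epsilon> powr p" if "j \<le> k" for j
    using that p by (intro powr_mono2) auto
  then have "a j \<le> \<epsilon> powr p" if "j \<le> k" for j
  proof -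
    have "(a j powr (1/p)) powr p = a j" using p a[of j] by (simp add: powr_powr)
    with that show ?thesis using \<open>\<And>j. j \<le> k \<Longrightarrow> (a j powr (1/p)) powr p \<le> \<epsilon> powr p\<close> by metis
  qed
  then show thesis using that S unfolding a_def by blast
qed

text \<open>Splitting at the value \<open>\<delta>\<close> of the tensor norm replaces Hoelder's inequality on the finite
  measure space.\<close>

lemma abs_integral_component_le:
  assumes vol: "emeasure vol UNIV < \<infinity>" and p: "p \<ge> 1" and \<delta>: "\<delta> > 0"
    and I: "length I = j" and \<psi>: "\<And>x. lam x ^ j * \<bar>\<psi> x\<bar> \<le> M * lam x ^ CARD('n)"
    and int: "integrable vol (\<lambda>q. tensor_norm A G j T q powr p)"
  shows "\<bar>LINT x|lborel. T std_chart x I * \<psi> x\<bar>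
      \<le> M * (\<delta> * measure vol UNIV + \<delta> powr (1 - p) * (LINT q|vol. tensor_norm A G j T q powr p))"
proof -
  interpret finite_measure vol by (rule finite_measure_vol[OF vol])
  have "0 \<le> lam 0 ^ j * \<bar>\<psi> 0\<bar>" using lam_pos[of 0] by (simp add: less_imp_le)
  then have "0 \<le> M * lam 0 ^ CARD('n)" using \<psi>[of 0] by linarith
  then have M: "M \<ge> 0" using zero_less_power[OF lam_pos[of 0], of "CARD('n)"]
    by (auto simp: zero_le_mult_iff)
  define N where "N x = tensor_norm A G j T x" for x
  define g where "g x = M * (\<delta> + \<delta> powr (1 - p) * N x powr p)" for x
  have N: "N x \<ge> 0" for x by (simp add: N_def tensor_norm_nonneg)
  have "N x \<le> \<delta> + \<delta> powr (1 - p) * N x powr p" for x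
  proof (cases "N x \<le> \<delta>")
    case False
    then have "N x powr (1 - p) \<le> \<delta> powr (1 - p)" using p \<delta> by (intro powr_mono2') auto
    then have "N x powr (1 - p) * N x powr p \<le> \<delta> powr (1 - p) * N x powr p"
      by (intro mult_right_mono) auto
    moreover have "N x powr (1 - p) * N x powr p = N x"
      using False \<delta> by (simp add: powr_add[symmetric])
    ultimately show ?thesis using \<delta> by linarith
  qed (use \<delta> in \<open>simp add: add_increasing2\<close>)
  then have g: "M * N x \<le> g x" for x unfolding g_def using M by (intro mult_left_mono)
  have bound: "\<bar>T std_chart x I * \<psi> x\<bar> \<le> lam x ^ CARD('n) * g x" for x
  proof -
    have "\<bar>T std_chart x I * \<psi> x\<bar> \<le> (lam x ^ j * N x) * \<bar>\<psi> x\<bar>"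
      unfolding abs_mult N_def by (intro mult_right_mono tensor_component_le I) simp
    also have "\<dots> = N x * (lam x ^ j * \<bar>\<psi> x\<bar>)" by simp
    also have "\<dots> \<le> N x * (M * lam x ^ CARD('n))" by (intro mult_left_mono \<psi> N)
    also have "\<dots> = lam x ^ CARD('n) * (M * N x)" by simp
    also have "\<dots> \<le> lam x ^ CARD('n) * g x"
      using lam_pos[of x] by (intro mult_left_mono g) (simp add: less_imp_le)
    finally show ?thesis .
  qed
  have intg: "integrable vol g"
    unfolding g_def N_def using int by simp
  then have gm: "g \<in> borel_measurable borel" by (simp add: vol_def borel_measurable_integrable)
  have intl: "integrable lborel (\<lambda>x. lam x ^ CARD('n) * g x)"
    using intg lam_pos gm unfolding vol_def by (subst (asm) integrable_density) (auto simp: less_imp_le)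
  have eq: "(LINT x|lborel. lam x ^ CARD('n) * g x) = (LINT x|vol. g x)"
    using lam_pos gm unfolding vol_def by (subst integral_density) (auto simp: less_imp_le)
  have "\<bar>LINT x|lborel. T std_chart x I * \<psi> x\<bar> \<le> (LINT x|lborel. lam x ^ CARD('n) * g x)"
  proof (cases "integrable lborel (\<lambda>x. T std_chart x I * \<psi> x)")
    case True
    then show ?thesis using intl bound
      by (intro order_trans[OF integral_abs_bound] integral_mono) auto
  next
    \<comment> \<open>A product that is not integrable has integral 0 by default, and the right-hand
      side is nonnegative.\<close>
    case False
    have "0 \<le> lam x ^ CARD('n) * g x" for x using bound[of x] abs_ge_zero order_trans by blast
    then show ?thesis using False by (simp add: not_integrable_integral_eq integral_nonneg_AE)
  qed
  also have "\<dots> = (LINT x|vol. g x)" by (rule eq)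
  also have "\<dots> = M * (\<delta> * measure vol UNIV + \<delta> powr (1 - p) * (LINT q|vol. N q powr p))"
  proof -
    have "space vol = UNIV" by (simp add: vol_def)
    then show ?thesis unfolding g_def using int by (simp add: N_def)
  qed
  finally show ?thesis unfolding N_def .
qed

text \<open>The hypothesis \<open>main\<close> says that the weak derivatives of \<open>1 - f\<close> up to order two cannot all be
  small in \<open>L\<^sup>1\<close>.\<close>

lemma not_test_functions_dense:
  assumes vol: "emeasure vol UNIV < \<infinity>" and k: "k \<ge> 2" and p: "p \<ge> 1" and m: "m > 0"
    and main: "\<And>f K T Q. smooth_on UNIV f \<Longrightarrow> compact K \<Longrightarrow> (\<And>x. x \<notin> K \<Longrightarrow> f x = 0) \<Longrightarrow>
      (\<And>x. T 0 std_chart x [] = 1 - f x) \<Longrightarrow>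
      (\<And>j. j \<le> 2 \<Longrightarrow> locally_integrable_tensor A j (T j)) \<Longrightarrow>
      (\<And>j. j < 2 \<Longrightarrow> weak_cov_deriv A G j (T j) (T (Suc j))) \<Longrightarrow> 
      (\<And>j I \<psi>. j \<le> 2 \<Longrightarrow> length I = j \<Longrightarrow> (\<And>x. lam x ^ j * \<bar>\<psi> x\<bar> \<le> M * lam x ^ CARD('n)) \<Longrightarrow>
        \<bar>LINT x|lborel. T j std_chart x I * \<psi> x\<bar> \<le> M * Q) \<Longrightarrow> m \<le> Q"
    and M: "M > 0"
  shows "\<not> test_functions_dense X A G k p"
proof
  assume dense: "test_functions_dense X A G k p"
  have p0: "p > 0" using p by simp
  define V where "V = measure vol UNIV"
  have V: "V \<ge> 0" by (simp add: V_def)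
  \<comment> \<open>\<open>\<delta>\<close> makes the first term of the bound at most
    \<open>m / 4\<close>, and \<open>\<epsilon>\<close> below makes the second one equal to
    \<open>m / 4\<close>; their sum stays below \<open>m\<close>.\<close>
  define \<delta> where "\<delta> = m / (4 * (V + 1))"
  have \<delta>: "\<delta> > 0" using m V by (simp add: \<delta>_def)
  have "\<delta> * V \<le> \<delta> * (V + 1)" using \<delta> by (intro mult_left_mono) auto
  also have "\<dots> = m / 4" unfolding \<delta>_def using V by (simp add: field_simps)
  finally have \<delta>V: "\<delta> * V \<le> m / 4" .
  define \<epsilon> where "\<epsilon> = (m / 4 * \<delta> powr (p - 1)) powr (1 / p)"
  have \<epsilon>: "\<epsilon> > 0" using m \<delta> by (simp add: \<epsilon>_def)
  have \<epsilon>p: "\<epsilon> powr p = m / 4 * \<delta> powr (p - 1)" using m \<delta> p0 by (simp add: \<epsilon>_def powr_powr)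
  have "\<delta> powr (1 - p) * \<delta> powr (p - 1) = 1"
    using \<delta> by (simp add: powr_add[symmetric])
  then have \<epsilon>\<delta>: "\<delta> powr (1 - p) * \<epsilon> powr p = m / 4"
    unfolding \<epsilon>p mult.left_commute[of _ "m / 4"] by simp
  have "sobolev_jet X A G k p (\<lambda>_. 1) (\<lambda>j c x I. cov_derivs (\<lambda>_. 1) j x I)"
    by (rule sobolev_jet_constant_outside[OF vol p0 smooth_const compact_empty]) simp
  then have "(\<lambda>_. 1) \<in> sobolev_space X A G k p"
    unfolding sobolev_space_def by blast
  from dense[unfolded test_functions_dense_def, rule_format, OF this \<epsilon>]
  obtain f where f: "f \<in> smooth_compact_support X A" "sobolev_norm X A G k p (\<lambda>q. 1 - f q) < \<epsilon>"
    by auto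
  have sf: "smooth_on UNIV f"
    using f(1) by (simp add: smooth_compact_support_def smooth_fun_def comp_def)
  define K where "K = closure {p. f p \<noteq> 0}"
  have K: "compact K" "\<And>x. x \<notin> K \<Longrightarrow> f x = 0"
    using f(1) closure_subset[of "{p. f p \<noteq> 0}"] by (auto simp: smooth_compact_support_def K_def)
  have "sobolev_jet X A G k p (\<lambda>q. 1 - f q) (\<lambda>j c x I. cov_derivs (\<lambda>q. 1 - f q) j x I)"
    by (rule sobolev_jet_constant_outside[OF vol p0 _ K(1), of _ 1])
      (auto intro: smooth_diff smooth_const sf simp: K(2))
  then obtain T where T: "sobolev_jet X A G k p (\<lambda>q. 1 - f q) T"
    "\<And>j. j \<le> k \<Longrightarrow> (LINT q|vol. tensor_norm A G j (T j) q powr p) \<le> \<epsilon> powr p"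
    using sobolev_norm_less[OF _ p0 f(2)] by blast
  have "m \<le> \<delta> * V + \<delta> powr (1 - p) * \<epsilon> powr p"
  proof (rule main[OF sf K, of T])
    show "T 0 std_chart x [] = 1 - f x" for x
      using T(1) by (simp add: sobolev_jet_def)
    show "locally_integrable_tensor A j (T j)" if "j \<le> 2" for j
      using T(1) k that by (simp add: sobolev_jet_def)
    show "weak_cov_deriv A G j (T j) (T (Suc j))" if "j < 2" for j
      using T(1) k that by (simp add: sobolev_jet_def)
    fix j I \<psi>
    assume j: "j \<le> (2::nat)" and I: "length (I :: 'n list) = j"
      and \<psi>: "\<And>x. lam x ^ j * \<bar>\<psi> x\<bar> \<le> M * lam x ^ CARD('n)"
    have int: "integrable vol (\<lambda>q. tensor_norm A G j (T j) q powr p)"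
      using T(1) k j by (simp add: sobolev_jet_def riem_measure_conf)
    have "\<bar>LINT x|lborel. T j std_chart x I * \<psi> x\<bar>
      \<le> M * (\<delta> * measure vol UNIV + \<delta> powr (1 - p) * (LINT q|vol. tensor_norm A G j (T j) q powr p))"
      by (rule abs_integral_component_le[OF vol p \<delta> I \<psi> int])
    also have "\<dots> \<le> M * (\<delta> * V + \<delta> powr (1 - p) * \<epsilon> powr p)"
      unfolding V_def using M T(2)[of j] j k by (intro mult_left_mono add_left_mono) auto
    finally show "\<bar>LINT x|lborel. T j std_chart x I * \<psi> x\<bar> \<le> M * (\<delta> * V + \<delta> powr (1 - p) * \<epsilon> powr p)" .
  qed
  then show False using \<delta>V \<epsilon>\<delta> m by linarith
qed

end

subsection \<open>An oscillating conformal factor\<close>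

text \<open>The offset 3 exceeds e, so that \<open>ln (rad x)\<close> is at least 1 and
  \<open>beta\<close> has no singularity.\<close>

definition rad :: "real^'n::finite \<Rightarrow> real" where
  "rad x = 3 + x \<bullet> x"

definition beta :: "real^'n::finite \<Rightarrow> real" where
  "beta x = 1 / (sqrt (rad x) * ln (rad x))"

text \<open>Bounded above and below, so that completeness and volume are governed by
  \<open>beta\<close>. The frequency is matched to the factor \<open>exp (- t)\<close> in
  \<open>prof\<close> and \<open>corr\<close>.\<close>

definition osc :: "real \<Rightarrow> real" where
  "osc t = 2 + sin (exp t)"

definition osc_factor :: "'n::finite \<Rightarrow> real^'n \<Rightarrow> real" where
  "osc_factor a x = beta x * osc (x $ a)"

lemma rad_ge_3: "rad x \<ge> 3" and rad_pos: "rad x > 0"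
  by (simp_all add: rad_def add_pos_nonneg)

lemma ln_rad_ge_1: "ln (rad x) \<ge> 1"
proof -
  have "exp 1 \<le> rad x" using exp_le rad_ge_3[of x] by linarith
  then show ?thesis using rad_pos[of x] by (simp add: ln_ge_iff)
qed

lemma ln_rad_pos: "ln (rad x) > 0"
  using ln_rad_ge_1[of x] by linarith

lemma norm_le_sqrt_rad: "norm x \<le> sqrt (rad x)"
  unfolding norm_eq_sqrt_inner rad_def by (rule real_sqrt_le_mono) simp

lemma norm_power2_le_rad: "(norm x)\<^sup>2 \<le> rad x"
  by (simp add: rad_def power2_norm_eq_inner)

lemma abs_coord_le_rad: "\<bar>x $ i\<bar> \<le> rad x"
proof -
  have "\<bar>x $ i\<bar> \<le> norm x" by (rule component_le_norm_cart)
  also have "norm x \<le> 1 + (norm x)\<^sup>2"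
  proof -
    have "0 \<le> (norm x - 1)\<^sup>2" by simp
    then have "2 * norm x \<le> 1 + (norm x)\<^sup>2" by (simp add: power2_diff)
    with norm_ge_zero[of x] show ?thesis by linarith
  qed
  also have "\<dots> \<le> rad x" using norm_power2_le_rad[of x] by (simp add: rad_def power2_norm_eq_inner)
  finally show ?thesis .
qed

lemma smooth_rad: "smooth_on UNIV rad"
  unfolding rad_def[abs_def] inner_vec_def
  by (intro smooth_add smooth_const smooth_sum) (simp add: smooth_mult smooth_coord)

lemma rad_has_derivative: "(rad has_derivative (\<lambda>v. 2 * (x \<bullet> v))) (at x)"
  unfolding rad_def[abs_def] by (auto intro!: derivative_eq_intros simp: inner_commute)

lemma smooth_beta: "smooth_on UNIV (beta :: real^'n::finite \<Rightarrow> real)"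
proof -
  have "smooth_on UNIV (\<lambda>x :: real^'n. rad x powr (1/2))"
    by (rule smooth_chain[OF smooth1_powr _ smooth_rad]) (simp add: rad_pos)
  then have "smooth_on UNIV (\<lambda>x :: real^'n. sqrt (rad x))"
    by (simp add: powr_half_sqrt[OF less_imp_le[OF rad_pos]])
  moreover have "smooth_on UNIV (\<lambda>x :: real^'n. ln (rad x))"
    by (rule smooth_chain[OF smooth1_ln _ smooth_rad]) (simp add: rad_pos)
  ultimately show ?thesis
    unfolding beta_def[abs_def]
    by (intro smooth_divide smooth_mult smooth_const) (simp_all add: rad_pos ln_rad_pos)
qed

lemma beta_pos: "beta x > 0"
  by (simp add: beta_def rad_pos ln_rad_pos)

lemma beta_le_1: "beta x \<le> 1"
proof -
  have "1 * 1 \<le> sqrt (rad x) * ln (rad x)"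
    using rad_ge_3[of x] ln_rad_ge_1[of x] by (intro mult_mono) auto
  then show ?thesis by (simp add: beta_def divide_le_eq)
qed

text \<open>From ln s at most 2 sqrt s. This crude polynomial bound serves twice: for the gradients
  of the coordinates divided by \<open>rad\<close>, and to dominate exponentially decaying weights
  by powers of the conformal factor.\<close>

lemma beta_ge: "1 / rad x \<le> 2 * beta x"
proof -
  have "ln (sqrt (rad x)) \<le> sqrt (rad x)"
    using ln_le_minus_one[of "sqrt (rad x)"] rad_pos[of x] by simp
  then have "ln (rad x) \<le> 2 * sqrt (rad x)"
    using rad_pos[of x] by (simp add: ln_sqrt)
  then have "sqrt (rad x) * ln (rad x) \<le> sqrt (rad x) * (2 * sqrt (rad x))"
    using rad_pos[of x] by (intro mult_left_mono) auto
  also have "\<dots> = 2 * rad x" using rad_pos[of x] by simp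
  finally show ?thesis using rad_pos[of x] ln_rad_pos[of x] by (simp add: beta_def field_simps)
qed

lemma osc_bounds: "1 \<le> osc t" "osc t \<le> 3" "osc t > 0"
  using sin_ge_minus_one[of "exp t"] sin_le_one[of "exp t"] unfolding osc_def by linarith+

lemma osc_DERIV: "(osc has_real_derivative exp t * cos (exp t)) (at t)"
  unfolding osc_def[abs_def] by (auto intro!: derivative_eq_intros)

lemma smooth_osc: "smooth_on UNIV (\<lambda>x. osc (x $ a))"
  unfolding osc_def
  by (intro smooth_add smooth_const smooth_chain[OF smooth1_sin] smooth_chain[OF smooth1_exp] smooth_coord) auto

lemma beta_le_osc_factor: "beta x \<le> osc_factor a x"
  using mult_left_mono[OF osc_bounds(1)[of "x $ a"], of "beta x"] beta_pos[of x] by (simp add: osc_factor_def)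

lemma osc_factor_le_3: "osc_factor a x \<le> 3"
  using mult_mono[OF beta_le_1[of x] osc_bounds(2)[of "x $ a"]] osc_bounds(1)[of "x $ a"] by (simp add: osc_factor_def)

interpretation osc: conformal "osc_factor a" for a :: "'n::finite"
proof
  show "smooth_on UNIV (osc_factor a)"
    unfolding osc_factor_def[abs_def] by (intro smooth_mult smooth_beta smooth_osc)
  show "osc_factor a x > 0" for x
    by (simp add: osc_factor_def beta_pos osc_bounds)
qed

section \<open>Logarithmic derivatives of the conformal factor\<close>

definition kappa :: "'n::finite \<Rightarrow> real^'n \<Rightarrow> real" where
  "kappa i x = pd i beta x / beta x"

lemma smooth_kappa: "smooth_on UNIV (kappa i)"
  unfolding kappa_def[abs_def] by (intro smooth_divide smooth_pd smooth_beta beta_pos)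

text \<open>The logarithmic derivative of 1 / (sqrt s ln s) in s is - (1 / (2 s) + 1 / (s ln s)),
  and the inner derivative \<open>2 * (x $ i)\<close> is at most 2 s in absolute value. Boundedness
  is all that the Hessian estimate asks of \<open>beta\<close>.\<close>

lemma kappa_bound: "\<bar>kappa i x\<bar> \<le> 3"
proof -
  let ?s = "rad x"
  have s: "?s > 0" "ln ?s \<ge> 1" "?s > 1" "ln ?s > 0"
    using rad_ge_3[of x] ln_rad_ge_1[of x] by auto
  have "((\<lambda>t. 1 / (sqrt t * ln t)) has_real_derivative
      - (1 / (2 * ?s) + 1 / (?s * ln ?s)) * beta x) (at ?s)"
  proof -
    have "((\<lambda>t. sqrt t * ln t) has_real_derivative (sqrt ?s * (1 / ?s) + inverse (sqrt ?s) / 2 * ln ?s)) (at ?s)"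
      using s by (intro DERIV_mult' DERIV_real_sqrt DERIV_ln_divide) auto
    then have "((\<lambda>t. 1 / (sqrt t * ln t)) has_real_derivative
      - (sqrt ?s * (1 / ?s) + inverse (sqrt ?s) / 2 * ln ?s) / (sqrt ?s * ln ?s)\<^sup>2) (at ?s)"
      using s by (auto intro!: derivative_eq_intros simp: power2_eq_square)
    moreover have "- (sqrt ?s * (1 / ?s) + inverse (sqrt ?s) / 2 * ln ?s) / (sqrt ?s * ln ?s)\<^sup>2
        = - (1 / (2 * ?s) + 1 / (?s * ln ?s)) * beta x"
    proof -
      define r where "r = sqrt ?s"
      have r: "?s = r * r" "r > 0" using s by (auto simp: r_def)
      define l where "l = ln ?s"
      have l: "l > 0" using s by (simp add: l_def)
      show ?thesis unfolding beta_def r_def[symmetric] l_def[symmetric] unfolding r(1)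
        using r(2) l by (simp add: field_simps power2_eq_square)
    qed
    ultimately show ?thesis by simp
  qed
  then have "pd i (\<lambda>x. 1 / (sqrt (rad x) * ln (rad x))) x = - (1 / (2 * ?s) + 1 / (?s * ln ?s)) * beta x * pd i rad x"
    by (rule pd_chain[OF smooth_differentiable[OF smooth_rad]])
  moreover have "pd i rad x = 2 * (x $ i)"
    using pd_has_derivative[OF rad_has_derivative[of x], of i] by (simp add: inner_axis)
  ultimately have "pd i beta x = - (1 / (2 * ?s) + 1 / (?s * ln ?s)) * beta x * (2 * (x $ i))"
    unfolding beta_def[abs_def, symmetric] by simp
  then have "kappa i x = - (1 / (2 * ?s) + 1 / (?s * ln ?s)) * (2 * (x $ i))"
    using beta_pos[of x] by (simp add: kappa_def)
  moreover have "1 / (2 * ?s) + 1 / (?s * ln ?s) > 0" using s by (simp add: add_pos_pos)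
  ultimately have "\<bar>kappa i x\<bar> = (1 / (2 * ?s) + 1 / (?s * ln ?s)) * (2 * \<bar>x $ i\<bar>)"
    by (simp only: abs_mult abs_minus_cancel abs_of_pos abs_numeral)
  also have "\<dots> \<le> (1 / (2 * ?s) + 1 / ?s) * (2 * ?s)"
    using s abs_coord_le_rad[of x i]
    by (intro mult_mono add_left_mono divide_left_mono) (auto simp: mult_le_cancel_left1)
  also have "\<dots> = 3" using s by (simp add: field_simps)
  finally show ?thesis .
qed

lemma dlog_osc: "osc.dlog a i x = kappa i x + (if i = a then exp (x $ a) * cos (exp (x $ a)) / osc (x $ a) else 0)"
proof -
  have "pd i (\<lambda>x. osc (x $ a)) x = (exp (x $ a) * cos (exp (x $ a))) * pd i (\<lambda>x. x $ a) x"
    by (rule pd_chain[OF smooth_differentiable[OF smooth_coord] osc_DERIV])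
  moreover have "pd i (osc_factor a) x = beta x * pd i (\<lambda>x. osc (x $ a)) x + pd i beta x * osc (x $ a)"
    unfolding osc_factor_def[abs_def]
    by (intro pd_mult smooth_differentiable smooth_beta smooth_osc)
  ultimately show ?thesis
    using beta_pos[of x] osc_bounds(3)[of "x $ a"]
    by (simp add: osc.dlog_def kappa_def osc_factor_def pd_coord field_simps)
qed

subsubsection \<open>Completeness\<close>

lemma osc_complete: "complete_riemannian_manifold euclidean std_atlas (conf_metric (osc_factor a))"
proof -
  \<comment> \<open>Its gradient is at most 2 sqrt s / (s ln s) = 2 \<open>beta x\<close> for s =
    \<open>rad x\<close>; its properness reflects the infinite radial length.\<close>
  define \<rho> :: "real^'a \<Rightarrow> real" where "\<rho> x = ln (ln (rad x))" for x
  \<comment> \<open>Plain coordinates have gradient of norm 1, too large where the factor is small.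
    After division by \<open>rad\<close> it is at most 3 / \<open>rad x\<close>, hence at most 6
    \<open>beta x\<close>, the origin of the constant 6. From \<open>\<rho>\<close> one recovers
    \<open>rad\<close>, and then the coordinates.\<close>
  define F where "F j x = (case j of None \<Rightarrow> \<rho> x | Some i \<Rightarrow> x $ i / rad x)" for j and x :: "real^'a"
  have s\<rho>: "smooth_on UNIV \<rho>"
    unfolding \<rho>_def by (intro smooth_chain[OF smooth1_ln] smooth_rad) (simp_all add: rad_pos ln_rad_pos)
  have d\<rho>: "\<bar>frechet_derivative \<rho> (at x) v\<bar> \<le> 6 * osc_factor a x * norm v" for x v
  proof -
    let ?s = "rad x"
    have "((\<lambda>t. ln (ln t)) has_derivative (\<lambda>h. (1 / ?s) / ln ?s * h)) (at ?s)"
      unfolding has_field_derivative_def[symmetric] using rad_pos[of x] ln_rad_pos[of x]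
      by (auto intro!: derivative_eq_intros)
    from has_derivative_compose[OF rad_has_derivative this]
    have "frechet_derivative \<rho> (at x) = (\<lambda>v. (1 / ?s) / ln ?s * (2 * (x \<bullet> v)))"
      unfolding \<rho>_def by (rule frechet_derivative_at[symmetric])
    then have "\<bar>frechet_derivative \<rho> (at x) v\<bar> = (1 / ?s) / ln ?s * (2 * \<bar>x \<bullet> v\<bar>)"
      using rad_pos[of x] ln_rad_pos[of x] by (simp add: abs_mult)
    also have "\<dots> \<le> (1 / ?s) / ln ?s * (2 * (sqrt ?s * norm v))"
    proof (intro mult_left_mono)
      have "\<bar>x \<bullet> v\<bar> \<le> norm x * norm v" by (rule Cauchy_Schwarz_ineq2)
      also have "\<dots> \<le> sqrt ?s * norm v" by (intro mult_right_mono norm_le_sqrt_rad) simp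
      finally show "\<bar>x \<bullet> v\<bar> \<le> sqrt ?s * norm v" .
    qed (use rad_pos[of x] ln_rad_pos[of x] in auto)
    also have "\<dots> = 2 * beta x * norm v"
      using rad_pos[of x] ln_rad_pos[of x] real_div_sqrt[of ?s] by (simp add: beta_def field_simps)
    also have "\<dots> \<le> 6 * osc_factor a x * norm v"
      using beta_le_osc_factor[of x a] beta_pos[of x] by (intro mult_right_mono) auto
    finally show ?thesis .
  qed
  interpret conformal_complete "osc_factor a" 3 6 \<rho> F
  proof
    show "osc_factor a x \<le> 3" for x by (rule osc_factor_le_3)
    show "(0::real) < 6" by simp
    show "smooth_on UNIV \<rho>" by (rule s\<rho>)
    show "\<bar>frechet_derivative \<rho> (at x) v\<bar> \<le> 6 * osc_factor a x * norm v" for x v by (rule d\<rho>)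
    show "bounded {x. \<rho> x \<le> c}" for c
    proof -
      have "norm x \<le> sqrt (exp (exp c))" if "\<rho> x \<le> c" for x
      proof -
        have "ln (rad x) \<le> exp c" using that ln_rad_pos[of x] unfolding \<rho>_def by (subst (asm) exp_le_cancel_iff[symmetric]) simp
        then have "rad x \<le> exp (exp c)" using rad_pos[of x] by (subst (asm) exp_le_cancel_iff[symmetric]) simp
        then show ?thesis using norm_le_sqrt_rad[of x] real_sqrt_le_mono order_trans by blast
      qed
      then show ?thesis unfolding bounded_iff by blast
    qed
    show "smooth_on UNIV (F j)" for j
      unfolding F_def by (cases j) (auto intro!: s\<rho> smooth_divide smooth_coord smooth_rad rad_pos)
    show "\<bar>frechet_derivative (F j) (at x) v\<bar> \<le> 6 * osc_factor a x * norm v" for j x v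
    proof (cases j)
      case None
      then have "F j = \<rho>" by (simp add: F_def fun_eq_iff)
      then show ?thesis using d\<rho> by simp
    next
      case (Some i)
      let ?s = "rad x"
      have F: "F j = (\<lambda>x. x $ i / rad x)" using Some by (simp add: F_def fun_eq_iff)
      have "((\<lambda>x. x $ i) has_derivative (\<lambda>v. v $ i)) (at x)"
        by (rule bounded_linear_imp_has_derivative[OF bounded_linear_vec_nth])
      from has_derivative_divide'[OF this rad_has_derivative]
      have "frechet_derivative (F j) (at x) = (\<lambda>v. (v $ i * ?s - x $ i * (2 * (x \<bullet> v))) / (?s * ?s))"
        unfolding F using rad_pos[of x] by (intro frechet_derivative_at[symmetric]) auto
      then have "\<bar>frechet_derivative (F j) (at x) v\<bar> = \<bar>v $ i * ?s - x $ i * (2 * (x \<bullet> v))\<bar> / (?s * ?s)"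
        by (simp add: abs_mult)
      also have "\<dots> \<le> (3 * ?s * norm v) / (?s * ?s)"
      proof (rule divide_right_mono)
        have "\<bar>v $ i * ?s\<bar> \<le> norm v * ?s"
          using component_le_norm_cart[of v i] rad_pos[of x] by (simp add: abs_mult)
        moreover have "\<bar>x $ i * (2 * (x \<bullet> v))\<bar> \<le> norm x * (2 * (norm x * norm v))"
          unfolding abs_mult using component_le_norm_cart[of x i] Cauchy_Schwarz_ineq2[of x v]
          by (intro mult_mono) auto
        moreover have "norm x * (2 * (norm x * norm v)) \<le> 2 * ?s * norm v"
          using mult_right_mono[OF norm_power2_le_rad[of x], of "2 * norm v"]
          by (simp add: power2_eq_square mult_ac)
        ultimately show "\<bar>v $ i * ?s - x $ i * (2 * (x \<bullet> v))\<bar> \<le> 3 * ?s * norm v"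
          by (simp add: algebra_simps abs_if split: if_splits)
      qed simp
      also have "\<dots> = 3 * (1 / ?s) * norm v" using rad_pos[of x] by simp
      also have "\<dots> \<le> 3 * (2 * osc_factor a x) * norm v"
        using beta_ge[of x] beta_le_osc_factor[of x a] by (intro mult_right_mono mult_left_mono) auto
      finally show ?thesis by simp
    qed
    show "x = y" if F: "\<And>j. F j x = F j y" for x y
    proof -
      have "ln (ln (rad x)) = ln (ln (rad y))" using F[of None] by (simp add: F_def \<rho>_def)
      then have "rad x = rad y"
        using ln_rad_pos[of x] ln_rad_pos[of y] rad_pos[of x] rad_pos[of y] by simp
      then have "x $ i = y $ i" for i using F[of "Some i"] rad_pos[of y] by (simp add: F_def)
      then show ?thesis by (simp add: vec_eq_iff)
    qed
  qed
  show ?thesis by (rule complete_conf)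
qed

subsubsection \<open>Finite volume\<close>

text \<open>Dyadic annuli: where the norm lies between 2^k and 2^(k+1), \<open>beta\<close> is at
  most 2 / (2^k (k + 1)), and the volume of the ball is of order 2^(k n), so the contributions are
  of order (k + 1)^(-n).\<close>

lemma osc_finite_volume:
  assumes "CARD('n::finite) \<ge> 2"
  shows "emeasure (osc.vol (a :: 'n)) UNIV < \<infinity>"
proof -
  let ?n = "CARD('n)"
  define c where "c k = (2 / (2 ^ k * (real k + 1))) ^ ?n" for k
  have c: "c k \<ge> 0" for k by (simp add: c_def)
  have bound: "ennreal (beta x ^ ?n) \<le> indicator (cball 0 1) x +
      (\<Sum>k. ennreal (c k) * indicator (cball 0 (2 ^ Suc k)) x)" for x :: "real^'n"
  proof (cases "norm x \<le> 1")
    case True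
    have "ennreal (beta x ^ ?n) \<le> 1"
      using power_le_one[OF less_imp_le[OF beta_pos] beta_le_1, of x ?n] by simp
    then show ?thesis using True by (simp add: add_increasing2)
  next
    case False
    define k where "k = (LEAST k. norm x < 2 ^ Suc k)"
    have "\<exists>k. norm x < 2 ^ Suc k"
    proof -
      obtain i where "norm x < 2 ^ i" using real_arch_pow[of 2 "norm x"] by auto
      also have "(2::real) ^ i \<le> 2 ^ Suc i" by simp
      finally show ?thesis by blast
    qed
    then have k1: "norm x < 2 ^ Suc k" unfolding k_def by (rule LeastI_ex)
    have k2: "2 ^ k \<le> norm x"
    proof (cases k)
      case (Suc i)
      then have "\<not> norm x < 2 ^ Suc i" using not_less_Least[of i "\<lambda>k. norm x < 2 ^ Suc k"] by (simp add: k_def)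
      with Suc show ?thesis by simp
    qed (use False in simp)
    have s: "(2 ^ k)\<^sup>2 \<le> rad x"
      by (rule order_trans[OF power_mono[OF k2] norm_power2_le_rad]) simp
    \<comment> \<open>The average of two bounds: \<open>ln (rad x)\<close> is at least 1, and at
      least k because \<open>rad x\<close> is at least 4^k and 2 ln 2 is at least 1.\<close>
    have l: "ln (rad x) \<ge> (real k + 1) / 2"
    proof -
      have ln_2_ge: "ln 2 \<ge> (1/2 :: real)"
        using ln_le_minus_one[of "1/2 :: real"] by (simp add: ln_div)
      have "real k * 1 \<le> real k * (2 * ln 2)"
        using ln_2_ge by (intro mult_left_mono) auto
      also have "\<dots> = ln ((2 ^ k)\<^sup>2)" by (simp add: ln_realpow)
      also have "\<dots> \<le> ln (rad x)" using s by (intro ln_mono) auto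
      finally show ?thesis using ln_rad_ge_1[of x] by simp
    qed
    have "2 ^ k * ((real k + 1) / 2) \<le> sqrt (rad x) * ln (rad x)"
      using l real_le_rsqrt[OF s] rad_pos[of x] by (intro mult_mono) auto
    then have "beta x \<le> 1 / (2 ^ k * ((real k + 1) / 2))"
      unfolding beta_def by (intro divide_left_mono) (auto intro!: mult_pos_pos simp: rad_pos ln_rad_pos)
    then have "beta x ^ ?n \<le> c k"
      unfolding c_def using beta_pos[of x] by (intro power_mono) (auto simp: less_imp_le)
    then have "ennreal (beta x ^ ?n) \<le> ennreal (c k) * indicator (cball 0 (2 ^ Suc k)) x"
      using k1 by (simp add: ennreal_leI less_imp_le)
    also have "\<dots> \<le> (\<Sum>k. ennreal (c k) * indicator (cball 0 (2 ^ Suc k)) x)"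
    proof -
      define f where "f k = ennreal (c k) * indicator (cball 0 (2 ^ Suc k)) x" for k
      show ?thesis unfolding f_def[symmetric] using sum_le_suminf[of f "{k}"] by simp
    qed
    finally show ?thesis by (simp add: add_increasing)
  qed
  define V where "V = unit_ball_vol (real ?n)"
  have V: "V \<ge> 0" by (simp add: V_def)
  have ball: "emeasure lborel (cball (0::real^'n) r) = ennreal (V * r ^ ?n)" if "r \<ge> 0" for r
    using emeasure_cball[OF that, of "0::real^'n"] by (simp add: V_def)
  have le: "c k * (V * (2 ^ Suc k) ^ ?n) \<le> V * 4 ^ ?n * inverse ((real (Suc k))\<^sup>2)" for k
  proof -
    have "c k * (2 ^ Suc k) ^ ?n = (2 / (2 ^ k * (real k + 1)) * 2 ^ Suc k) ^ ?n"
      unfolding c_def by (rule power_mult_distrib[symmetric])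
    also have "2 / (2 ^ k * (real k + 1)) * 2 ^ Suc k = 4 * inverse (real (Suc k))"
      using add_pos_nonneg[of "2 ^ k :: real" "real k * 2 ^ k"] by (simp add: field_simps)
    also have "(4 * inverse (real (Suc k))) ^ ?n = 4 ^ ?n * inverse (real (Suc k)) ^ ?n"
      by (rule power_mult_distrib)
    \<comment> \<open>Here dimension at least 2 enters: it gives comparison with the convergent
      series of inverse squares.\<close>
    also have "\<dots> \<le> 4 ^ ?n * inverse (real (Suc k)) ^ 2"
      using assms by (intro mult_left_mono power_decreasing) (auto simp: field_simps)
    finally have "c k * (2 ^ Suc k) ^ ?n \<le> 4 ^ ?n * inverse ((real (Suc k))\<^sup>2)" by (simp add: power_inverse)
    from mult_left_mono[OF this V] show ?thesis by (simp add: mult_ac)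
  qed
  have "summable (\<lambda>k. V * 4 ^ ?n * inverse ((real (Suc k))\<^sup>2))"
    using inverse_power_summable[of 2, where 'a=real] by (intro summable_mult) (subst summable_Suc_iff, simp)
  then have sm: "summable (\<lambda>k. c k * (V * (2 ^ Suc k) ^ ?n))"
  proof (rule summable_comparison_test')
    fix k :: nat
    have "0 \<le> c k * (V * (2 ^ Suc k) ^ ?n)" by (intro mult_nonneg_nonneg c V) simp
    then show "norm (c k * (V * (2 ^ Suc k) ^ ?n)) \<le> V * 4 ^ ?n * inverse ((real (Suc k))\<^sup>2)"
      using le[of k] by (simp only: real_norm_def abs_of_nonneg)
  qed
  have "(\<integral>\<^sup>+(x::real^'n). ennreal (beta x ^ ?n) \<partial>lborel) \<le> (\<integral>\<^sup>+(x::real^'n). indicator (cball 0 1) x +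
      (\<Sum>k. ennreal (c k) * indicator (cball 0 (2 ^ Suc k)) x) \<partial>lborel)"
    by (intro nn_integral_mono bound)
  also have "\<dots> = emeasure lborel (cball (0::real^'n) 1) + (\<Sum>k. ennreal (c k) * emeasure lborel (cball (0::real^'n) (2 ^ Suc k)))"
  proof -
    define B where "B k = cball (0::real^'n) (2 ^ Suc k)" for k
    have [measurable]: "B k \<in> sets borel" "cball (0::real^'n) 1 \<in> sets borel" for k
      by (simp_all add: B_def)
    have [measurable]: "(\<lambda>x. \<Sum>k. ennreal (c k) * indicator (B k) x) \<in> borel_measurable lborel"
      by (intro borel_measurable_suminf_order) measurable
    have "(\<integral>\<^sup>+x. indicator (cball 0 1) x + (\<Sum>k. ennreal (c k) * indicator (B k) x) \<partial>lborel)
        = (\<integral>\<^sup>+x. indicator (cball (0::real^'n) 1) x \<partial>lborel) + (\<integral>\<^sup>+x. (\<Sum>k. ennreal (c k) * indicator (B k) x) \<partial>lborel)"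
      by (rule nn_integral_add) simp_all
    also have "(\<integral>\<^sup>+x. (\<Sum>k. ennreal (c k) * indicator (B k) x) \<partial>lborel)
        = (\<Sum>k. \<integral>\<^sup>+x. ennreal (c k) * indicator (B k) x \<partial>lborel)"
      by (rule nn_integral_suminf) measurable
    finally show ?thesis by (simp add: B_def nn_integral_cmult_indicator)
  qed
  also have "\<dots> = ennreal V + (\<Sum>k. ennreal (c k * (V * (2 ^ Suc k) ^ ?n)))"
    using c V by (simp add: ball ennreal_mult)
  also have "(\<Sum>k. ennreal (c k * (V * (2 ^ Suc k) ^ ?n))) = ennreal (\<Sum>k. c k * (V * (2 ^ Suc k) ^ ?n))"
    using c V sm by (intro suminf_ennreal2) auto
  finally have fin: "(\<integral>\<^sup>+(x::real^'n). ennreal (beta x ^ ?n) \<partial>lborel) < \<infinity>"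
    by (rule le_less_trans) simp
  have "emeasure (osc.vol a) UNIV = (\<integral>\<^sup>+x. ennreal (osc_factor a x ^ ?n) \<partial>lborel)"
    unfolding osc.vol_def by (subst emeasure_density) auto
  also have "\<dots> \<le> (\<integral>\<^sup>+(x::real^'n). ennreal (3 ^ ?n) * ennreal (beta x ^ ?n) \<partial>lborel)"
  proof (intro nn_integral_mono)
    fix x :: "real^'n"
    have "osc_factor a x ^ ?n \<le> (beta x * 3) ^ ?n"
      unfolding osc_factor_def using beta_pos[of x] osc_bounds[of "x $ a"]
      by (intro power_mono mult_left_mono) auto
    then show "ennreal (osc_factor a x ^ ?n) \<le> ennreal (3 ^ ?n) * ennreal (beta x ^ ?n)"
      using beta_pos[of x] by (subst ennreal_mult[symmetric]) (auto intro!: ennreal_leI simp: power_mult_distrib mult_ac)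
  qed
  also have "\<dots> = ennreal (3 ^ ?n) * (\<integral>\<^sup>+(x::real^'n). ennreal (beta x ^ ?n) \<partial>lborel)"
  proof (rule nn_integral_cmult)
    have [measurable]: "(beta :: real^'n \<Rightarrow> real) \<in> borel_measurable borel"
      by (rule osc.borel_measurable_smooth[OF smooth_beta])
    show "(\<lambda>x::real^'n. ennreal (beta x ^ ?n)) \<in> borel_measurable lborel" by measurable
  qed
  also have "\<dots> < \<infinity>" using fin by (simp add: ennreal_mult_less_top)
  finally show ?thesis .
qed

subsection \<open>Weights supported in the strip\<close>

text \<open>The strip surrounds the positive \<open>a\<close>-axis; in it the weights below decay like \<open>exp (- x $ a)\<close>,
  faster than any power of the conformal factor.\<close>

definition lat2 :: "'n::finite \<Rightarrow> real^'n \<Rightarrow> real" where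
  "lat2 a x = (\<Sum>i\<in>-{a}. (x $ i)\<^sup>2)"

definition decay :: "'n::finite \<Rightarrow> real^'n \<Rightarrow> real" where
  "decay a x = (if 0 \<le> x $ a \<and> lat2 a x \<le> 1 then exp (- (x $ a)) else 0)"

definition strip_box :: "'n::finite \<Rightarrow> real \<Rightarrow> (real^'n) set" where
  "strip_box a R = {x. 0 \<le> x $ a \<and> x $ a \<le> R \<and> lat2 a x \<le> 1}"

lemma lat2_nonneg: "lat2 a x \<ge> 0"
  by (simp add: lat2_def sum_nonneg)

lemma rad_lat2: "rad x = 3 + (x $ a)\<^sup>2 + lat2 a x"
proof -
  have "x \<bullet> x = (\<Sum>i\<in>UNIV. (x $ i)\<^sup>2)" by (simp add: inner_vec_def power2_eq_square)
  also have "\<dots> = (x $ a)\<^sup>2 + lat2 a x"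
    using sum.remove[of UNIV a "\<lambda>i. (x $ i)\<^sup>2"] by (simp add: lat2_def Compl_eq_Diff_UNIV)
  finally show ?thesis by (simp add: rad_def)
qed

lemma smooth_lat2: "smooth_on UNIV (lat2 a)"
  unfolding lat2_def[abs_def] by (intro smooth_sum smooth_power smooth_coord)

lemma pd_lat2: "pd i (lat2 a) x = (if i = a then 0 else 2 * (x $ i))"
proof -
  have "((\<lambda>x. (x $ j)\<^sup>2) has_derivative (\<lambda>v. 2 * (x $ j) * (v $ j))) (at x)" for j
  proof -
    have "((\<lambda>x. x $ j) has_derivative (\<lambda>v. v $ j)) (at x)"
      by (rule bounded_linear_imp_has_derivative[OF bounded_linear_vec_nth])
    from has_derivative_power[OF this, of 2] show ?thesis by (simp add: mult_ac)
  qed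
  then have "(lat2 a has_derivative (\<lambda>v. \<Sum>j\<in>-{a}. 2 * (x $ j) * (v $ j))) (at x)"
    unfolding lat2_def[abs_def] by (intro has_derivative_sum)
  from pd_has_derivative[OF this, of i]
  have "pd i (lat2 a) x = (\<Sum>j\<in>-{a}. if i = j then 2 * (x $ j) else 0)"
    by (simp add: axis_def if_distrib cong: if_cong)
  then show ?thesis by (simp add: sum.delta')
qed

lemma decay_nonneg: "decay a x \<ge> 0"
  by (simp add: decay_def)

lemma compact_strip_box: "compact (strip_box a R)"
proof -
  have "norm x \<le> sqrt (R\<^sup>2 + 4)" if "x \<in> strip_box a R" for x
  proof -
    have "(x $ a)\<^sup>2 \<le> R\<^sup>2" using that by (intro power_mono) (auto simp: strip_box_def)
    moreover have "lat2 a x \<le> 1" using that by (simp add: strip_box_def)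
    ultimately have "rad x \<le> R\<^sup>2 + 4" unfolding rad_lat2[of x a] by linarith
    then show ?thesis using norm_le_sqrt_rad[of x] real_sqrt_le_mono order_trans by blast
  qed
  then have "bounded (strip_box a R)" unfolding bounded_iff by blast
  moreover have "closed (strip_box a R)"
  proof -
    have "closed {x :: real^'a. 0 \<le> x $ a}"
      by (intro closed_Collect_le continuous_on_const smooth_continuous smooth_coord)
    moreover have "closed {x :: real^'a. x $ a \<le> R}"
      by (intro closed_Collect_le continuous_on_const smooth_continuous smooth_coord)
    moreover have "closed {x. lat2 a x \<le> 1}"
      by (intro closed_Collect_le continuous_on_const smooth_continuous smooth_lat2)
    ultimately have "closed ({x :: real^'a. 0 \<le> x $ a} \<inter> {x. x $ a \<le> R} \<inter> {x. lat2 a x \<le> 1})" by blast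
    also have "{x :: real^'a. 0 \<le> x $ a} \<inter> {x. x $ a \<le> R} \<inter> {x. lat2 a x \<le> 1} = strip_box a R"
      by (auto simp: strip_box_def)
    finally show ?thesis .
  qed
  ultimately show ?thesis by (simp add: compact_eq_bounded_closed)
qed

text \<open>On the strip \<open>rad\<close> is at most quadratic in \<open>x $ a\<close>, so the
  factor is at least a multiple of (1 + \<open>x $ a\<close>)^(-2), whose n-th power dominates the
  exponential up to a constant. This makes \<open>decay\<close> an admissible weight in the
  hypothesis \<open>main\<close> of \<open>not_test_functions_dense\<close>.\<close>

lemma decay_le_osc_factor:
  fixes a :: "'n::finite"
  assumes "j \<le> 2"
  shows "osc_factor a x ^ j * decay a x \<le> 9 * 8 ^ CARD('n) * (2 * real CARD('n)) ^ (2 * CARD('n)) * osc_factor a x ^ CARD('n)"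
proof (cases "0 \<le> x $ a \<and> lat2 a x \<le> 1")
  case False
  then show ?thesis using osc.lam_pos[of a x] by (auto simp: decay_def less_imp_le)
next
  case True
  let ?n = "CARD('n)" and ?t = "x $ a"
  have n: "real ?n \<ge> 1" by (simp add: Suc_leI)
  have pos: "osc_factor a x > 0" by (rule osc.lam_pos)
  have "rad x \<le> 4 + ?t\<^sup>2" using True by (simp add: rad_lat2[of x a])
  also have "\<dots> \<le> 4 * (1 + ?t)\<^sup>2" using True by (simp add: power2_eq_square algebra_simps)
  finally have r: "2 * rad x \<le> 8 * (1 + ?t)\<^sup>2" by simp
  \<comment> \<open>The rate 1 / (2 n) is chosen so that the (2 n)-th power of the exponential is
    exactly \<open>exp ?t\<close>.\<close>
  have "2 * real ?n * (1 + ?t / (2 * real ?n)) = 2 * real ?n + ?t"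
    by (simp add: distrib_left)
  then have "1 + ?t \<le> 2 * real ?n * (1 + ?t / (2 * real ?n))"
    using n by linarith
  also have "\<dots> \<le> 2 * real ?n * exp (?t / (2 * real ?n))"
    using exp_ge_add_one_self[of "?t / (2 * real ?n)"] by (intro mult_left_mono) auto
  finally have "(1 + ?t) ^ (2 * ?n) \<le> (2 * real ?n * exp (?t / (2 * real ?n))) ^ (2 * ?n)"
    using True by (intro power_mono) auto
  also have "\<dots> = (2 * real ?n) ^ (2 * ?n) * exp (real (2 * ?n) * (?t / (2 * real ?n)))"
    unfolding power_mult_distrib exp_of_nat_mult[symmetric] ..
  also have "real (2 * ?n) * (?t / (2 * real ?n)) = ?t" using n by simp
  finally have e: "(1 + ?t) ^ (2 * ?n) \<le> (2 * real ?n) ^ (2 * ?n) * exp ?t" .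
  have "1 \<le> 2 * rad x * osc_factor a x"
  proof -
    have "1 / rad x \<le> 2 * osc_factor a x" using beta_ge[of x] beta_le_osc_factor[of x a] by linarith
    then show ?thesis using rad_pos[of x] by (simp add: field_simps)
  qed
  also have "\<dots> \<le> 8 * (1 + ?t)\<^sup>2 * osc_factor a x"
    using r pos by (intro mult_right_mono) auto
  finally have "1 ^ ?n \<le> (8 * (1 + ?t)\<^sup>2 * osc_factor a x) ^ ?n" by (intro power_mono) auto
  also have "\<dots> = 8 ^ ?n * osc_factor a x ^ ?n * (1 + ?t) ^ (2 * ?n)"
    unfolding power_mult_distrib power_mult[symmetric] by simp
  also have "\<dots> \<le> 8 ^ ?n * osc_factor a x ^ ?n * ((2 * real ?n) ^ (2 * ?n) * exp ?t)"
    using pos e by (intro mult_left_mono) auto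
  finally have "1 \<le> (8 ^ ?n * (2 * real ?n) ^ (2 * ?n) * osc_factor a x ^ ?n) * exp ?t"
    by (simp add: mult_ac)
  then have d: "decay a x \<le> 8 ^ ?n * (2 * real ?n) ^ (2 * ?n) * osc_factor a x ^ ?n"
    unfolding decay_def if_P[OF True] exp_minus inverse_eq_divide by (subst pos_divide_le_eq) simp_all
  have "osc_factor a x ^ j \<le> 3 ^ j" using pos osc_factor_le_3[of a x] by (intro power_mono) auto
  also have "\<dots> \<le> (3::real) ^ 2" using assms by (intro power_increasing) auto
  finally have "osc_factor a x ^ j \<le> 9" by simp
  then have "osc_factor a x ^ j * decay a x \<le> 9 * (8 ^ ?n * (2 * real ?n) ^ (2 * ?n) * osc_factor a x ^ ?n)"
    using d decay_nonneg[of a x] by (intro mult_mono) auto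
  then show ?thesis by (simp add: mult_ac)
qed

subsection \<open>The profile functions\<close>

text \<open>Multiplied by the derivative of \<open>osc\<close> this becomes 4 cos^2 (exp t), which
  is nonnegative; the factor \<open>exp (- t)\<close> removes the frequency.\<close>

definition prof :: "real \<Rightarrow> real" where
  "prof t = 4 * cos (exp t) * exp (- t)"

text \<open>With u = exp t, what is missing is \<open>osc t\<close> - 4 cos^2 u = sin u - 2 cos (2
  u), of mean zero in u. Its primitive in u is - (cos u + sin (2 u)); divided by u it is
  exponentially small in t, yet its t-derivative is the missing term minus
  \<open>corr t\<close>.\<close>

definition corr :: "real \<Rightarrow> real" where
  "corr t = - (cos (exp t) + sin (2 * exp t)) * exp (- t)"

definition corr' :: "real \<Rightarrow> real" where
  "corr' t = sin (exp t) - 2 * cos (2 * exp t) - corr t"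

lemma corr_DERIV: "(corr has_real_derivative corr' t) (at t)"
proof -
  have "(corr has_real_derivative - (- sin (exp t) * exp t + cos (2 * exp t) * (2 * exp t)) * exp (- t)
      + (exp (- t) * (- 1)) * - (cos (exp t) + sin (2 * exp t))) (at t)"
    unfolding corr_def[abs_def] by (auto intro!: derivative_eq_intros)
  moreover have "- (- sin (exp t) * exp t + cos (2 * exp t) * (2 * exp t)) * exp (- t)
      + (exp (- t) * (- 1)) * - (cos (exp t) + sin (2 * exp t))
      = sin (exp t) * (exp t * exp (- t)) - 2 * cos (2 * exp t) * (exp t * exp (- t)) - corr t"
    unfolding corr_def by (simp add: algebra_simps)
  moreover have "exp t * exp (- t) = 1" by (simp add: exp_minus)
  then have "sin (exp t) * (exp t * exp (- t)) - 2 * cos (2 * exp t) * (exp t * exp (- t)) - corr t = corr' t"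
    by (simp add: corr'_def)
  ultimately show ?thesis by simp
qed

text \<open>Because \<open>4 cos\<^sup>2 = 2 + 2 cos (2 \<cdot>)\<close>, the test functions built from \<open>prof\<close> and \<open>corr\<close> add up to
  \<open>osc\<close> with an exponentially small error, although \<open>prof\<close> alone cannot see the turning points of
  \<open>osc\<close>.\<close>

lemma prof_corr: "prof t * (exp t * cos (exp t)) + corr' t = osc t - corr t"
proof -
  have "exp t * exp (- t) = 1" by (simp add: exp_minus)
  then have "prof t * (exp t * cos (exp t)) = 4 * (cos (exp t))\<^sup>2"
    unfolding prof_def by (simp add: algebra_simps power2_eq_square)
  also have "\<dots> = 2 + 2 * cos (2 * exp t)" by (simp add: cos_double_cos)
  finally show ?thesis by (simp add: corr'_def osc_def)
qed

lemma prof_le: "\<bar>prof t\<bar> \<le> 4 * exp (- t)" and corr_le: "\<bar>corr t\<bar> \<le> 2 * exp (- t)"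
proof -
  show "\<bar>prof t\<bar> \<le> 4 * exp (- t)"
    unfolding prof_def abs_mult using abs_cos_le_one[of "exp t"] by simp
  have "\<bar>- (cos (exp t) + sin (2 * exp t))\<bar> \<le> 2"
    using abs_cos_le_one[of "exp t"] abs_sin_le_one[of "2 * exp t"] by linarith
  then show "\<bar>corr t\<bar> \<le> 2 * exp (- t)"
    unfolding corr_def abs_mult by simp
qed

lemma smooth_exp_coord: "smooth_on UNIV (\<lambda>x. exp (x $ a))" "smooth_on UNIV (\<lambda>x. exp (- (x $ a)))"
  by (intro smooth_chain[OF smooth1_exp] smooth_coord smooth_minus; simp)+

lemma smooth_prof: "smooth_on UNIV (\<lambda>x. prof (x $ a))"
  unfolding prof_def
  by (intro smooth_mult smooth_const smooth_chain[OF smooth1_cos] smooth_exp_coord) auto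

lemma smooth_corr: "smooth_on UNIV (\<lambda>x. corr (x $ a))"
  unfolding corr_def
  by (intro smooth_mult smooth_const smooth_minus smooth_add smooth_chain[OF smooth1_cos]
      smooth_chain[OF smooth1_sin] smooth_exp_coord) auto

lemma pd_fun_coord:
  assumes "(F has_real_derivative F') (at (x $ a))"
  shows "pd i (\<lambda>x. F (x $ a)) x = (if i = a then F' else 0)"
  using pd_chain[OF smooth_differentiable[OF smooth_coord] assms, of i] by (simp add: pd_coord)

subsection \<open>The lateral cutoff\<close>

definition lat_cut :: "'n::finite \<Rightarrow> real^'n \<Rightarrow> real" where
  "lat_cut a x = bump (1 - lat2 a x)"

lemma smooth_lat_cut: "smooth_on UNIV (lat_cut a)"
  unfolding lat_cut_def[abs_def]
  by (intro smooth_chain[OF smooth1_bump_deriv] smooth_diff smooth_const smooth_lat2) auto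

lemma lat_cut_bounds: "0 \<le> lat_cut a x" "lat_cut a x \<le> 1"
  by (simp_all add: lat_cut_def bump_nonneg bump_le_1)

lemma lat_cut_zero: "lat2 a x > 1 \<Longrightarrow> lat_cut a x = 0"
  by (simp add: lat_cut_def bump_deriv_nonpos)

lemma pd_bump_lat2:
  "pd i (\<lambda>x. bump_deriv k (1 - lat2 a x)) x
    = (if i = a then 0 else - 2 * (x $ i) * bump_deriv (Suc k) (1 - lat2 a x))"
proof -
  have s: "smooth_on UNIV (\<lambda>x. 1 - lat2 a x)" by (intro smooth_diff smooth_const smooth_lat2)
  have "pd i (\<lambda>x. 1 - lat2 a x) x = - pd i (lat2 a) x"
    using pd_add[OF smooth_differentiable[OF smooth_const[of 1]] smooth_differentiable[OF smooth_minus[OF smooth_lat2]], of i a x]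
      pd_mult[OF smooth_differentiable[OF smooth_const[of "-1"]] smooth_differentiable[OF smooth_lat2], of i a x]
    by (simp add: pd_const)
  then show ?thesis
    using pd_chain[OF smooth_differentiable[OF s, of x] bump_deriv_DERIV[of k], of i] by (simp add: pd_lat2)
qed

lemma pd_lat_cut: "pd i (lat_cut a) x = (if i = a then 0 else - 2 * (x $ i) * bump_deriv 1 (1 - lat2 a x))"
  unfolding lat_cut_def[abs_def] pd_bump_lat2 by simp

lemma pd_pd_lat_cut:
  assumes "i \<noteq> a"
  shows "pd i (pd i (lat_cut a)) x
    = 4 * (x $ i)\<^sup>2 * bump_deriv 2 (1 - lat2 a x) - 2 * bump_deriv 1 (1 - lat2 a x)"
proof -
  have s: "smooth_on UNIV (\<lambda>x. bump_deriv 1 (1 - lat2 a x))"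
    by (intro smooth_chain[OF smooth1_bump_deriv] smooth_diff smooth_const smooth_lat2) auto
  have s': "smooth_on UNIV (\<lambda>x. - 2 * (x $ i))" by (intro smooth_mult smooth_const smooth_coord)
  have "pd i (pd i (lat_cut a)) x = pd i (\<lambda>x. - 2 * (x $ i) * bump_deriv 1 (1 - lat2 a x)) x"
    using assms by (simp add: pd_lat_cut[abs_def])
  also have "\<dots> = - 2 * (x $ i) * pd i (\<lambda>x. bump_deriv 1 (1 - lat2 a x)) x
      + pd i (\<lambda>x. - 2 * (x $ i)) x * bump_deriv 1 (1 - lat2 a x)"
    by (rule pd_mult[OF smooth_differentiable[OF s'] smooth_differentiable[OF s]])
  also have "pd i (\<lambda>x. - 2 * (x $ i)) x = - 2"
    using pd_mult[OF smooth_differentiable[OF smooth_const[of "-2"]] smooth_differentiable[OF smooth_coord], of i i x]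
    by (simp add: pd_const pd_coord)
  finally show ?thesis using assms by (simp add: pd_bump_lat2 power2_eq_square numeral_2_eq_2)
qed

text \<open>The Hessian equation in a transverse direction is integrated by parts twice, so the
  second derivative of the cutoff acts as a weight and has to be bounded and supported in the
  strip.\<close>

lemma pd_pd_lat_cut_bounded:
  obtains C where "C \<ge> 0" "\<And>(a :: 'n::finite) i x. i \<noteq> a \<Longrightarrow> \<bar>pd i (pd i (lat_cut a)) x\<bar> \<le> C"
    "\<And>(a :: 'n) i x. i \<noteq> a \<Longrightarrow> lat2 a x > 1 \<Longrightarrow> pd i (pd i (lat_cut a)) x = 0"
proof -
  have "bounded (bump_deriv k ` {0..1})" for k
    by (intro compact_imp_bounded compact_continuous_image bump_deriv_continuous) auto
  then have "\<exists>B>0. \<forall>t\<in>{0..1}. \<bar>bump_deriv k t\<bar> \<le> B" for k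
    unfolding bounded_pos by auto
  then obtain B where B: "B k > 0" "\<forall>t\<in>{0..1}. \<bar>bump_deriv k t\<bar> \<le> B k" for k
    by metis
  have z: "pd i (pd i (lat_cut a)) x = 0" if "i \<noteq> a" "lat2 a x > 1" for a i :: 'n and x
    using that by (simp add: pd_pd_lat_cut bump_deriv_nonpos)
  have "\<bar>pd i (pd i (lat_cut a)) x\<bar> \<le> 4 * B 2 + 2 * B 1" if ia: "i \<noteq> a" for a i :: 'n and x
  proof (cases "lat2 a x > 1")
    case True
    then show ?thesis using z[OF ia True] B(1)[of 1] B(1)[of 2] by simp
  next
    case False
    have "(x $ i)\<^sup>2 \<le> lat2 a x"
      unfolding lat2_def using ia by (intro member_le_sum) auto
    then have x: "(x $ i)\<^sup>2 \<le> 1" using False by simp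
    have t: "1 - lat2 a x \<in> {0..1}" using False lat2_nonneg[of a x] by auto
    have "\<bar>(x $ i)\<^sup>2 * bump_deriv 2 (1 - lat2 a x)\<bar> \<le> 1 * B 2"
      unfolding abs_mult using x B(2)[of 2] t by (intro mult_mono) auto
    moreover have "\<bar>bump_deriv 1 (1 - lat2 a x)\<bar> \<le> B 1" using B(2)[of 1] t by blast
    ultimately show ?thesis unfolding pd_pd_lat_cut[OF ia] by linarith
  qed
  then show thesis using that[of "4 * B 2 + 2 * B 1"] z B(1)[of 1] B(1)[of 2] by fastforce
qed

text \<open>The \<open>a\<close>-derivative of the cutoff used below is this weight minus its
  translate by \<open>R\<close> along the axis: the rise at the near end minus the fall at the far
  end.\<close>

definition end_weight :: "'n::finite \<Rightarrow> real^'n \<Rightarrow> real" where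
  "end_weight a x = step' (x $ a) * lat_cut a x"

lemma smooth_end_weight: "smooth_on UNIV (end_weight a)"
  using smooth_mult[OF smooth_step'_coord[of a 0] smooth_lat_cut] by (simp add: end_weight_def[abs_def])

lemma end_weight_zero: "x \<notin> strip_box a 1 \<Longrightarrow> end_weight a x = 0"
  using step'_zero[of "x $ a"] lat_cut_zero[of a x] by (auto simp: end_weight_def strip_box_def not_le)

text \<open>Continuity, and positivity at the point of the axis with \<open>x $ a = 1/2\<close>. The
  integral is the fixed quantity that the jets of \<open>1 - f\<close> have to dominate.\<close>

lemma integral_end_weight_pos: "(LINT x|lborel. end_weight a x) > 0"
proof -
  let ?x0 = "(1/2) *\<^sub>R axis a 1 :: real^'a"
  have int: "integrable lborel (end_weight a)"
    by (rule integrable_compact_support[OF smooth_continuous[OF smooth_end_weight] compact_strip_box end_weight_zero])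
  have nonneg: "end_weight a x \<ge> 0" for x
    by (simp add: end_weight_def step'_nonneg lat_cut_bounds)
  have "?x0 $ a = 1/2" "lat2 a ?x0 = 0" by (simp_all add: lat2_def axis_def)
  then have pos: "end_weight a ?x0 > 0"
    by (simp add: end_weight_def step'_half_pos lat_cut_def bump_pos)
  have "isCont (end_weight a) ?x0"
    using smooth_continuous[OF smooth_end_weight[of a], of UNIV] by (simp add: continuous_on_eq_continuous_at)
  then obtain d where d: "d > 0" "\<And>x. dist ?x0 x < d \<Longrightarrow> \<bar>end_weight a x - end_weight a ?x0\<bar> < end_weight a ?x0 / 2"
    unfolding continuous_at_eps_delta using pos by (metis dist_commute dist_real_def half_gt_zero)
  define c where "c = end_weight a ?x0 / 2"
  have "0 < c * measure lborel (ball ?x0 d)"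
    using pos d(1) content_ball_pos[of d ?x0] by (simp add: c_def)
  also have "\<dots> = (LINT x|lborel. c * indicator (ball ?x0 d) x)"
    by simp
  also have "\<dots> \<le> (LINT x|lborel. end_weight a x)"
  proof (rule integral_mono[OF _ int])
    show "integrable lborel (\<lambda>x. c * indicator (ball ?x0 d) x)"
      using emeasure_lborel_ball_finite[of ?x0 d] by (intro integrable_mult_right integrable_real_indicator) auto
    show "c * indicator (ball ?x0 d) x \<le> end_weight a x" for x
    proof (cases "dist ?x0 x < d")
      case True
      then have "c \<le> end_weight a x" using d(2)[OF True] unfolding c_def by linarith
      with True show ?thesis by simp
    qed (simp add: nonneg)
  qed
  finally show ?thesis .
qed

subsection \<open>The estimate for weak jets\<close>

text \<open>The constant of \<open>decay_le_osc_factor\<close>: 9 bounds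
  \<open>osc_factor a x ^ j\<close> for \<open>j \<le> 2\<close>, 8 comes from the quadratic bound
  for \<open>2 * rad x\<close>, and the last power from comparing (1 + t)^(2 n) with exp t.\<close>

definition osc_const :: "'n::finite itself \<Rightarrow> real" where
  "osc_const _ = 9 * 8 ^ CARD('n) * (2 * real CARD('n)) ^ (2 * CARD('n))"

lemma osc_const_pos: "osc_const TYPE('n::finite) > 0"
  by (simp add: osc_const_def)

text \<open>\<open>small\<close> is smallness in L^1 in dual form: components are tested against
  weights that, after multiplication by \<open>osc_factor a x ^ j\<close>, are dominated by the
  Riemannian density. \<open>T\<close> is an arbitrary weak jet.\<close>

locale osc_jet =
  fixes a b :: "'n::finite" and f :: "real^'n \<Rightarrow> real" and K :: "(real^'n) set"
    and T :: "nat \<Rightarrow> (real^'n, 'n) tensor" and Q :: real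
  assumes ab: "a \<noteq> b"
    and f: "smooth_on UNIV f" and K: "compact K" "\<And>x. x \<notin> K \<Longrightarrow> f x = 0"
    and T0: "\<And>x. T 0 std_chart x [] = 1 - f x"
    and loc_int: "\<And>j. j \<le> 2 \<Longrightarrow> locally_integrable_tensor std_atlas j (T j)"
    and weak: "\<And>j. j < 2 \<Longrightarrow> weak_cov_deriv std_atlas (conf_metric (osc_factor a)) j (T j) (T (Suc j))"
    and small: "\<And>j I \<psi>. j \<le> 2 \<Longrightarrow> length I = j \<Longrightarrow>
      (\<And>x. osc_factor a x ^ j * \<bar>\<psi> x\<bar> \<le> osc_const TYPE('n) * osc_factor a x ^ CARD('n)) \<Longrightarrow>
        \<bar>LINT x|lborel. T j std_chart x I * \<psi> x\<bar> \<le> osc_const TYPE('n) * Q"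
begin

abbreviation w :: "real^'n \<Rightarrow> real" where "w x \<equiv> T 0 std_chart x []"
abbreviation v :: "'n \<Rightarrow> real^'n \<Rightarrow> real" where "v i x \<equiv> T (Suc 0) std_chart x [i]"
abbreviation H :: "'n \<Rightarrow> 'n \<Rightarrow> real^'n \<Rightarrow> real" where "H i l x \<equiv> T 2 std_chart x [i, l]"

definition N :: real where "N = osc_const TYPE('n) * Q"

lemma integrable_component:
  assumes j: "j \<le> 2" "length I = j" and g: "continuous_on UNIV g" and B: "compact B" "\<And>x. x \<notin> B \<Longrightarrow> g x = 0"
  shows "integrable lborel (\<lambda>x. T j std_chart x I * g x)"
proof -
  obtain C where C: "\<And>x. \<bar>g x\<bar> \<le> C" using bounded_compact_support[OF g B] by blast
  have int: "integrable lborel (\<lambda>x. indicator B x *\<^sub>R T j std_chart x I)"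
    using loc_int[OF j(1)] j(2) B(1) by (auto simp: locally_integrable_tensor_def set_integrable_def)
  have [measurable]: "(\<lambda>x. indicator B x *\<^sub>R T j std_chart x I) \<in> borel_measurable borel" "g \<in> borel_measurable borel"
    using borel_measurable_integrable[OF int] g by (simp_all add: borel_measurable_continuous_onI)
  have eq: "(\<lambda>x. T j std_chart x I * g x) = (\<lambda>x. (indicator B x *\<^sub>R T j std_chart x I) * g x)"
    using B(2) by (auto simp: fun_eq_iff indicator_def)
  show ?thesis
    unfolding eq
  proof (rule Bochner_Integration.integrable_bound[OF integrable_mult_right[OF int, of C]])
    show "(\<lambda>x. (indicator B x *\<^sub>R T j std_chart x I) * g x) \<in> borel_measurable lborel"
      unfolding measurable_lborel1 by (intro borel_measurable_times) measurable
    show "AE x in lborel. norm (indicator B x *\<^sub>R T j std_chart x I * g x) \<le> norm (C * indicator B x *\<^sub>R T j std_chart x I)"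
    proof (rule AE_I2)
      fix x
      have "\<bar>g x\<bar> \<le> \<bar>C\<bar>" using C[of x] by linarith
      then show "norm (indicator B x *\<^sub>R T j std_chart x I * g x) \<le> norm (C * indicator B x *\<^sub>R T j std_chart x I)"
        by (auto simp: abs_mult indicator_def mult.commute intro: mult_right_mono)
    qed
  qed
qed

text \<open>After division by \<open>c\<close> the weight is admissible in \<open>small\<close>.
  From here on, domination by \<open>decay\<close> is the condition to be checked for each
  weight.\<close>

lemma component_small:
  assumes j: "j \<le> 2" "length I = j" and c: "c \<ge> 0" and g: "\<And>x. \<bar>g x\<bar> \<le> c * decay a x"
  shows "\<bar>LINT x|lborel. T j std_chart x I * g x\<bar> \<le> c * N"
proof (cases "c = 0")
  case True
  then have "g x = 0" for x using g[of x] by simp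
  then show ?thesis using True by simp
next
  case False
  then have c: "c > 0" using c by simp
  have "\<bar>LINT x|lborel. T j std_chart x I * (g x / c)\<bar> \<le> osc_const TYPE('n) * Q"
  proof (rule small[OF j])
    fix x
    have "\<bar>g x / c\<bar> \<le> decay a x" using g[of x] c by (simp add: field_simps)
    then have "osc_factor a x ^ j * \<bar>g x / c\<bar> \<le> osc_factor a x ^ j * decay a x"
      using osc.lam_pos[of a x] by (intro mult_left_mono) auto
    also have "\<dots> \<le> osc_const TYPE('n) * osc_factor a x ^ CARD('n)"
      unfolding osc_const_def by (rule decay_le_osc_factor[OF j(1)])
    finally show "osc_factor a x ^ j * \<bar>g x / c\<bar> \<le> osc_const TYPE('n) * osc_factor a x ^ CARD('n)" .
  qed
  then have "\<bar>(LINT x|lborel. T j std_chart x I * g x) / c\<bar> \<le> N" by (simp add: N_def)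
  then show ?thesis using c by (simp add: field_simps)
qed

section \<open>The weak equations in coordinates\<close>

lemma weak_first:
  assumes "\<psi> \<in> test_functions UNIV"
  shows "(LINT x|lborel. v i x * \<psi> x) = - (LINT x|lborel. w x * pd i \<psi> x)"
  using weak[of 0] assms by (auto simp: weak_cov_deriv_def)

abbreviation osc_dlog :: "real^'n \<Rightarrow> real" where
  "osc_dlog x \<equiv> exp (x $ a) * cos (exp (x $ a)) / osc (x $ a)"

text \<open>What remains of the Euclidean derivative of \<open>v i\<close> in direction
  \<open>i\<close> once the contribution of \<open>osc\<close> to the connection is split off; its
  coefficients are bounded.\<close>

definition reduced :: "'n \<Rightarrow> real^'n \<Rightarrow> real" where
  "reduced i x = H i i x + 2 * kappa i x * v i x - (\<Sum>m\<in>UNIV. kappa m x * v m x)"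

text \<open>Contracting the Christoffel symbols with \<open>v\<close> gives
  \<open>2 * osc.dlog a i x * v i x\<close> minus the sum of all
  \<open>osc.dlog a m x * v m x\<close>. The part of the logarithmic derivative that stems from
  \<open>osc\<close> lives in direction \<open>a\<close>, so it enters with 2 - 1 = 1 for
  \<open>i = a\<close> and with -1 otherwise.\<close>

lemma weak_second:
  assumes "\<psi> \<in> test_functions UNIV"
  shows "(LINT x|lborel. (reduced i x + (if i = a then 1 else - 1) * (osc_dlog x * v a x)) * \<psi> x)
    = - (LINT x|lborel. v i x * pd i \<psi> x)"
proof -
  have "(\<Sum>m\<in>UNIV. christoffel (conf_metric (osc_factor a)) std_chart x m i i * v m x)
      = 2 * osc.dlog a i x * v i x - (\<Sum>m\<in>UNIV. osc.dlog a m x * v m x)" for x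
  proof -
    have "christoffel (conf_metric (osc_factor a)) std_chart x m i i * v m x
        = (if m = i then 2 * osc.dlog a i x * v i x else 0) - osc.dlog a m x * v m x" for m
      by (simp add: osc.christoffel_conf algebra_simps)
    then show ?thesis by (simp add: sum_subtractf)
  qed
  moreover have "2 * osc.dlog a i x * v i x - (\<Sum>m\<in>UNIV. osc.dlog a m x * v m x)
      = 2 * kappa i x * v i x - (\<Sum>m\<in>UNIV. kappa m x * v m x) + (if i = a then 1 else - 1) * (osc_dlog x * v a x)" for x
  proof -
    have "(\<Sum>m\<in>UNIV. osc.dlog a m x * v m x)
        = (\<Sum>m\<in>UNIV. kappa m x * v m x + (if m = a then osc_dlog x * v a x else 0))"
      by (intro sum.cong) (auto simp: dlog_osc distrib_right)
    then show ?thesis by (simp add: sum.distrib dlog_osc distrib_right algebra_simps)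
  qed
  ultimately have eq: "H i i x + (\<Sum>m\<in>UNIV. christoffel (conf_metric (osc_factor a)) std_chart x m i i * v m x)
      = reduced i x + (if i = a then 1 else - 1) * (osc_dlog x * v a x)" for x
    by (simp add: reduced_def)
  have "\<forall>i I. length I = 1 \<longrightarrow> (\<forall>\<psi> \<in> test_functions UNIV.
        (LINT x|lborel. (T 2 std_chart x (i # I) +
            (\<Sum>s<1. \<Sum>l\<in>UNIV. christoffel (conf_metric (osc_factor a)) std_chart x l i (I ! s)
              * T 1 std_chart x (I[s := l]))) * \<psi> x)
        = - (LINT x|lborel. T 1 std_chart x I * pd i \<psi> x))"
    using weak[of 1] by (simp add: weak_cov_deriv_def numeral_2_eq_2)
  from this[rule_format, of "[i]" \<psi> i] assms
  have "(LINT x|lborel. (H i i x + (\<Sum>m\<in>UNIV. christoffel (conf_metric (osc_factor a)) std_chart x m i i * v m x)) * \<psi> x)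
      = - (LINT x|lborel. v i x * pd i \<psi> x)"
    by simp
  then show ?thesis unfolding eq .
qed

lemma integrable_reduced:
  assumes "continuous_on UNIV g" "compact B" "\<And>x. x \<notin> B \<Longrightarrow> g x = 0"
  shows "integrable lborel (\<lambda>x. reduced i x * g x)"
    and "(LINT x|lborel. reduced i x * g x) = (LINT x|lborel. H i i x * g x)
      + (LINT x|lborel. v i x * (2 * kappa i x * g x)) - (\<Sum>m\<in>UNIV. LINT x|lborel. v m x * (kappa m x * g x))"
proof -
  have eq: "reduced i x * g x = H i i x * g x + v i x * (2 * kappa i x * g x)
      - (\<Sum>m\<in>UNIV. v m x * (kappa m x * g x))" for x
    unfolding reduced_def sum_distrib_right left_diff_distrib distrib_right by (simp add: mult_ac)
  have 1: "integrable lborel (\<lambda>x. H i i x * g x)"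
    by (rule integrable_component[OF _ _ assms]) auto
  have 2: "integrable lborel (\<lambda>x. v m x * (c * kappa m x * g x))" for m c
    by (rule integrable_component[OF _ _ _ assms(2)])
      (auto intro!: continuous_intros assms(1) smooth_continuous[OF smooth_kappa] simp: assms(3))
  have 3: "integrable lborel (\<lambda>x. v m x * (kappa m x * g x))" for m
    using 2[of m 1] by simp
  show "integrable lborel (\<lambda>x. reduced i x * g x)"
    unfolding eq using 1 2 3 by auto
  show "(LINT x|lborel. reduced i x * g x) = (LINT x|lborel. H i i x * g x)
      + (LINT x|lborel. v i x * (2 * kappa i x * g x)) - (\<Sum>m\<in>UNIV. LINT x|lborel. v m x * (kappa m x * g x))"
    unfolding eq using 1 2 3 by (simp add: Bochner_Integration.integral_sum)
qed

text \<open>The constant counts 1 for the Hessian component, 2 times 3 for the doubled term and 3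
  for each of the \<open>CARD('n)\<close> summands, as \<open>kappa\<close> is bounded by 3.\<close>

lemma reduced_small:
  assumes "continuous_on UNIV g" "compact B" "\<And>x. x \<notin> B \<Longrightarrow> g x = 0"
    and c: "c \<ge> 0" and g: "\<And>x. \<bar>g x\<bar> \<le> c * decay a x"
  shows "\<bar>LINT x|lborel. reduced i x * g x\<bar> \<le> c * (7 + 3 * real CARD('n)) * N"
proof -
  have k: "\<bar>kappa m x * g x\<bar> \<le> 3 * c * decay a x" for m x
    unfolding abs_mult using mult_mono[OF kappa_bound[of m x] g[of x]] by (simp add: mult_ac)
  have "\<bar>LINT x|lborel. H i i x * g x\<bar> \<le> c * N"
    by (rule component_small[OF _ _ c g]) auto
  moreover have "\<bar>LINT x|lborel. v i x * (2 * kappa i x * g x)\<bar> \<le> (6 * c) * N"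
    by (rule component_small) (use c k[of i] in \<open>auto simp: abs_mult mult_ac\<close>)
  moreover have "\<bar>\<Sum>m\<in>UNIV. LINT x|lborel. v m x * (kappa m x * g x)\<bar> \<le> (\<Sum>m\<in>(UNIV :: 'n set). 3 * c * N)"
    by (rule order_trans[OF sum_abs sum_mono], rule component_small) (use c k in auto)
  moreover have "c * (7 + 3 * real CARD('n)) * N = c * N + (6 * c) * N + (\<Sum>m\<in>(UNIV :: 'n set). 3 * c * N)"
    by (simp add: algebra_simps)
  moreover note integrable_reduced(2)[OF assms(1-3), of i]
  ultimately show ?thesis by linarith
qed

text \<open>The weak Hessian equations in the directions \<open>b\<close> and \<open>a\<close> are tested with \<open>prof \<cdot> cut\<close> and
  \<open>corr / osc \<cdot> cut\<close>; by \<open>prof_corr\<close> they bound the integral of \<open>v a \<cdot> cut\<close>, which measures the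
  drop of \<open>f\<close> along the strip.\<close>

lemma end_weight_estimate:
  assumes step'_le: "\<And>t. step' t \<le> Cs" and Cs: "Cs \<ge> 0"
    and Cb: "Cb \<ge> 0" "\<And>x. \<bar>pd b (pd b (lat_cut a)) x\<bar> \<le> Cb"
      "\<And>x. lat2 a x > 1 \<Longrightarrow> pd b (pd b (lat_cut a)) x = 0"
  shows "(LINT x|lborel. end_weight a x)
    \<le> (3 * Cs + 4 * (7 + 3 * real CARD('n)) + 4 * Cb + 2 * (7 + 3 * real CARD('n)) + (4 * Cs + 2)) * N"
proof -
  obtain R where R: "R \<ge> 1" "\<And>x. x \<in> K \<Longrightarrow> norm x < R"
  proof -
    obtain r where r: "\<And>x. x \<in> K \<Longrightarrow> norm x \<le> r"
      using compact_imp_bounded[OF K(1)] unfolding bounded_iff by blast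
    show thesis by (rule that[of "max 1 (r + 1)"]) (use r in fastforce)+
  qed
  define B where "B = strip_box a (R + 1)"
  have B: "compact B" unfolding B_def by (rule compact_strip_box)
  \<comment> \<open>A plateau: it rises on [0, 1] and falls on [R, R + 1], beyond the support of
    \<open>f\<close>.\<close>
  define th where "th t = step t - step (t - R)" for t
  define th' where "th' t = step' t - step' (t - R)" for t
  define cut where "cut x = th (x $ a) * lat_cut a x" for x
  define \<psi> where "\<psi> x = prof (x $ a) * cut x" for x
  \<comment> \<open>Division by \<open>osc\<close> is an integrating factor: the term that it
    contributes to \<open>pd a \<psi>'\<close> cancels
    \<open>osc_dlog x * \<psi>' x\<close>.\<close>
  define \<psi>' where "\<psi>' x = corr (x $ a) / osc (x $ a) * cut x" for x
  \<comment> \<open>The error. Both parts carry the small factor \<open>corr\<close>: in one the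
    derivative falls on the cutoff, the other is the error in \<open>prof_corr\<close>.\<close>
  define W where "W x = corr (x $ a) / osc (x $ a) * (th' (x $ a) * lat_cut a x - cut x)" for x
  have th_DERIV: "(th has_real_derivative th' t) (at t)" for t
  proof -
    have "((\<lambda>t. step (t - R)) has_real_derivative step' (t - R) * 1) (at t)"
      by (rule DERIV_chain2[OF step_DERIV]) (auto intro!: derivative_eq_intros)
    then show ?thesis unfolding th_def[abs_def] th'_def by (auto intro!: DERIV_diff step_DERIV)
  qed
  have th_abs: "\<bar>th t\<bar> \<le> 1" for t
    using step_nonneg[of t] step_le_1[of t] step_nonneg[of "t - R"] step_le_1[of "t - R"] by (simp add: th_def)
  have th'_abs: "\<bar>th' t\<bar> \<le> 2 * Cs" for t
    using step'_nonneg[of t] step'_le[of t] step'_nonneg[of "t - R"] step'_le[of "t - R"] by (simp add: th'_def)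
  have th_zero: "th t = 0" "th' t = 0" if "t < 0 \<or> t > R + 1" for t
    using that R(1) by (auto simp: th_def th'_def step_nonpos step_ge_1 step'_zero)
  have s_th: "smooth_on UNIV (\<lambda>x. th (x $ a))" and s_th': "smooth_on UNIV (\<lambda>x. th' (x $ a))"
    unfolding th_def th'_def using smooth_step'_coord[of a 0] smooth_step'_coord[of a R]
    by (auto intro!: smooth_diff smooth_step smooth_coord smooth_const)
  have s_cut: "smooth_on UNIV cut" unfolding cut_def[abs_def] by (intro smooth_mult s_th smooth_lat_cut)
  have s_\<psi>: "smooth_on UNIV \<psi>" unfolding \<psi>_def[abs_def] by (intro smooth_mult smooth_prof s_cut)
  have s_co: "smooth_on UNIV (\<lambda>x. corr (x $ a) / osc (x $ a))"
    by (intro smooth_divide smooth_corr smooth_osc osc_bounds(3))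
  have s_\<psi>': "smooth_on UNIV \<psi>'" unfolding \<psi>'_def[abs_def] by (intro smooth_mult s_co s_cut)
  have s_W: "smooth_on UNIV W" unfolding W_def[abs_def]
    by (intro smooth_mult smooth_diff s_co s_cut s_th' smooth_lat_cut)
  have outB: "th (x $ a) * lat_cut a x = 0" "th' (x $ a) * lat_cut a x = 0" if "x \<notin> B" for x
    using that th_zero[of "x $ a"] lat_cut_zero[of a x] by (auto simp: B_def strip_box_def not_le)
  have z: "cut x = 0" "\<psi> x = 0" "\<psi>' x = 0" "W x = 0" if "x \<notin> B" for x
    using outB[OF that] by (auto simp: cut_def \<psi>_def \<psi>'_def W_def)
  have t_cut: "cut \<in> test_functions UNIV" by (rule test_functionsI[OF s_cut B z(1)])
  have t_\<psi>: "\<psi> \<in> test_functions UNIV" by (rule test_functionsI[OF s_\<psi> B z(2)])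
  have t_\<psi>': "\<psi>' \<in> test_functions UNIV" by (rule test_functionsI[OF s_\<psi>' B z(3)])
  have c_dlog: "continuous_on UNIV osc_dlog"
    by (intro smooth_continuous smooth_divide smooth_mult smooth_exp_coord smooth_chain[OF smooth1_cos] smooth_osc osc_bounds(3)) auto
  have decayI: "\<bar>F * g\<bar> \<le> c * decay a x"
    if "\<bar>F\<bar> \<le> c * exp (- (x $ a))" "\<bar>g\<bar> \<le> 1" "x $ a < 0 \<or> lat2 a x > 1 \<Longrightarrow> F * g = 0" for F g c x
  proof (cases "0 \<le> x $ a \<and> lat2 a x \<le> 1")
    case True
    then show ?thesis using mult_mono[OF that(1,2)] that(1) by (simp add: abs_mult decay_def)
  next
    case False
    then show ?thesis using that(3) by (auto simp: decay_def not_le)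
  qed
  have zero: "th (x $ a) * lat_cut a x = 0" "th' (x $ a) * lat_cut a x = 0" if "x $ a < 0 \<or> lat2 a x > 1" for x
    using that th_zero[of "x $ a"] lat_cut_zero[of a x] by auto
  have cut_abs: "\<bar>cut x\<bar> \<le> 1" for x
    unfolding cut_def abs_mult using mult_mono[OF th_abs[of "x $ a"], of "\<bar>lat_cut a x\<bar>" 1] lat_cut_bounds[of a x] by simp
  have corr_osc: "\<bar>corr t / osc t\<bar> \<le> 2 * exp (- t)" for t
  proof -
    have "\<bar>corr t\<bar> / osc t \<le> \<bar>corr t\<bar> / 1" using osc_bounds[of t] by (intro divide_left_mono) auto
    then show ?thesis using corr_le[of t] osc_bounds(3)[of t] by (simp add: abs_divide)
  qed
  have \<psi>_le: "\<bar>\<psi> x\<bar> \<le> 4 * decay a x" for x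
    unfolding \<psi>_def by (rule decayI[OF prof_le cut_abs]) (use zero(1) in \<open>simp add: cut_def\<close>)
  have \<psi>'_le: "\<bar>\<psi>' x\<bar> \<le> 2 * decay a x" for x
    unfolding \<psi>'_def by (rule decayI[OF corr_osc cut_abs]) (use zero(1) in \<open>simp add: cut_def\<close>)
  have W_le: "\<bar>W x\<bar> \<le> (4 * Cs + 2) * decay a x" for x
  proof -
    have "\<bar>th' (x $ a) * lat_cut a x - cut x\<bar> \<le> 2 * Cs + 1"
    proof -
      have "\<bar>th' (x $ a) * lat_cut a x\<bar> \<le> 2 * Cs * 1"
        unfolding abs_mult using th'_abs[of "x $ a"] lat_cut_bounds[of a x] Cs by (intro mult_mono) auto
      then show ?thesis using cut_abs[of x] by linarith
    qed
    then have "\<bar>W x\<bar> \<le> (2 * exp (- (x $ a))) * (2 * Cs + 1)"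
      unfolding W_def abs_mult[of "corr (x $ a) / osc (x $ a)"] using corr_osc[of "x $ a"] by (intro mult_mono) auto
    moreover have "W x = 0" if "x $ a < 0 \<or> lat2 a x > 1"
      using zero[OF that] by (auto simp: W_def cut_def)
    ultimately show ?thesis by (auto simp: decay_def algebra_simps not_le)
  qed
  \<comment> \<open>\<open>step'\<close> vanishes beyond 1, and up to there 3 exp (- t) is at least
    1 because e is at most 3.\<close>
  have e_le: "\<bar>end_weight a x\<bar> \<le> (3 * Cs) * decay a x" for x
    unfolding end_weight_def
  proof (rule decayI)
    show "\<bar>step' (x $ a)\<bar> \<le> 3 * Cs * exp (- (x $ a))"
    proof (cases "x $ a \<le> 1")
      case True
      have "1 = exp 1 * exp (- 1 :: real)" by (simp add: exp_minus)
      also have "\<dots> \<le> 3 * exp (- (x $ a))" using True exp_le by (intro mult_mono) auto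
      finally have "Cs * 1 \<le> Cs * (3 * exp (- (x $ a)))" using Cs by (intro mult_left_mono)
      then show ?thesis using step'_le[of "x $ a"] step'_nonneg[of "x $ a"] by simp
    next
      case False
      then show ?thesis using Cs step'_zero[of "x $ a"] by simp
    qed
    show "\<bar>lat_cut a x\<bar> \<le> 1" using lat_cut_bounds[of a x] by simp
    show "step' (x $ a) * lat_cut a x = 0" if "x $ a < 0 \<or> lat2 a x > 1"
      using that step'_zero[of "x $ a"] lat_cut_zero[of a x] by auto
  qed
  have pdcut: "pd a cut x = th' (x $ a) * lat_cut a x" for x
    unfolding cut_def[abs_def]
    using pd_mult[OF smooth_differentiable[OF s_th, of x] smooth_differentiable[OF smooth_lat_cut[of a], of x], of a]
      pd_fun_coord[OF th_DERIV[of "x $ a"], of a] by (simp add: pd_lat_cut)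
  \<comment> \<open>By \<open>prof_corr\<close> the weights that the two Hessian equations put on
    \<open>v a\<close> add up to the cutoff, up to \<open>W\<close>.\<close>
  have pd\<psi>': "cut x = osc_dlog x * \<psi> x + pd a \<psi>' x + osc_dlog x * \<psi>' x - W x" for x
  proof -
    let ?t = "x $ a"
    have o: "osc ?t > 0" by (rule osc_bounds(3))
    have "((\<lambda>t. corr t / osc t) has_real_derivative
        (corr' ?t * osc ?t - corr ?t * (exp ?t * cos (exp ?t))) / (osc ?t * osc ?t)) (at ?t)"
      using o by (intro DERIV_divide corr_DERIV osc_DERIV) auto
    from pd_fun_coord[OF this, of a]
    have "pd a \<psi>' x = corr ?t / osc ?t * (th' ?t * lat_cut a x)
        + (corr' ?t * osc ?t - corr ?t * (exp ?t * cos (exp ?t))) / (osc ?t * osc ?t) * cut x"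
      unfolding \<psi>'_def[abs_def]
      using pd_mult[OF smooth_differentiable[OF s_co, of x] smooth_differentiable[OF s_cut, of x], of a] by (simp add: pdcut)
    then have "osc_dlog x * \<psi> x + pd a \<psi>' x + osc_dlog x * \<psi>' x - W x
        = (prof ?t * (exp ?t * cos (exp ?t)) + corr' ?t + corr ?t) * cut x / osc ?t"
      unfolding \<psi>_def \<psi>'_def W_def using o by (simp add: field_simps)
    also have "\<dots> = cut x" using prof_corr[of ?t] o by simp
    finally show ?thesis by simp
  qed
  \<comment> \<open>Since \<open>b\<close> differs from \<open>a\<close>, the derivatives see the
    lateral cutoff only, and the large derivatives of \<open>prof\<close> do not occur.\<close>
  have pdpd\<psi>: "pd b (pd b \<psi>) x = (prof (x $ a) * th (x $ a)) * pd b (pd b (lat_cut a)) x" for x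
  proof -
    define F where "F t = prof t * th t" for t
    have sF: "smooth_on UNIV (\<lambda>x. F (x $ a))" unfolding F_def by (intro smooth_mult smooth_prof s_th)
    have F: "pd b (\<lambda>x. F (x $ a)) x = 0" for x
    proof -
      have "(prof has_real_derivative (4 * (- sin (exp t) * exp t) * exp (- t) + (exp (- t) * (- 1)) * (4 * cos (exp t)))) (at t)" for t
        unfolding prof_def[abs_def] by (auto intro!: derivative_eq_intros)
      from DERIV_mult[OF this th_DERIV] have "\<exists>F'. (F has_real_derivative F') (at t)" for t
        unfolding F_def[abs_def] by blast
      then obtain F' where "(F has_real_derivative F') (at (x $ a))" by blast
      from pd_fun_coord[OF this, of b] show ?thesis using ab by simp
    qed
    have \<psi>F: "\<psi> = (\<lambda>x. F (x $ a) * lat_cut a x)" by (simp add: fun_eq_iff \<psi>_def cut_def F_def mult_ac)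
    have "pd b \<psi> = (\<lambda>x. F (x $ a) * pd b (lat_cut a) x)"
      unfolding \<psi>F using pd_mult[OF smooth_differentiable[OF sF] smooth_differentiable[OF smooth_lat_cut]] F by (simp add: fun_eq_iff)
    then show ?thesis
      using pd_mult[OF smooth_differentiable[OF sF, of x] smooth_differentiable[OF smooth_pd[OF smooth_lat_cut[of a], of b], of x], of b] F
      by (simp add: F_def)
  qed
  have pdpd\<psi>_le: "\<bar>pd b (pd b \<psi>) x\<bar> \<le> (4 * Cb) * decay a x" for x
  proof -
    have "\<bar>prof (x $ a) * th (x $ a)\<bar> \<le> 4 * exp (- (x $ a)) * 1"
      unfolding abs_mult using prof_le[of "x $ a"] th_abs[of "x $ a"] by (intro mult_mono) auto
    then have "\<bar>pd b (pd b \<psi>) x\<bar> \<le> (4 * exp (- (x $ a))) * Cb"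
      unfolding pdpd\<psi> abs_mult[of "prof (x $ a) * th (x $ a)"] using Cb(2)[of x] by (intro mult_mono) auto
    moreover have "pd b (pd b \<psi>) x = 0" if "x $ a < 0 \<or> lat2 a x > 1"
      using that th_zero(1)[of "x $ a"] Cb(3)[of x] by (auto simp: pdpd\<psi>)
    ultimately show ?thesis by (auto simp: decay_def algebra_simps not_le)
  qed
  note cont = smooth_continuous[OF s_cut, of UNIV] smooth_continuous[OF s_\<psi>, of UNIV]
    smooth_continuous[OF s_\<psi>', of UNIV] smooth_continuous[OF s_W, of UNIV]
  have pz: "pd a \<psi>' x = 0" if "x \<notin> B" for x
    by (rule pd_zero_outside[OF compact_imp_closed[OF B] _ that]) (rule z(3))
  have int_v: "integrable lborel (\<lambda>x. v a x * g x)" if "continuous_on UNIV g" "\<And>x. x \<notin> B \<Longrightarrow> g x = 0" for g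
    by (rule integrable_component[OF _ _ that(1) B that(2)]) auto
  have int1: "integrable lborel (\<lambda>x. v a x * (osc_dlog x * \<psi> x))"
    by (rule int_v[OF continuous_on_mult[OF c_dlog cont(2)]]) (simp add: z)
  have int2: "integrable lborel (\<lambda>x. v a x * (osc_dlog x * \<psi>' x))"
    by (rule int_v[OF continuous_on_mult[OF c_dlog cont(3)]]) (simp add: z)
  have int3: "integrable lborel (\<lambda>x. v a x * pd a \<psi>' x)"
    by (rule int_v[OF smooth_continuous[OF smooth_pd[OF s_\<psi>']] pz])
  have int4: "integrable lborel (\<lambda>x. v a x * W x)"
    by (rule int_v[OF cont(4) z(4)])
  \<comment> \<open>Direction \<open>b\<close>: the Hessian equation and the first-order equation
    move both derivatives onto \<open>\<psi>\<close>, which leaves \<open>w\<close> itself.\<close>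
  have eq_b: "(LINT x|lborel. v a x * (osc_dlog x * \<psi> x))
      = (LINT x|lborel. reduced b x * \<psi> x) - (LINT x|lborel. w x * pd b (pd b \<psi>) x)"
  proof -
    have "(LINT x|lborel. (reduced b x + - 1 * (osc_dlog x * v a x)) * \<psi> x)
        = (LINT x|lborel. reduced b x * \<psi> x - v a x * (osc_dlog x * \<psi> x))"
      by (intro Bochner_Integration.integral_cong) (auto simp: algebra_simps)
    also have "\<dots> = (LINT x|lborel. reduced b x * \<psi> x) - (LINT x|lborel. v a x * (osc_dlog x * \<psi> x))"
      by (rule Bochner_Integration.integral_diff[OF integrable_reduced(1)[OF cont(2) B z(2)] int1])
    finally show ?thesis
      using weak_second[OF t_\<psi>, of b] weak_first[OF test_functions_pd[OF t_\<psi>], of b b] ab by simp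
  qed
  \<comment> \<open>Direction \<open>a\<close>: the term with \<open>pd a \<psi>'\<close> is kept,
    because it is of order one and fills the gaps that \<open>prof\<close> leaves at the turning
    points.\<close>
  have eq_a: "(LINT x|lborel. v a x * (osc_dlog x * \<psi>' x)) + (LINT x|lborel. v a x * pd a \<psi>' x)
      = - (LINT x|lborel. reduced a x * \<psi>' x)"
  proof -
    have "(LINT x|lborel. (reduced a x + 1 * (osc_dlog x * v a x)) * \<psi>' x)
        = (LINT x|lborel. reduced a x * \<psi>' x + v a x * (osc_dlog x * \<psi>' x))"
      by (intro Bochner_Integration.integral_cong) (auto simp: algebra_simps)
    also have "\<dots> = (LINT x|lborel. reduced a x * \<psi>' x) + (LINT x|lborel. v a x * (osc_dlog x * \<psi>' x))"
      by (rule Bochner_Integration.integral_add[OF integrable_reduced(1)[OF cont(3) B z(3)] int2])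
    finally show ?thesis using weak_second[OF t_\<psi>', of a] by simp
  qed
  have "(LINT x|lborel. v a x * cut x) = (LINT x|lborel. v a x * (osc_dlog x * \<psi> x)
      + v a x * pd a \<psi>' x + v a x * (osc_dlog x * \<psi>' x) - v a x * W x)"
    by (intro Bochner_Integration.integral_cong refl, subst pd\<psi>') (simp add: algebra_simps)
  also have "\<dots> = (LINT x|lborel. reduced b x * \<psi> x) - (LINT x|lborel. w x * pd b (pd b \<psi>) x)
      - (LINT x|lborel. reduced a x * \<psi>' x) - (LINT x|lborel. v a x * W x)"
    using int1 int2 int3 int4 eq_a eq_b by simp
  finally have drop: "(LINT x|lborel. v a x * cut x) = (LINT x|lborel. reduced b x * \<psi> x)
      - (LINT x|lborel. w x * pd b (pd b \<psi>) x) - (LINT x|lborel. reduced a x * \<psi>' x) - (LINT x|lborel. v a x * W x)" .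
  define e where "e = end_weight a"
  define shift where "shift x = end_weight a ((- R) *\<^sub>R axis a 1 + x)" for x
  have shift: "shift x = step' (x $ a - R) * lat_cut a x" for x
  proof -
    have "((- R) *\<^sub>R axis a 1 + x) $ i = (if i = a then x $ a - R else x $ i)" for i
      by (simp add: axis_def)
    moreover from this have "lat2 a ((- R) *\<^sub>R axis a 1 + x) = lat2 a x"
      unfolding lat2_def by (intro sum.cong) auto
    ultimately show ?thesis by (simp add: shift_def end_weight_def lat_cut_def)
  qed
  \<comment> \<open>The translated weight lives where \<open>x $ a > R\<close>, outside
    \<open>K\<close>, and there \<open>w\<close> is 1. This is how the compact support of
    \<open>f\<close> forces a drop.\<close>
  have w1: "w x * shift x = shift x" for x
  proof (cases "x \<in> K")
    case True
    then have "x $ a - R \<le> 0" using R(2)[OF True] component_le_norm_cart[of x a] by linarith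
    then show ?thesis by (simp add: shift step'_zero)
  next
    case False
    then show ?thesis by (simp add: T0 K(2))
  qed
  have "(LINT x|lborel. w x * pd a cut x) = (LINT x|lborel. w x * e x - shift x)"
    by (intro Bochner_Integration.integral_cong refl, subst w1[symmetric])
      (simp add: pdcut th'_def shift e_def end_weight_def algebra_simps)
  also have "\<dots> = (LINT x|lborel. w x * e x) - (LINT x|lborel. shift x)"
  proof (rule Bochner_Integration.integral_diff)
    show "integrable lborel (\<lambda>x. w x * e x)"
      unfolding e_def
      by (rule integrable_component[OF _ _ smooth_continuous[OF smooth_end_weight] compact_strip_box end_weight_zero]) auto
    show "integrable lborel shift"
    proof (rule integrable_compact_support[OF _ B])
      show "continuous_on UNIV shift"
        unfolding shift by (intro smooth_continuous smooth_mult smooth_step'_coord smooth_lat_cut)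
      show "shift x = 0" if "x \<notin> B" for x
        using that R(1) lat_cut_zero[of a x] step'_zero[of "x $ a - R"]
        by (auto simp: shift B_def strip_box_def not_le)
    qed
  qed
  \<comment> \<open>By translation invariance the far end contributes the same number for every
    \<open>R\<close>, so the lower bound does not depend on \<open>f\<close>.\<close>
  also have "(LINT x|lborel. shift x) = (LINT x|lborel. end_weight a x)"
    unfolding shift_def by (rule integral_lborel_translation)
  finally have "(LINT x|lborel. end_weight a x) = (LINT x|lborel. w x * e x) + (LINT x|lborel. v a x * cut x)"
    using weak_first[OF t_cut, of a] by simp
  then have eq: "(LINT x|lborel. end_weight a x) = (LINT x|lborel. w x * e x) + (LINT x|lborel. reduced b x * \<psi> x)
      - (LINT x|lborel. w x * pd b (pd b \<psi>) x) - (LINT x|lborel. reduced a x * \<psi>' x) - (LINT x|lborel. v a x * W x)"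
    using drop by simp
  have "\<bar>LINT x|lborel. w x * e x\<bar> \<le> 3 * Cs * N"
    unfolding e_def by (rule component_small[OF _ _ _ e_le]) (use Cs in auto)
  moreover have "\<bar>LINT x|lborel. reduced b x * \<psi> x\<bar> \<le> 4 * (7 + 3 * real CARD('n)) * N"
    by (rule reduced_small[OF cont(2) B z(2) _ \<psi>_le]) auto
  moreover have "\<bar>LINT x|lborel. w x * pd b (pd b \<psi>) x\<bar> \<le> 4 * Cb * N"
    by (rule component_small[OF _ _ _ pdpd\<psi>_le]) (use Cb in auto)
  moreover have "\<bar>LINT x|lborel. reduced a x * \<psi>' x\<bar> \<le> 2 * (7 + 3 * real CARD('n)) * N"
    by (rule reduced_small[OF cont(3) B z(3) _ \<psi>'_le]) auto
  moreover have "\<bar>LINT x|lborel. v a x * W x\<bar> \<le> (4 * Cs + 2) * N"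
    by (rule component_small[OF _ _ _ W_le]) (use Cs in auto)
  ultimately show ?thesis unfolding eq distrib_right by linarith
qed

end

section \<open>Choice of the constants and conclusion\<close>

theorem theorem1p8:
  assumes "CARD('n::finite) \<ge> 2"
  shows "\<exists>(X :: (real^'n) topology) (A :: (real^'n, 'n) chart set) (G :: (real^'n, 'n) metric_comps).
           complete_riemannian_manifold X A G \<and>
           (\<forall>k\<ge>2. \<forall>p\<ge>2. \<not> test_functions_dense X A G k p)"
proof -
  obtain a b :: 'n where ab: "a \<noteq> b"
    using assms card_le_Suc0_iff_eq[of "UNIV :: 'n set"] by auto
  obtain Cs where Cs: "\<And>t. \<bar>step' t\<bar> \<le> Cs" using step'_bounded by blast
  have Cs': "step' t \<le> Cs" "Cs \<ge> 0" for t using Cs[of t] by auto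
  obtain Cb where Cb: "Cb \<ge> 0" "\<And>(a :: 'n) i x. i \<noteq> a \<Longrightarrow> \<bar>pd i (pd i (lat_cut a)) x\<bar> \<le> Cb"
    "\<And>(a :: 'n) i x. i \<noteq> a \<Longrightarrow> lat2 a x > 1 \<Longrightarrow> pd i (pd i (lat_cut a)) x = 0"
    using pd_pd_lat_cut_bounded[where 'n='n] by blast
  \<comment> \<open>The constant of \<open>end_weight_estimate\<close> with \<open>N\<close>
    unfolded. It depends on the dimension and the fixed cutoffs, so that \<open>m\<close> is chosen
    before \<open>f\<close>.\<close>
  define C where "C = (3 * Cs + 4 * (7 + 3 * real CARD('n)) + 4 * Cb + 2 * (7 + 3 * real CARD('n)) + (4 * Cs + 2))
    * osc_const TYPE('n)"
  have C: "C > 0"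
    unfolding C_def using Cs'(2) Cb(1) by (intro mult_pos_pos osc_const_pos) (simp add: add_nonneg_pos)
  define m where "m = (LINT x|lborel. end_weight a x) / C"
  have m: "m > 0" unfolding m_def using integral_end_weight_pos[of a] C by simp
  have "\<not> test_functions_dense euclidean std_atlas (conf_metric (osc_factor a)) k p"
    if "k \<ge> 2" "p \<ge> 2" for k p
  proof (rule osc.not_test_functions_dense[OF osc_finite_volume[OF assms] that(1) _ m _ osc_const_pos])
    show "1 \<le> p" using that(2) by simp
    fix f K Q and T :: "nat \<Rightarrow> (real^'n, 'n) tensor"
    assume "smooth_on UNIV f" "compact K" "\<And>x. x \<notin> K \<Longrightarrow> f x = 0" "\<And>x. T 0 std_chart x [] = 1 - f x"
      "\<And>j. j \<le> 2 \<Longrightarrow> locally_integrable_tensor std_atlas j (T j)"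
      "\<And>j. j < 2 \<Longrightarrow> weak_cov_deriv std_atlas (conf_metric (osc_factor a)) j (T j) (T (Suc j))"
      "\<And>j I \<psi>. j \<le> 2 \<Longrightarrow> length I = j \<Longrightarrow>
        (\<And>x. osc_factor a x ^ j * \<bar>\<psi> x\<bar> \<le> osc_const TYPE('n) * osc_factor a x ^ CARD('n)) \<Longrightarrow>
        \<bar>LINT x|lborel. T j std_chart x I * \<psi> x\<bar> \<le> osc_const TYPE('n) * Q"
    then interpret osc_jet a b f K T Q
      using ab by unfold_locales auto
    have "(LINT x|lborel. end_weight a x) \<le> C * Q"
      using end_weight_estimate[OF Cs' Cb(1) Cb(2)[OF ab[symmetric]] Cb(3)[OF ab[symmetric]]]
      by (simp add: C_def N_def mult.assoc)
    then show "m \<le> Q" unfolding m_def using C by (simp add: pos_divide_le_eq mult.commute)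
  qed
  then show ?thesis using osc_complete[of a] by blast
qed

end
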